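(* Let $L,m>0$, $2<p<6$, and let $r$ satisfy $r>\frac{2\alpha p+2}{4\alpha+4-p}$ for some $\alpha\in(0,1/2)$ with $4\alpha+4-p>0$. Then the generalized pressure $\log Z(\kappa,\beta,\lambda)$ is analytic in $(\kappa,\beta,\lambda)$ on a domain in $\mathbb{C}^3$ that includes all $(\kappa,\beta,\lambda)$ such that $\Re\beta>0$, $\Re\kappa>0$ and $|\Im\beta|$, $|\Im\kappa|$, $|\Im\lambda|$ are sufficiently small (depending on $\Re\kappa$, $\Re\beta$ and $\Re\lambda$).
   Context: $\mathbb{T}^1$ is the circle of circumference $L$, $\Delta$ its Laplacian, $\Omega=C(\mathbb{T}^1)$ the space of continuous complex-valued functions on it, and $\|\cdot\|_q$ the norm of $L^q(\mathbb{T}^1)$. For $\beta>0$ and $k\in\mathbb{Z}$ let $u_k(x)=L^{-1/2}e^{2\pi i kx/L}$ and $\theta_k=\beta((2\pi k/L)^2+m^2)$. $\mu_\beta$ is the centered Gaussian probability measure on $\Omega$ with covariance $\beta^{-1}(m^2-\Delta)^{-1}$; that is, under $\mu_\beta$ the Fourier coefficients $X_k=\langle u_k,\phi\rangle_{L^2}$ are independent, and the law of $X_k$ on $\mathbb{C}\cong\mathbb{R}^2$ has density $\frac{\theta_k}{2\pi}e^{-\theta_k|x|^2/2}$. The generalized grand-canonical partition function is, for $\beta>0$, $$Z(\kappa,\beta,\lambda)=\int_\Omega\exp\left[\beta\left(\frac{\lambda}{p}\|\phi\|_p^p+\frac{m^2}{2}\|\phi\|_2^2-\frac{\kappa}{r}\|\phi\|_2^{2r}\right)\right]d\mu_\beta,$$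 which by the change of variables $\psi=\sqrt\beta\,\phi$ equals $$\int_\Omega\exp\left[\frac{\lambda\beta^{1-p/2}}{p}\|\psi\|_p^p+\frac{m^2}{2}\|\psi\|_2^2-\frac{\beta^{1-r}\kappa}{r}\|\psi\|_2^{2r}\right]d\mu_1(\psi).$$ For complex arguments with $\Re\beta>0$ and $\Re(\beta^{1-r}\kappa)>0$ (principal branches), $Z$ is defined by this last formula. $Z>0$ for $\beta>0$, $\kappa>0$, $\lambda\in\mathbb{R}$, and $\log Z$ denotes the branch that is real there. *)

theory Defs
  imports "HOL-Probability.Probability"
begin

text \<open>
  The circle of circumference \<open>L\<close> is \<open>\<real>\<close> modulo \<open>L\<close>: functions on it are \<open>L\<close>-periodic functions
  on the line and integrals run over one period. A continuous periodic function is bounded, so the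
  following set is all of \<open>C(T\<^sup>1)\<close>, and the metric inherited from the type is the supremum metric.
\<close>

definition circle_functions :: "real \<Rightarrow> (real \<Rightarrow>\<^sub>C complex) set" where
  "circle_functions L = {\<phi>. \<forall>x. apply_bcontfun \<phi> (x + L) = apply_bcontfun \<phi> x}"

definition circle_norm :: "real \<Rightarrow> real \<Rightarrow> (real \<Rightarrow>\<^sub>C complex) \<Rightarrow> real" where
  "circle_norm L q \<phi> = (LBINT x:{0..L}. cmod (apply_bcontfun \<phi> x) powr q) powr (1 / q)"

definition fourier_mode :: "real \<Rightarrow> int \<Rightarrow> real \<Rightarrow> complex" where
  "fourier_mode L k x = of_real (L powr (-1/2)) * exp (\<i> * of_real (2 * pi * of_int k * x / L))"

definition fourier_coeff :: "real \<Rightarrow> int \<Rightarrow> (real \<Rightarrow>\<^sub>C complex) \<Rightarrow> complex" where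
  "fourier_coeff L k \<phi> = (LBINT x:{0..L}. cnj (fourier_mode L k x) * apply_bcontfun \<phi> x)"

definition mode_weight :: "real \<Rightarrow> real \<Rightarrow> real \<Rightarrow> int \<Rightarrow> real" where
  "mode_weight L m \<beta> k = \<beta> * ((2 * pi * of_int k / L)\<^sup>2 + m\<^sup>2)"

text \<open>
  The centered Gaussian measure with covariance \<open>\<beta>\<^sup>-\<^sup>1 (m\<^sup>2 - \<Delta>)\<^sup>-\<^sup>1\<close>, as a Borel probability measure
  on \<open>C(T\<^sup>1)\<close>. Since the Fourier coefficients separate points and generate the Borel sets
  of \<open>C(T\<^sup>1)\<close>, the predicate determines the measure.
\<close>

definition gaussian_field :: "real \<Rightarrow> real \<Rightarrow> real \<Rightarrow> (real \<Rightarrow>\<^sub>C complex) measure \<Rightarrow> bool" where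
  "gaussian_field L m \<beta> M \<longleftrightarrow>
     prob_space M \<and>
     sets M = sets (restrict_space borel (circle_functions L)) \<and>
     prob_space.indep_vars M (\<lambda>_. borel) (fourier_coeff L) UNIV \<and>
     (\<forall>k. distributed M lborel (fourier_coeff L k)
        (\<lambda>z. ennreal (mode_weight L m \<beta> k / (2 * pi) * exp (- mode_weight L m \<beta> k * (cmod z)\<^sup>2 / 2))))"

text \<open>
  The partition function for real arguments; the measure \<open>M\<close> is the Gaussian field at inverse
  temperature \<open>\<beta>\<close>.
\<close>

definition partition_function ::
    "real \<Rightarrow> real \<Rightarrow> real \<Rightarrow> real \<Rightarrow> (real \<Rightarrow>\<^sub>C complex) measure \<Rightarrow> real \<Rightarrow> real \<Rightarrow> real \<Rightarrow> real" where
  "partition_function L m p r M \<kappa> \<beta> \<Lambda> =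
     (LINT \<phi>|M. exp (\<beta> * (\<Lambda> / p * circle_norm L p \<phi> powr p
        + m\<^sup>2 / 2 * (circle_norm L 2 \<phi>)\<^sup>2
        - \<kappa> / r * circle_norm L 2 \<phi> powr (2 * r))))"

text \<open>
  The partition function for complex arguments with \<open>Re \<beta> > 0\<close> and \<open>Re (\<beta> powr (1 - r) * \<kappa>) > 0\<close>;
  here the measure \<open>M\<close> is the Gaussian field at inverse temperature \<open>1\<close>.
\<close>

definition partition_function_complex ::
    "real \<Rightarrow> real \<Rightarrow> real \<Rightarrow> real \<Rightarrow> (real \<Rightarrow>\<^sub>C complex) measure \<Rightarrow>
       complex \<Rightarrow> complex \<Rightarrow> complex \<Rightarrow> complex" where
  "partition_function_complex L m p r M \<kappa> \<beta> \<Lambda> =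
     (LINT \<psi>|M. exp (\<Lambda> * \<beta> powr of_real (1 - p / 2) / of_real p
          * of_real (circle_norm L p \<psi> powr p)
        + of_real (m\<^sup>2 / 2 * (circle_norm L 2 \<psi>)\<^sup>2)
        - \<beta> powr of_real (1 - r) * \<kappa> / of_real r
          * of_real (circle_norm L 2 \<psi> powr (2 * r))))"

text \<open>
  Analyticity in three complex variables: near every point of \<open>D\<close> the function is the sum of a
  power series converging (unconditionally) on a polydisc. Intended for open \<open>D\<close>.
\<close>

definition analytic3_on ::
    "(complex \<times> complex \<times> complex \<Rightarrow> complex) \<Rightarrow> (complex \<times> complex \<times> complex) set \<Rightarrow> bool" where
  "analytic3_on F D \<longleftrightarrow>
     (\<forall>(a, b, c) \<in> D. \<exists>\<rho>>0. \<exists>C :: nat \<times> nat \<times> nat \<Rightarrow> complex. \<forall>x y z.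
        cmod (x - a) < \<rho> \<and> cmod (y - b) < \<rho> \<and> cmod (z - c) < \<rho> \<longrightarrow>
        ((\<lambda>(i, j, k). C (i, j, k) * (x - a) ^ i * (y - b) ^ j * (z - c) ^ k)
           has_sum F (x, y, z)) UNIV)"

end

theory Submission
  imports Defs "HOL-Complex_Analysis.Complex_Analysis"
begin

text \<open>
  The heart of the matter is that \<open>exp (A P + (m\<^sup>2/2) N - B N\<^sup>r)\<close> is integrable under \<open>\<mu>\<^sub>1\<close> for all real
  \<open>A\<close> and all \<open>B > 0\<close>, where \<open>P\<close> is the \<open>p\<close>-th power of the \<open>L\<^sup>p\<close> norm and \<open>N\<close> the square of the
  \<open>L\<^sup>2\<close> norm. Increments are centered Gaussian with variance of order \<open>|x - y|\<close>, so
  \<open>W = \<integral>\<integral> exp (|\<phi>(x + s) - \<phi>(x)|\<^sup>2 / (16 s)) ds dx\<close> has finite expectation. Conversely, if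
  \<open>|\<phi>(x)|\<^sup>2\<close> exceeds \<open>8 N / h\<close>, then \<open>|\<phi>|\<close> must drop to half of that value on half of the window
  \<open>[x, x + h]\<close>, which costs at least \<open>(h/2) exp (|\<phi>(x)|\<^sup>2 / (64 h))\<close> in \<open>W\<close>. With
  \<open>Y = ln (C\<^sub>0 + W)\<close> and \<open>h\<close> a small multiple of \<open>Y\<close> to the power \<open>-(p-2)/(p+2)\<close> this gives
  \<open>A P + (m\<^sup>2/2) N \<le> Y + B N\<^sup>r + C\<close> as soon as \<open>r > (p+2)/(6-p)\<close>, which is the limit of the
  hypothesis as \<open>\<alpha>\<close> tends to \<open>1/2\<close>.

  Domination makes \<open>Z\<close> continuous and holomorphic in each variable, hence analytic by Osgood's lemma.
  On the connected component of \<open>Re Z > 0\<close> that contains the real points the principal logarithm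
  of \<open>Z\<close> is the required branch.
\<close>

section \<open>Fejer means\<close>

text \<open>The Gaussian field is given only through the law of its Fourier coefficients, while the
  argument is about point values, and the Fourier series of a continuous function may diverge at a
  point. Fejer means bridge this gap. They converge everywhere, so they carry Laplace transform
  bounds from coefficients to increments by Fatou's lemma, they make evaluation jointly measurable,
  and they express \<open>P\<close> and \<open>N\<close> through the coefficients, which is how the
  fields at inverse temperatures \<beta> and 1 are compared.

  The exponent (p+2)/(6-p) is dictated by scaling. A bump of height a and width h has N of order a^2
  h and P of order a^p h, and it costs about E = a^2/h in the Gaussian weight. Eliminating a and h
  gives P of order N^((p+2)/4) E^((p-2)/4), and for p < 6 Young's inequality trades the power of E
  for N^((p+2)/(6-p)). Choosing \<open>h\<close> as a function of \<open>Y\<close> alone leads to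
  the same exponent.\<close>

definition fejer :: "real \<Rightarrow> (int \<Rightarrow> complex) \<Rightarrow> nat \<Rightarrow> real \<Rightarrow> complex" where
  "fejer L X n x =
     (\<Sum>j<n. \<Sum>l<n. X (int j - int l) * fourier_mode L (int j - int l) x) / of_nat n"

text \<open>The kernel of the double sum in \<open>fejer\<close>, in which frequency k has weight n
  - |k|. As the squared modulus of a geometric sum it is visibly nonnegative, and the closed form of
  that sum gives its decay.\<close>

definition fejer_kernel :: "real \<Rightarrow> nat \<Rightarrow> real \<Rightarrow> real" where
  "fejer_kernel L n t = (cmod (\<Sum>j<n. cis (real j * (2 * pi * t / L))))\<^sup>2 / (L * n)"

lemma double_sum_cis:
  "(\<Sum>j<n. \<Sum>l<n. cis (of_int (int j - int l) * t)) = of_real ((cmod (\<Sum>j<n. cis (real j * t)))\<^sup>2)"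
  unfolding complex_norm_square sum_product cnj_sum
proof (intro sum.cong refl)
  fix j l :: nat
  have "cis (of_int (int j - int l) * t) = cis (real j * t + - (real l * t))" by (simp add: algebra_simps)
  thus "cis (of_int (int j - int l) * t) = cis (real j * t) * cnj (cis (real l * t))"
    by (simp only: cis_mult cis_cnj)
qed

lemma fejer_kernel_nonneg: "L > 0 \<Longrightarrow> 0 \<le> fejer_kernel L n t"
  by (simp add: fejer_kernel_def)

text \<open>Multiplying the geometric sum by \<open>1 - cis u\<close> telescopes it to
  \<open>1 - cis u ^ n\<close>, of modulus at most 2. This is the decay away from the diagonal;
  measured by \<open>1 - cis\<close>, it is periodic and avoids distances modulo L.\<close>

lemma fejer_kernel_mult_le:
  assumes "L > 0" "n > 0"
  shows "fejer_kernel L n t * (cmod (1 - cis (2 * pi * t / L)))\<^sup>2 \<le> 4 / (L * n)"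
proof -
  let ?u = "2 * pi * t / L"
  have "(\<Sum>j<n. cis (real j * ?u)) = (\<Sum>j<n. cis ?u ^ j)"
    by (intro sum.cong refl) (rule Complex.DeMoivre[symmetric])
  hence "(1 - cis ?u) * (\<Sum>j<n. cis (real j * ?u)) = 1 - cis ?u ^ n"
    by (simp only: one_diff_power_eq)
  hence "cmod (\<Sum>j<n. cis (real j * ?u)) * cmod (1 - cis ?u) = cmod (1 - cis ?u ^ n)"
    by (metis mult.commute norm_mult)
  also have "\<dots> \<le> 2"
    using norm_triangle_ineq4[of 1 "cis ?u ^ n"] by (simp add: norm_power)
  finally have "(cmod (\<Sum>j<n. cis (real j * ?u)) * cmod (1 - cis ?u))\<^sup>2 \<le> 2\<^sup>2"
    by (intro power_mono) auto
  thus ?thesis using assms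
    by (simp add: fejer_kernel_def divide_right_mono power_mult_distrib del: of_nat_mult)
qed

lemma integral_cis_period:
  assumes "L > 0"
  shows "(LBINT y:{0..L}. cis (of_int k * (2 * pi * (x - y) / L))) = (if k = 0 then of_real L else 0)"
proof (cases "k = 0")
  case True thus ?thesis using assms by (simp add: set_lebesgue_integral_def scaleR_conv_of_real)
next
  case False
  define c where "c = \<i> * of_int k * (2 * pi / L)"
  have c: "c \<noteq> 0" using False assms by (auto simp: c_def)
  have e: "cis (of_int k * (2 * pi * (x - y) / L)) = exp (c * (x - y))" for y
    using assms by (simp add: cis_conv_exp c_def algebra_simps)
  have "(LBINT y:{0..L}. exp (c * (x - y))) = - exp (c * (x - L)) / c - (- exp (c * (x - 0)) / c)"
    unfolding set_lebesgue_integral_def using assms c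
  proof (intro integral_FTC_atLeastAtMost)
    fix y :: real
    have "((\<lambda>z. - exp (c * (x - z)) / c) has_field_derivative exp (c * (x - y))) (at (of_real y))"
      using c by (auto intro!: derivative_eq_intros)
    from has_vector_derivative_real_field[OF this]
    show "((\<lambda>y. - exp (c * (x - y)) / c) has_vector_derivative exp (c * (x - y))) (at y within {0..L})"
      by (auto simp: o_def intro: has_vector_derivative_at_within)
  qed (auto intro!: continuous_intros)
  also have "c * (x - L) = c * x + of_int (2 * (- k)) * pi * \<i>"
    using assms by (simp add: c_def field_simps)
  also have "exp (c * x + of_int (2 * (- k)) * pi * \<i>) = exp (c * x)"
    unfolding exp_eq by (intro exI[of _ "-k"]) simp
  finally show ?thesis unfolding e using False by simp
qed

lemma cis_eq_fourier_mode:
  assumes "L > 0"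
  shows "cnj (fourier_mode L k y) * fourier_mode L k x = cis (of_int k * (2 * pi * (x - y) / L)) / L"
proof -
  have "L powr (-1/2) * L powr (-1/2) = 1 / L"
    using assms by (simp add: powr_minus_divide flip: powr_add)
  hence "of_real (L powr (-1/2)) * of_real (L powr (-1/2)) = (1 / of_real L :: complex)"
    by (simp flip: of_real_mult)
  moreover have "cnj (fourier_mode L k y) * fourier_mode L k x
    = (of_real (L powr (-1/2)) * of_real (L powr (-1/2))) * cis (of_int k * (2 * pi * (x - y) / L))"
    by (simp add: fourier_mode_def exp_cnj cis_conv_exp diff_divide_distrib algebra_simps flip: exp_add)
  ultimately show ?thesis by simp
qed

lemma continuous_apply_bcontfun [continuous_intros]:
  assumes "continuous_on A f" shows "continuous_on A (\<lambda>x. apply_bcontfun \<phi> (f x))"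
proof -
  have "continuous_on UNIV (apply_bcontfun \<phi>)" using apply_bcontfun[of \<phi>] by (simp add: bcontfun_def)
  from continuous_on_compose2[OF this assms] show ?thesis by auto
qed

lemma set_integral_double_sum:
  fixes g :: "int \<Rightarrow> real \<Rightarrow> complex"
  assumes "\<And>k. set_integrable lborel A (g k)"
  shows "(\<Sum>j<n. \<Sum>l<n. LBINT y:A. g (int j - int l) y) / c
    = (LBINT y:A. (\<Sum>j<n. \<Sum>l<n. g (int j - int l) y) / c)"
proof -
  define f where "f k y = indicator A y *\<^sub>R g k y" for k y
  have [simp]: "integrable lborel (f k)" for k
    using assms[of k] unfolding set_integrable_def f_def .
  have "(LBINT y:A. (\<Sum>j<n. \<Sum>l<n. g (int j - int l) y) / c)
     = (LBINT y. (\<Sum>j<n. \<Sum>l<n. f (int j - int l) y) / c)"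
    unfolding set_lebesgue_integral_def f_def
    by (simp only: scaleR_conv_of_real sum_distrib_left sum_divide_distrib times_divide_eq_right)
  also have "\<dots> = (\<Sum>j<n. \<Sum>l<n. LBINT y. f (int j - int l) y) / c" by simp
  finally show ?thesis unfolding set_lebesgue_integral_def f_def ..
qed

lemma continuous_fejer_kernel [continuous_intros]:
  "continuous_on A (\<lambda>y. fejer_kernel L n (x - y))"
  unfolding fejer_kernel_def divide_inverse by (intro continuous_intros)

lemma fejer_fourier_coeff:
  assumes L: "L > 0"
  shows "fejer L (\<lambda>k. fourier_coeff L k \<phi>) n x =
    (LBINT y:{0..L}. of_real (fejer_kernel L n (x - y)) * apply_bcontfun \<phi> y)"
proof -
  define g where "g k y = cis (of_int k * (2 * pi * (x - y) / L)) / L * apply_bcontfun \<phi> y" for k y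
  have int: "set_integrable lborel {0..L} (g k)" for k
    unfolding g_def using L by (intro borel_integrable_atLeastAtMost') (auto intro!: continuous_intros simp: cis_conv_exp)
  have "fourier_coeff L k \<phi> * fourier_mode L k x
      = (LBINT y:{0..L}. (cnj (fourier_mode L k y) * fourier_mode L k x) * apply_bcontfun \<phi> y)" for k
    unfolding fourier_coeff_def set_integral_mult_left[symmetric] by (simp add: mult_ac)
  hence "fourier_coeff L k \<phi> * fourier_mode L k x = (LBINT y:{0..L}. g k y)" for k
    unfolding cis_eq_fourier_mode[OF L] g_def .
  hence "fejer L (\<lambda>k. fourier_coeff L k \<phi>) n x = (\<Sum>j<n. \<Sum>l<n. LBINT y:{0..L}. g (int j - int l) y) / n"
    by (simp add: fejer_def)
  also have "\<dots> = (LBINT y:{0..L}. (\<Sum>j<n. \<Sum>l<n. g (int j - int l) y) / n)"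
    using int by (rule set_integral_double_sum)
  also have "(\<lambda>y. (\<Sum>j<n. \<Sum>l<n. g (int j - int l) y) / n)
      = (\<lambda>y. of_real (fejer_kernel L n (x - y)) * apply_bcontfun \<phi> y)"
    unfolding g_def fejer_kernel_def sum_distrib_right[symmetric] sum_divide_distrib[symmetric]
      double_sum_cis by simp
  finally show ?thesis .
qed

lemma integral_fejer_kernel:
  assumes L: "L > 0" and n: "n > 0"
  shows "(LBINT y:{0..L}. fejer_kernel L n (x - y)) = 1"
proof -
  define g where "g k y = cis (of_int k * (2 * pi * (x - y) / L))" for k y
  have int: "set_integrable lborel {0..L} (g k)" for k
    unfolding g_def using L by (intro borel_integrable_atLeastAtMost') (auto intro!: continuous_intros simp: cis_conv_exp)
  have "(\<Sum>j<n. \<Sum>l<n. LBINT y:{0..L}. g (int j - int l) y) / (L * n)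
      = (LBINT y:{0..L}. (\<Sum>j<n. \<Sum>l<n. g (int j - int l) y) / (L * n))"
    using int by (rule set_integral_double_sum)
  also have "(\<lambda>y. (\<Sum>j<n. \<Sum>l<n. g (int j - int l) y) / (L * n)) = (\<lambda>y. of_real (fejer_kernel L n (x - y)))"
    unfolding g_def double_sum_cis fejer_kernel_def by simp
  also have "(LBINT y:{0..L}. complex_of_real (fejer_kernel L n (x - y))) = of_real (LBINT y:{0..L}. fejer_kernel L n (x - y))"
    by (rule set_integral_complex_of_real)
  also have "(\<Sum>j<n. \<Sum>l<n. LBINT y:{0..L}. g (int j - int l) y) = (\<Sum>j<n. \<Sum>l<n. if l = j then of_real L else 0)"
    unfolding g_def integral_cis_period[OF L] by (intro sum.cong) auto
  also have "\<dots> = of_real (n * L)" by simp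
  finally have "complex_of_real (LBINT y:{0..L}. fejer_kernel L n (x - y)) = 1"
    using L n by simp
  thus ?thesis by (simp only: of_real_eq_1_iff)
qed

lemma periodic_int:
  assumes "\<And>x::real. f (x + L) = f x"
  shows "f (x + of_int k * L) = f x"
proof (induction k arbitrary: x rule: int_induct[where k = 0])
  case (step1 i) thus ?case using assms[of "x + of_int i * L"] by (simp add: algebra_simps)
next
  case (step2 i) thus ?case using assms[of "x + of_int (i - 1) * L"] by (simp add: algebra_simps)
qed auto

text \<open>The modulus of continuity at \<open>x\<close> is expressed through \<open>1 - cis\<close>, which cancels against the kernel.\<close>
lemma periodic_modulus:
  assumes L: "L > 0" and \<phi>: "\<phi> \<in> circle_functions L" and e: "e > 0"
  shows "\<exists>C\<ge>0. \<forall>y\<in>{0..L}. cmod (apply_bcontfun \<phi> y - apply_bcontfun \<phi> x)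
           \<le> e + C * (cmod (1 - cis (2 * pi * (x - y) / L)))\<^sup>2"
proof -
  let ?f = "apply_bcontfun \<phi>"
  let ?K = "{0..L} \<inter> {y. e \<le> cmod (?f y - ?f x)}"
  let ?d = "\<lambda>y. (cmod (1 - cis (2 * pi * (x - y) / L)))\<^sup>2"
  let ?q = "\<lambda>y. cmod (?f y - ?f x) / ?d y"
  have per: "?f (y + of_int k * L) = ?f y" for y k
    by (rule periodic_int) (use \<phi> in \<open>auto simp: circle_functions_def\<close>)
  \<comment> \<open>The periodic distance vanishes only if x - y is a multiple of L, and then
    periodicity makes the two values equal, contrary to the definition of \<open>?K\<close>. On the
    compact set \<open>?K\<close> the quotient \<open>?q\<close> is therefore continuous, hence
    bounded.\<close>
  have dpos: "?d y > 0" if "y \<in> ?K" for y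
  proof (rule ccontr)
    assume "\<not> ?d y > 0"
    hence "cis (2 * pi * (x - y) / L) = 1" by simp
    hence "cos (2 * pi * (x - y) / L) = 1" by (metis cis.sel(1) one_complex.sel(1))
    then obtain k :: int where "2 * pi * (x - y) / L = of_int k * 2 * pi"
      by (auto simp: cos_one_2pi_int)
    hence "2 * pi * ((x - y) / L) = 2 * pi * of_int k" by (simp add: mult_ac)
    hence "(x - y) / L = of_int k" using pi_neq_zero by (simp only: mult_cancel_left) simp
    hence "x = y + of_int k * L" using L by (simp add: field_simps)
    hence "?f x = ?f y" using per[of y k] by simp
    thus False using that e by simp
  qed
  have "compact ?K"
    by (intro compact_Int_closed closed_Collect_le) (auto intro!: continuous_intros)
  moreover have "continuous_on ?K ?q"
    using L dpos by (intro continuous_intros ballI) (simp, metis less_irrefl)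
  ultimately have "bounded (?q ` ?K)" by (intro compact_imp_bounded compact_continuous_image)
  then obtain C where C: "\<And>y. y \<in> ?K \<Longrightarrow> \<bar>?q y\<bar> \<le> C" unfolding bounded_iff by fastforce
  show ?thesis
  proof (intro exI[of _ "max C 0"] conjI ballI)
    fix y assume y: "y \<in> {0..L}"
    show "cmod (?f y - ?f x) \<le> e + max C 0 * ?d y"
    proof (cases "y \<in> ?K")
      case True
      hence "cmod (?f y - ?f x) = ?q y * ?d y" using dpos[OF True] by simp
      also have "\<dots> \<le> max C 0 * ?d y" using C[OF True] by (intro mult_right_mono) auto
      finally show ?thesis using e by simp
    next
      case False thus ?thesis using y by (auto simp: add_increasing2)
    qed
  qed auto
qed

text \<open>Because the kernel has mass 1, the error is the integral of the kernel against the
  increment from x. The modulus of continuity splits it into e/2 times the mass and a part that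
  \<open>fejer_kernel_mult_le\<close> bounds uniformly in y.\<close>

theorem fejer_tendsto:
  assumes L: "L > 0" and \<phi>: "\<phi> \<in> circle_functions L"
  shows "(\<lambda>n. fejer L (\<lambda>k. fourier_coeff L k \<phi>) n x) \<longlonglongrightarrow> apply_bcontfun \<phi> x"
proof (rule LIMSEQ_I)
  let ?f = "apply_bcontfun \<phi>"
  fix e :: real assume "e > 0"
  hence e2: "e / 2 > 0" by simp
  from periodic_modulus[OF L \<phi> e2, of x] obtain C where C: "C \<ge> 0"
    and mod: "\<And>y. y \<in> {0..L} \<Longrightarrow> cmod (?f y - ?f x) \<le> e/2 + C * (cmod (1 - cis (2 * pi * (x - y) / L)))\<^sup>2"
    by blast
  \<comment> \<open>Integrating \<open>C * (4 / (L * n))\<close> over one period leaves 4 C / n,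
    which has to be below e / 2.\<close>
  obtain n0 :: nat where n0: "8 * C / e < n0" using reals_Archimedean2 by blast
  show "\<exists>no. \<forall>n\<ge>no. norm (fejer L (\<lambda>k. fourier_coeff L k \<phi>) n x - ?f x) < e"
  proof (intro exI[of _ "max 1 n0"] allI impI)
    fix n assume "max 1 n0 \<le> n"
    hence n: "n > 0" "n0 \<le> n" by auto
    let ?K = "\<lambda>y. fejer_kernel L n (x - y)"
    have K: "continuous_on {0..L} ?K" by (intro continuous_intros)
    have iK: "set_integrable lborel {0..L} ?K"
      by (intro borel_integrable_atLeastAtMost' K)
    have ff: "set_integrable lborel {0..L} (\<lambda>y. of_real (?K y) * ?f y)"
      by (intro borel_integrable_atLeastAtMost' continuous_intros K)
    have fc: "set_integrable lborel {0..L} (\<lambda>y. of_real (?K y) * ?f x)"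
      by (intro borel_integrable_atLeastAtMost' continuous_intros K)
    have "fejer L (\<lambda>k. fourier_coeff L k \<phi>) n x - ?f x
        = (LBINT y:{0..L}. of_real (?K y) * ?f y) - (LBINT y:{0..L}. of_real (?K y) * ?f x)"
      using integral_fejer_kernel[OF L n(1), of x]
      by (simp add: fejer_fourier_coeff[OF L] set_integral_complex_of_real)
    also have "\<dots> = (LBINT y:{0..L}. of_real (?K y) * ?f y - of_real (?K y) * ?f x)"
      by (rule set_integral_diff(2)[OF ff fc, symmetric])
    also have "cmod \<dots> \<le> (LBINT y:{0..L}. cmod (of_real (?K y) * ?f y - of_real (?K y) * ?f x))"
      by (intro set_integral_norm_bound set_integral_diff ff fc)
    also have "\<dots> \<le> (LBINT y:{0..L}. (e/2) * ?K y + C * (4 / (L * n)))"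
    proof (intro set_integral_mono set_integrable_norm set_integral_diff ff fc)
      fix y assume y: "y \<in> {0..L}"
      have "cmod (of_real (?K y) * ?f y - of_real (?K y) * ?f x) = ?K y * cmod (?f y - ?f x)"
        using fejer_kernel_nonneg[OF L] by (simp add: norm_mult flip: right_diff_distrib)
      also have "\<dots> \<le> ?K y * (e/2 + C * (cmod (1 - cis (2 * pi * (x - y) / L)))\<^sup>2)"
        by (intro mult_left_mono mod y fejer_kernel_nonneg L)
      also have "\<dots> = (e/2) * ?K y + C * (?K y * (cmod (1 - cis (2 * pi * (x - y) / L)))\<^sup>2)"
        by (simp add: algebra_simps)
      also have "\<dots> \<le> (e/2) * ?K y + C * (4 / (L * n))"
        by (intro add_left_mono mult_left_mono fejer_kernel_mult_le C L n)
      finally show "cmod (of_real (?K y) * ?f y - of_real (?K y) * ?f x) \<le> \<dots>" .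
    qed (intro borel_integrable_atLeastAtMost' continuous_intros K)
    also have "\<dots> = (e/2) * (LBINT y:{0..L}. ?K y) + (LBINT y:{0..L}. C * (4 / (L * n)))"
      by (subst set_integral_add) (auto intro!: iK borel_integrable_atLeastAtMost' continuous_intros)
    also have "\<dots> = e/2 + 4 * C / n"
      using L n integral_fejer_kernel[OF L n(1), of x] by (simp add: set_lebesgue_integral_def)
    also have "4 * C / n < e / 2"
    proof -
      have "8 * C < n0 * e" using n0 \<open>e > 0\<close> by (simp add: field_simps)
      also have "\<dots> \<le> n * e" using n \<open>e > 0\<close> by (intro mult_right_mono) auto
      finally show ?thesis using n by (simp add: field_simps)
    qed
    finally show "norm (fejer L (\<lambda>k. fourier_coeff L k \<phi>) n x - ?f x) < e" by simp
  qed
qed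

section \<open>Increments of the Gaussian field\<close>

lemma mode_weight_pos: "m > 0 \<Longrightarrow> \<beta> > 0 \<Longrightarrow> mode_weight L m \<beta> k > 0"
  by (simp add: mode_weight_def add_nonneg_pos)

lemma gaussian_field_laplace_mode:
  fixes w :: complex
  assumes "m > 0" "\<beta> > 0" and G: "gaussian_field L m \<beta> M"
  shows "(\<integral>\<^sup>+\<phi>. exp (Re (w * fourier_coeff L k \<phi>)) \<partial>M)
    = exp ((cmod w)\<^sup>2 / (2 * mode_weight L m \<beta> k))"
proof -
  define \<theta> where "\<theta> = mode_weight L m \<beta> k"
  have \<theta>: "\<theta> > 0" unfolding \<theta>_def by (intro mode_weight_pos assms)
  interpret prob_space M using G by (simp add: gaussian_field_def)
  define f where "f z = ennreal (\<theta> / (2 * pi) * exp (- \<theta> * (cmod z)\<^sup>2 / 2))" for z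
  have D: "distributed M lborel (fourier_coeff L k) f"
    using G unfolding gaussian_field_def f_def \<theta>_def by blast
  have [measurable]: "f \<in> borel_measurable borel" unfolding f_def by measurable
  \<comment> \<open>Completing the square in the exponent moves the centre of the Gaussian to
    \<open>c\<close>; translation invariance of Lebesgue measure then removes the shift.\<close>
  define c where "c = cnj w / \<theta>"
  \<comment> \<open>The mass of the density is read off from the probability measure instead of
    evaluating a Gaussian integral.\<close>
  have mass: "(\<integral>\<^sup>+z. f z \<partial>lborel) = 1"
    using distributed_nn_integral[OF D, of "\<lambda>_. 1"] by (simp add: emeasure_space_1)
  have eq: "f z * ennreal (exp (Re (w * z))) = ennreal (exp ((cmod w)\<^sup>2 / (2 * \<theta>))) * f (- c + z)" for z
  proof -
    have "- \<theta> * (cmod z)\<^sup>2 / 2 + Re (w * z) = (cmod w)\<^sup>2 / (2 * \<theta>) + - \<theta> * (cmod (- c + z))\<^sup>2 / 2"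
      using \<theta> unfolding c_def cmod_power2
      by (simp add: field_simps power2_eq_square)
    hence "exp (- \<theta> * (cmod z)\<^sup>2 / 2) * exp (Re (w * z))
      = exp ((cmod w)\<^sup>2 / (2 * \<theta>)) * exp (- \<theta> * (cmod (- c + z))\<^sup>2 / 2)"
      by (simp only: exp_add[symmetric])
    thus ?thesis using \<theta> unfolding f_def
      by (subst (1 2) ennreal_mult[symmetric]) (simp_all add: mult_ac)
  qed
  have "(\<integral>\<^sup>+\<phi>. exp (Re (w * fourier_coeff L k \<phi>)) \<partial>M) = (\<integral>\<^sup>+z. f z * ennreal (exp (Re (w * z))) \<partial>lborel)"
    by (rule distributed_nn_integral[OF D, symmetric]) measurable
  also have "\<dots> = ennreal (exp ((cmod w)\<^sup>2 / (2 * \<theta>))) * (\<integral>\<^sup>+z. f (- c + z) \<partial>lborel)"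
    unfolding eq by (rule nn_integral_cmult) measurable
  also have "(\<integral>\<^sup>+z. f (- c + z) \<partial>lborel) = (\<integral>\<^sup>+z. f z \<partial>distr lborel borel ((+) (- c)))"
    by (subst nn_integral_distr) auto
  also have "\<dots> = 1" by (simp add: lborel_distr_plus mass)
  finally show ?thesis by (simp add: \<theta>_def)
qed

lemma gaussian_field_measurable_coeff:
  assumes "gaussian_field L m \<beta> M"
  shows "fourier_coeff L k \<in> borel_measurable M"
proof -
  have "fourier_coeff L k \<in> measurable M lborel"
    using assms unfolding gaussian_field_def by (blast intro: distributed_measurable)
  thus ?thesis by simp
qed

lemma gaussian_field_laplace_sum:
  assumes "m > 0" "\<beta> > 0" and G: "gaussian_field L m \<beta> M" and S: "finite S"
  shows "(\<integral>\<^sup>+\<phi>. exp (\<Sum>k\<in>S. Re (w k * fourier_coeff L k \<phi>)) \<partial>M)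
    = exp (\<Sum>k\<in>S. (cmod (w k))\<^sup>2 / (2 * mode_weight L m \<beta> k))"
proof -
  interpret prob_space M using G by (simp add: gaussian_field_def)
  let ?Y = "\<lambda>k \<phi>. ennreal (exp (Re (w k * fourier_coeff L k \<phi>)))"
  have "indep_vars (\<lambda>_. borel) (fourier_coeff L) S"
    using G by (auto simp: gaussian_field_def intro: indep_vars_subset)
  hence "indep_vars (\<lambda>_. borel) ?Y S"
    by (rule indep_vars_compose2[where Y = "\<lambda>k z. ennreal (exp (Re (w k * z)))"]) measurable
  hence "(\<integral>\<^sup>+\<phi>. (\<Prod>k\<in>S. ?Y k \<phi>) \<partial>M) = (\<Prod>k\<in>S. \<integral>\<^sup>+\<phi>. ?Y k \<phi> \<partial>M)"
    using S by (intro indep_vars_nn_integral) auto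
  also have "\<dots> = (\<Prod>k\<in>S. ennreal (exp ((cmod (w k))\<^sup>2 / (2 * mode_weight L m \<beta> k))))"
    using assms by (intro prod.cong refl gaussian_field_laplace_mode)
  finally show ?thesis using S by (simp add: prod_ennreal exp_sum)
qed

text \<open>For fixed \<open>j\<close> the frequencies \<open>j - l\<close> are distinct, so Jensen's inequality over \<open>j\<close>
  reduces the Fejer mean to sums of independent variables.\<close>
lemma gaussian_field_laplace_fejer:
  fixes v :: "int \<Rightarrow> complex"
  assumes "m > 0" "\<beta> > 0" and G: "gaussian_field L m \<beta> M" and n: "n > 0"
    and B: "\<And>S. finite S \<Longrightarrow> (\<Sum>k\<in>S. (cmod (v k))\<^sup>2 / mode_weight L m \<beta> k) \<le> B"
  shows "(\<integral>\<^sup>+\<phi>. exp (Re ((\<Sum>j<n. \<Sum>l<n. fourier_coeff L (int j - int l) \<phi> * v (int j - int l)) / of_nat n)) \<partial>M)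
    \<le> exp (B / 2)"
proof -
  note [measurable] = gaussian_field_measurable_coeff[OF G]
  interpret prob_space M using G by (simp add: gaussian_field_def)
  define s where "s j \<phi> = (\<Sum>l<n. Re (v (int j - int l) * fourier_coeff L (int j - int l) \<phi>))" for j :: nat and \<phi>
  have [measurable]: "s j \<in> borel_measurable M" for j unfolding s_def by measurable
  have s: "(\<integral>\<^sup>+\<phi>. exp (s j \<phi>) \<partial>M) \<le> exp (B / 2)" for j
  proof -
    have inj: "inj_on (\<lambda>l::nat. int j - int l) {..<n}" by (auto simp: inj_on_def)
    let ?S = "(\<lambda>l::nat. int j - int l) ` {..<n}"
    have "s j \<phi> = (\<Sum>k\<in>?S. Re (v k * fourier_coeff L k \<phi>))" for \<phi>
      unfolding s_def by (subst sum.reindex[OF inj]) simp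
    hence "(\<integral>\<^sup>+\<phi>. exp (s j \<phi>) \<partial>M) = exp (\<Sum>k\<in>?S. (cmod (v k))\<^sup>2 / (2 * mode_weight L m \<beta> k))"
      using gaussian_field_laplace_sum[OF assms(1,2) G, of ?S v] by simp
    also have "(\<Sum>k\<in>?S. (cmod (v k))\<^sup>2 / (2 * mode_weight L m \<beta> k))
        = (\<Sum>k\<in>?S. (cmod (v k))\<^sup>2 / mode_weight L m \<beta> k) / 2"
      unfolding sum_divide_distrib by (intro sum.cong refl) simp
    also have "ennreal (exp \<dots>) \<le> exp (B / 2)" using B[of ?S] by simp
    finally show ?thesis .
  qed
  define h where "h = 1 / real n"
  have h: "h \<ge> 0" "real n * h = 1" using n by (auto simp: h_def)
  define H where "H \<phi> = Re ((\<Sum>j<n. \<Sum>l<n. fourier_coeff L (int j - int l) \<phi> * v (int j - int l)) / of_nat n)" for \<phi>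
  have le: "ennreal (exp (H \<phi>)) \<le> (\<Sum>j<n. ennreal h * ennreal (exp (s j \<phi>)))" for \<phi>
  proof -
    have "H \<phi> = (\<Sum>j<n. h *\<^sub>R s j \<phi>)"
      unfolding H_def h_def Re_divide_of_nat s_def Re_sum real_scaleR_def sum_distrib_left sum_divide_distrib
      by (intro sum.cong refl) (simp add: mult.commute)
    also have "exp \<dots> \<le> (\<Sum>j<n. h * exp (s j \<phi>))"
      using n h by (intro convex_on_sum[OF _ _ exp_convex]) auto
    finally have "ennreal (exp (H \<phi>)) \<le> ennreal (\<Sum>j<n. h * exp (s j \<phi>))"
      by (rule ennreal_leI)
    also have "\<dots> = (\<Sum>j<n. ennreal (h * exp (s j \<phi>)))"
      using h by (intro sum_ennreal[symmetric]) auto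
    also have "\<dots> = (\<Sum>j<n. ennreal h * ennreal (exp (s j \<phi>)))"
      using h by (intro sum.cong refl ennreal_mult) auto
    finally show ?thesis .
  qed
  have "(\<integral>\<^sup>+\<phi>. exp (H \<phi>) \<partial>M) \<le> (\<integral>\<^sup>+\<phi>. (\<Sum>j<n. ennreal h * ennreal (exp (s j \<phi>))) \<partial>M)"
    by (intro nn_integral_mono le)
  also have "\<dots> = (\<Sum>j<n. ennreal h * (\<integral>\<^sup>+\<phi>. exp (s j \<phi>) \<partial>M))"
    by (subst nn_integral_sum) (auto simp: nn_integral_cmult)
  also have "\<dots> \<le> (\<Sum>j<n. ennreal h * exp (B / 2))"
    by (intro sum_mono mult_left_mono s) auto
  also have "\<dots> = exp (B / 2)"
    using h by (simp add: ennreal_of_nat_eq_real_of_nat mult.assoc[symmetric] flip: ennreal_mult)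
  finally show ?thesis unfolding H_def .
qed

section \<open>Variance of an increment\<close>

lemma sum_inverse_square_le:
  assumes a: "a > 0"
  shows "(\<Sum>k=1..n. 1 / (a\<^sup>2 + (real k)\<^sup>2)) \<le> pi / (2 * a)"
proof -
  \<comment> \<open>Comparison with the integral of 1/(a^2 + x^2), whose antiderivative is
    arctan(x/a)/a. The mean value theorem replaces the integral, and the telescoped bound does not
    depend on n.\<close>
  have step: "1 / (a\<^sup>2 + (real (Suc k))\<^sup>2) \<le> (arctan (real (Suc k) / a) - arctan (real k / a)) / a" for k
  proof -
    have "\<exists>z. real k < z \<and> z < real (Suc k) \<and> arctan (real (Suc k) / a) - arctan (real k / a)
        = (real (Suc k) - real k) * (inverse (1 + (z / a)\<^sup>2) * (1 / a))"
      using a by (intro MVT2) (auto intro!: derivative_eq_intros)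
    then obtain z where z: "real k < z" "z < real (Suc k)"
      and eq: "arctan (real (Suc k) / a) - arctan (real k / a) = inverse (1 + (z / a)\<^sup>2) * (1 / a)"
      by auto
    have "1 + (z / a)\<^sup>2 = (a\<^sup>2 + z\<^sup>2) / a\<^sup>2"
      using a by (simp add: field_simps)
    hence "inverse (1 + (z / a)\<^sup>2) * (1 / a) / a = 1 / (a\<^sup>2 + z\<^sup>2)"
      using a by (simp add: power2_eq_square)
    moreover have "z\<^sup>2 \<le> (real (Suc k))\<^sup>2" using z by (intro power_mono) auto
    hence "1 / (a\<^sup>2 + (real (Suc k))\<^sup>2) \<le> 1 / (a\<^sup>2 + z\<^sup>2)"
      using a by (intro divide_left_mono add_left_mono mult_pos_pos) (auto simp: add_pos_nonneg)
    ultimately show ?thesis unfolding eq by simp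
  qed
  have "(\<Sum>k=1..n. 1 / (a\<^sup>2 + (real k)\<^sup>2)) \<le> arctan (real n / a) / a"
  proof (induction n)
    case (Suc n) thus ?case using step[of n] by (simp add: diff_divide_distrib)
  qed auto
  also have "\<dots> \<le> (pi / 2) / a" using a arctan_ubound[of "real n / a"] by (intro divide_right_mono) auto
  finally show ?thesis by simp
qed

text \<open>Frequency 0 is excluded because its term 1/a^2 is not of order 1/a for small a. In the
  application the constant mode cancels from increments.\<close>

lemma sum_int_inverse_square_le:
  assumes a: "a > 0" and S: "finite S" "0 \<notin> S"
  shows "(\<Sum>k\<in>S. 1 / (a\<^sup>2 + (real_of_int k)\<^sup>2)) \<le> pi / a"
proof -
  obtain n where n: "\<And>k. k \<in> S \<Longrightarrow> nat \<bar>k\<bar> \<le> n"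
    using finite_nat_set_iff_bounded_le[of "(\<lambda>k. nat \<bar>k\<bar>) ` S"] S by auto
  let ?f = "\<lambda>k::int. 1 / (a\<^sup>2 + (real_of_int k)\<^sup>2)"
  let ?P = "int ` {1..n}" and ?N = "(\<lambda>k. - int k) ` {1..n}"
  have "S \<subseteq> ?P \<union> ?N"
  proof
    fix k assume k: "k \<in> S"
    hence "nat \<bar>k\<bar> \<in> {1..n}" using n[OF k] S by (cases "k = 0") auto
    moreover have "k = int (nat \<bar>k\<bar>) \<or> k = - int (nat \<bar>k\<bar>)" by auto
    ultimately show "k \<in> ?P \<union> ?N" by blast
  qed
  hence "sum ?f S \<le> sum ?f (?P \<union> ?N)"
    by (intro sum_mono2) auto
  also have "\<dots> = sum ?f ?P + sum ?f ?N" by (intro sum.union_disjoint) auto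
  also have "sum ?f ?P = (\<Sum>k=1..n. 1 / (a\<^sup>2 + (real k)\<^sup>2))" by (subst sum.reindex) auto
  also have "sum ?f ?N = (\<Sum>k=1..n. 1 / (a\<^sup>2 + (real k)\<^sup>2))" by (subst sum.reindex) (auto simp: inj_on_def)
  moreover have "pi / (2 * a) + pi / (2 * a) = pi / a" by simp
  ultimately show ?thesis using sum_inverse_square_le[OF a, of n] by linarith
qed

text \<open>With t = x - y the left side is 4 sin^2(t/2), hence at most both t^2 and 4. The right
  side is the harmonic mean of these two bounds, which dominates their minimum. This rational form
  makes it unnecessary to split the frequencies into low and high ones.\<close>

lemma norm_exp_diff_sq_le:
  "(cmod (exp (\<i> * of_real x) - exp (\<i> * of_real y)))\<^sup>2 \<le> 8 * (x - y)\<^sup>2 / (4 + (x - y)\<^sup>2)"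
proof -
  define t where "t = x - y"
  have "exp (\<i> * of_real x) - exp (\<i> * of_real y) = exp (\<i> * of_real y) * (exp (\<i> * of_real t) - 1)"
    by (simp add: t_def algebra_simps flip: exp_add)
  hence "(cmod (exp (\<i> * of_real x) - exp (\<i> * of_real y)))\<^sup>2 = (2 * \<bar>sin (t / 2)\<bar>)\<^sup>2"
    by (simp add: norm_mult dist_exp_i_1)
  hence eq: "(cmod (exp (\<i> * of_real x) - exp (\<i> * of_real y)))\<^sup>2 = 4 * (sin (t / 2))\<^sup>2"
    by (simp add: power_mult_distrib)
  have "\<bar>sin (t/2)\<bar>\<^sup>2 \<le> \<bar>t/2\<bar>\<^sup>2" by (intro power_mono abs_sin_x_le_abs_x) auto
  hence 1: "4 * (sin (t/2))\<^sup>2 \<le> t\<^sup>2" by (simp add: power_divide)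
  have 2: "(sin (t/2))\<^sup>2 \<le> 1" by (simp add: abs_square_le_1)
  have "4 * (sin (t/2))\<^sup>2 * (4 + t\<^sup>2) = 4 * (4 * (sin (t/2))\<^sup>2) + 4 * ((sin (t/2))\<^sup>2 * t\<^sup>2)"
    by (simp add: algebra_simps)
  also have "\<dots> \<le> 4 * t\<^sup>2 + 4 * (1 * t\<^sup>2)" using 1 2 by (intro add_mono mult_left_mono mult_right_mono) auto
  finally have "4 * (sin (t/2))\<^sup>2 * (4 + t\<^sup>2) \<le> 8 * t\<^sup>2" by simp
  hence "4 * (sin (t/2))\<^sup>2 \<le> 8 * t\<^sup>2 / (4 + t\<^sup>2)"
    by (subst pos_le_divide_eq) (auto simp: add_pos_nonneg)
  thus ?thesis unfolding eq t_def .
qed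

text \<open>The weight is bounded below by \<beta> q^2 with q the frequency. This q^2 cancels
  against the numerator and leaves a multiple of 1/(a^2 + k^2), whose sum over k is of order 1/a,
  that is, of order |x - y|.\<close>

lemma mode_increment_variance_le:
  assumes L: "L > 0" and m: "m > 0" and \<beta>: "\<beta> > 0" and S: "finite S"
  shows "(\<Sum>k\<in>S. (cmod (fourier_mode L k x - fourier_mode L k y))\<^sup>2 / mode_weight L m \<beta> k)
    \<le> 2 * \<bar>x - y\<bar> / \<beta>"
proof (cases "x = y")
  case False
  define s where "s = \<bar>x - y\<bar>"
  \<comment> \<open>This \<open>a\<close> is determined by 4 + q^2 s^2 = (4 pi^2 s^2 / L^2) (a^2 +
    k^2) for q = 2 pi k / L.\<close>
  define a where "a = L / (pi * s)"
  have s: "s > 0" using False by (simp add: s_def)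
  have a: "a > 0" using L s by (simp add: a_def)
  let ?g = "\<lambda>k. (cmod (fourier_mode L k x - fourier_mode L k y))\<^sup>2 / mode_weight L m \<beta> k"
  have g0: "?g 0 = 0" by (simp add: fourier_mode_def)
  have le: "?g k \<le> 2 * L / (pi\<^sup>2 * \<beta>) * (1 / (a\<^sup>2 + (real_of_int k)\<^sup>2))" if k: "k \<noteq> 0" for k
  proof -
    define q where "q = 2 * pi * of_int k / L"
    have q: "q \<noteq> 0" using k L by (simp add: q_def)
    have "L powr (-1/2) * L powr (-1/2) = 1 / L"
      using L by (simp add: powr_minus_divide flip: powr_add)
    hence L2: "(L powr (-1/2))\<^sup>2 = 1 / L" by (simp add: power2_eq_square)
    have "fourier_mode L k x - fourier_mode L k y
      = of_real (L powr (-1/2)) * (exp (\<i> * of_real (q * x)) - exp (\<i> * of_real (q * y)))"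
      by (simp add: fourier_mode_def q_def right_diff_distrib)
    hence "(cmod (fourier_mode L k x - fourier_mode L k y))\<^sup>2
      = (L powr (-1/2))\<^sup>2 * (cmod (exp (\<i> * of_real (q * x)) - exp (\<i> * of_real (q * y))))\<^sup>2"
      by (simp add: norm_mult power_mult_distrib)
    also have "\<dots> \<le> 1 / L * (8 * (q * x - q * y)\<^sup>2 / (4 + (q * x - q * y)\<^sup>2))"
      unfolding L2 using L by (intro mult_left_mono norm_exp_diff_sq_le) auto
    also have "(q * x - q * y)\<^sup>2 = q\<^sup>2 * s\<^sup>2"
      by (simp add: s_def power_mult_distrib flip: right_diff_distrib)
    finally have num: "(cmod (fourier_mode L k x - fourier_mode L k y))\<^sup>2 \<le> 1 / L * (8 * (q\<^sup>2 * s\<^sup>2) / (4 + q\<^sup>2 * s\<^sup>2))" .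
    have "mode_weight L m \<beta> k \<ge> \<beta> * q\<^sup>2" using \<beta> by (simp add: mode_weight_def q_def)
    hence "?g k \<le> 1 / L * (8 * (q\<^sup>2 * s\<^sup>2) / (4 + q\<^sup>2 * s\<^sup>2)) / (\<beta> * q\<^sup>2)"
      using num L \<beta> q by (intro frac_le) (auto intro!: mult_nonneg_nonneg divide_nonneg_nonneg)
    also have "\<dots> = 1 / L * (8 * s\<^sup>2) / (\<beta> * (4 + q\<^sup>2 * s\<^sup>2))"
      using L \<beta> q by (simp add: divide_simps) 
    also have "\<dots> = 2 * L / (pi\<^sup>2 * \<beta>) * (1 / (a\<^sup>2 + (real_of_int k)\<^sup>2))"
    proof -
      define D where "D = a\<^sup>2 + (real_of_int k)\<^sup>2"
      have D: "D > 0" using a by (simp add: D_def add_pos_nonneg)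
      have eq: "4 + q\<^sup>2 * s\<^sup>2 = 4 * pi\<^sup>2 * s\<^sup>2 / L\<^sup>2 * D"
        using L s by (simp add: D_def a_def q_def power_mult_distrib power_divide field_simps)
      show ?thesis unfolding eq D_def[symmetric] using L s \<beta> D
        by (simp add: field_simps power2_eq_square)
    qed
    finally show ?thesis .
  qed
  have "sum ?g S = sum ?g (S - {0})" using S g0 by (simp add: sum_diff1)
  also have "\<dots> \<le> (\<Sum>k\<in>S-{0}. 2 * L / (pi\<^sup>2 * \<beta>) * (1 / (a\<^sup>2 + (real_of_int k)\<^sup>2)))"
    by (intro sum_mono le) auto
  also have "\<dots> = 2 * L / (pi\<^sup>2 * \<beta>) * (\<Sum>k\<in>S-{0}. 1 / (a\<^sup>2 + (real_of_int k)\<^sup>2))"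
    by (rule sum_distrib_left[symmetric])
  also have "\<dots> \<le> 2 * L / (pi\<^sup>2 * \<beta>) * (pi / a)"
    using L \<beta> S a by (intro mult_left_mono sum_int_inverse_square_le) auto
  also have "\<dots> = 2 * s / \<beta>" using L s \<beta> by (simp add: a_def field_simps power2_eq_square)
  finally show ?thesis by (simp add: s_def)
qed simp

section \<open>Point evaluation and the Laplace transform of increments\<close>

lemma gaussian_field_space:
  assumes "gaussian_field L m \<beta> M" shows "space M = circle_functions L"
proof -
  have "space M = space (restrict_space borel (circle_functions L))"
    using assms unfolding gaussian_field_def by (intro sets_eq_imp_space_eq) blast
  thus ?thesis by (simp add: space_restrict_space)
qed

lemma fourier_mode_measurable [measurable]: "fourier_mode L k \<in> borel_measurable borel"
  unfolding fourier_mode_def divide_inverse by (intro borel_measurable_continuous_onI continuous_intros)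

text \<open>Evaluation is jointly measurable because it is a limit of Fejer means; the product
  \<open>\<sigma>\<close>-algebra is smaller than the Borel sets of the (non-separable) product space.\<close>
lemma gaussian_field_measurable_eval:
  assumes L: "L > 0" and G: "gaussian_field L m \<beta> M"
  shows "(\<lambda>q. apply_bcontfun (fst q) (snd q)) \<in> borel_measurable (M \<Otimes>\<^sub>M borel)"
proof (rule borel_measurable_LIMSEQ_metric)
  note [measurable] = gaussian_field_measurable_coeff[OF G]
  show "(\<lambda>q. fejer L (\<lambda>k. fourier_coeff L k (fst q)) n (snd q)) \<in> borel_measurable (M \<Otimes>\<^sub>M borel)" for n
    unfolding fejer_def by measurable
  show "(\<lambda>n. fejer L (\<lambda>k. fourier_coeff L k (fst q)) n (snd q)) \<longlonglongrightarrow> apply_bcontfun (fst q) (snd q)"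
    if "q \<in> space (M \<Otimes>\<^sub>M borel)" for q
  proof -
    have "fst q \<in> space M" using that by (simp add: space_pair_measure mem_Times_iff)
    thus ?thesis unfolding gaussian_field_space[OF G] by (rule fejer_tendsto[OF L])
  qed
qed

lemma gaussian_field_measurable_eval' [measurable (raw)]:
  assumes "L > 0" "gaussian_field L m \<beta> M" and [measurable]: "f \<in> measurable N M" "g \<in> borel_measurable N"
  shows "(\<lambda>x. apply_bcontfun (f x) (g x)) \<in> borel_measurable N"
proof -
  have "(\<lambda>x. (f x, g x)) \<in> measurable N (M \<Otimes>\<^sub>M borel)" by measurable
  from measurable_compose[OF this gaussian_field_measurable_eval[OF assms(1,2)]] show ?thesis by simp
qed

text \<open>The bound for Fejer means is uniform in n, and the means converge pointwise on the whole
  space of \<open>M\<close>, so Fatou's lemma passes the bound to the limit.\<close>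

lemma gaussian_field_laplace_increment:
  assumes L: "L > 0" and m: "m > 0" and \<beta>: "\<beta> > 0" and G: "gaussian_field L m \<beta> M"
  shows "(\<integral>\<^sup>+\<phi>. exp (Re (c * (apply_bcontfun \<phi> x - apply_bcontfun \<phi> y))) \<partial>M)
    \<le> exp ((cmod c)\<^sup>2 * \<bar>x - y\<bar> / \<beta>)"
proof -
  note [measurable] = gaussian_field_measurable_coeff[OF G]
  let ?F = "\<lambda>n \<phi>. fejer L (\<lambda>k. fourier_coeff L k \<phi>) n"
  let ?E = "\<lambda>n \<phi>. ennreal (exp (Re (c * (?F n \<phi> x - ?F n \<phi> y))))"
  have [measurable]: "?E n \<in> borel_measurable M" for n unfolding fejer_def by measurable
  have bound: "(\<integral>\<^sup>+\<phi>. ?E n \<phi> \<partial>M) \<le> exp ((cmod c)\<^sup>2 * \<bar>x - y\<bar> / \<beta>)" if n: "n > 0" for n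
  proof -
    define v where "v k = c * (fourier_mode L k x - fourier_mode L k y)" for k
    have "(\<Sum>k\<in>S. (cmod (v k))\<^sup>2 / mode_weight L m \<beta> k) \<le> 2 * ((cmod c)\<^sup>2 * \<bar>x - y\<bar> / \<beta>)" if "finite S" for S
    proof -
      have "(\<Sum>k\<in>S. (cmod (v k))\<^sup>2 / mode_weight L m \<beta> k)
        = (cmod c)\<^sup>2 * (\<Sum>k\<in>S. (cmod (fourier_mode L k x - fourier_mode L k y))\<^sup>2 / mode_weight L m \<beta> k)"
        by (simp add: v_def norm_mult power_mult_distrib sum_distrib_left)
      also have "\<dots> \<le> (cmod c)\<^sup>2 * (2 * \<bar>x - y\<bar> / \<beta>)"
        using that assms by (intro mult_left_mono mode_increment_variance_le) auto
      finally show ?thesis by (simp add: mult_ac)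
    qed
    from gaussian_field_laplace_fejer[OF m \<beta> G n this]
    have "(\<integral>\<^sup>+\<phi>. exp (Re ((\<Sum>j<n. \<Sum>l<n. fourier_coeff L (int j - int l) \<phi> * v (int j - int l)) / of_nat n)) \<partial>M)
       \<le> exp ((cmod c)\<^sup>2 * \<bar>x - y\<bar> / \<beta>)" by simp
    moreover have "c * (?F n \<phi> x - ?F n \<phi> y)
        = (\<Sum>j<n. \<Sum>l<n. fourier_coeff L (int j - int l) \<phi> * v (int j - int l)) / of_nat n" for \<phi>
      unfolding fejer_def v_def diff_divide_distrib[symmetric] sum_subtractf[symmetric]
        times_divide_eq_right sum_distrib_left by (simp add: algebra_simps)
    ultimately show ?thesis by simp
  qed
  have "(\<integral>\<^sup>+\<phi>. exp (Re (c * (apply_bcontfun \<phi> x - apply_bcontfun \<phi> y))) \<partial>M)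
      = (\<integral>\<^sup>+\<phi>. liminf (\<lambda>n. ?E n \<phi>) \<partial>M)"
  proof (intro nn_integral_cong)
    fix \<phi> assume "\<phi> \<in> space M"
    hence "\<phi> \<in> circle_functions L" using gaussian_field_space[OF G] by simp
    hence "(\<lambda>n. ?E n \<phi>) \<longlonglongrightarrow> exp (Re (c * (apply_bcontfun \<phi> x - apply_bcontfun \<phi> y)))"
      by (intro tendsto_ennrealI tendsto_exp tendsto_Re tendsto_mult tendsto_const tendsto_diff fejer_tendsto L)
    thus "ennreal (exp (Re (c * (apply_bcontfun \<phi> x - apply_bcontfun \<phi> y)))) = liminf (\<lambda>n. ?E n \<phi>)"
      by (intro lim_imp_Liminf[symmetric]) auto
  qed
  also have "\<dots> \<le> liminf (\<lambda>n. \<integral>\<^sup>+\<phi>. ?E n \<phi> \<partial>M)" by (intro nn_integral_liminf) measurable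
  also have "\<dots> \<le> liminf (\<lambda>n. ennreal (exp ((cmod c)\<^sup>2 * \<bar>x - y\<bar> / \<beta>)))"
    by (intro Liminf_mono eventually_mono[OF eventually_gt_at_top[of 0]] bound)
  finally show ?thesis by (simp add: Liminf_const)
qed

section \<open>Square-exponential moments and the increment energy\<close>

lemma exp_half_square_eq_gaussian:
  fixes t :: real
  shows "ennreal (exp (t\<^sup>2 / 2)) = (\<integral>\<^sup>+g. ennreal (std_normal_density g) * exp (t * g) \<partial>lborel)"
proof -
  have eq: "std_normal_density g * exp (t * g) = exp (t\<^sup>2 / 2) * normal_density t 1 g" for g
  proof -
    have "- g\<^sup>2 / 2 + t * g = t\<^sup>2 / 2 + - (g - t)\<^sup>2 / 2"
      by (simp add: power2_eq_square field_simps)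
    hence "exp (- g\<^sup>2 / 2) * exp (t * g) = exp (t\<^sup>2 / 2) * exp (- (g - t)\<^sup>2 / 2)"
      by (simp only: exp_add[symmetric])
    thus ?thesis by (simp add: normal_density_def)
  qed
  have "(\<integral>\<^sup>+g. ennreal (std_normal_density g) * exp (t * g) \<partial>lborel)
      = (\<integral>\<^sup>+g. ennreal (exp (t\<^sup>2 / 2)) * ennreal (normal_density t 1 g) \<partial>lborel)"
    by (intro nn_integral_cong) (simp add: eq flip: ennreal_mult)
  also have "\<dots> = ennreal (exp (t\<^sup>2 / 2)) * (\<integral>\<^sup>+g. normal_density t 1 g \<partial>lborel)"
    by (intro nn_integral_cmult) auto
  also have "(\<integral>\<^sup>+g. normal_density t 1 g \<partial>lborel) = 1"
    by (subst nn_integral_eq_integral) auto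
  finally show ?thesis by simp
qed

text \<open>The Gaussian linearization \<open>exp (t\<^sup>2/2) = E (exp (t g))\<close> turns Laplace transforms into
  square-exponential moments.\<close>
lemma gaussian_field_square_exp_component:
  assumes L: "L > 0" and m: "m > 0" and G: "gaussian_field L m 1 M" and xy: "x \<noteq> y" and u: "cmod u = 1"
  shows "(\<integral>\<^sup>+\<phi>. exp ((Re (u * (apply_bcontfun \<phi> x - apply_bcontfun \<phi> y)))\<^sup>2 / (8 * \<bar>x - y\<bar>)) \<partial>M) \<le> 2"
proof -
  interpret prob_space M using G by (simp add: gaussian_field_def)
  note [measurable] = gaussian_field_measurable_eval'[OF L G]
  interpret lp: pair_sigma_finite M lborel ..
  define s where "s = \<bar>x - y\<bar>"
  have s: "s > 0" using xy by (simp add: s_def)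
  define R where "R \<phi> = Re (u * (apply_bcontfun \<phi> x - apply_bcontfun \<phi> y))" for \<phi>
  have [measurable]: "R \<in> borel_measurable M" unfolding R_def by measurable
  \<comment> \<open>Chosen so that (b R)^2 / 2 is R^2 / (8 s). The Laplace bound then gives exp(b^2
    g^2 s) = exp(g^2 / 4), which the standard normal density, decaying like exp(-g^2 / 2), can
    absorb.\<close>
  define b where "b = 1 / (2 * sqrt s)"
  have b: "b\<^sup>2 = 1 / (4 * s)" using s by (simp add: b_def power_divide power_mult_distrib)
  have "(\<integral>\<^sup>+\<phi>. exp ((R \<phi>)\<^sup>2 / (8 * s)) \<partial>M) = (\<integral>\<^sup>+\<phi>. exp ((b * R \<phi>)\<^sup>2 / 2) \<partial>M)"
    by (simp add: power_mult_distrib b)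
  also have "\<dots> = (\<integral>\<^sup>+\<phi>. \<integral>\<^sup>+g. ennreal (std_normal_density g) * exp (b * R \<phi> * g) \<partial>lborel \<partial>M)"
    unfolding exp_half_square_eq_gaussian ..
  also have "\<dots> = (\<integral>\<^sup>+g. \<integral>\<^sup>+\<phi>. ennreal (std_normal_density g) * exp (b * R \<phi> * g) \<partial>M \<partial>lborel)"
    by (rule lp.Fubini'[symmetric]) measurable
  also have "\<dots> = (\<integral>\<^sup>+g. ennreal (std_normal_density g) * (\<integral>\<^sup>+\<phi>. exp (b * R \<phi> * g) \<partial>M) \<partial>lborel)"
    by (intro nn_integral_cong nn_integral_cmult) measurable
  also have "\<dots> \<le> (\<integral>\<^sup>+g. ennreal (std_normal_density g) * exp (g\<^sup>2 / 4) \<partial>lborel)"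
  proof (intro nn_integral_mono mult_left_mono)
    fix g :: real
    have "b * R \<phi> * g = Re ((of_real (b * g) * u) * (apply_bcontfun \<phi> x - apply_bcontfun \<phi> y))" for \<phi>
      unfolding R_def by (simp add: algebra_simps)
    hence "(\<integral>\<^sup>+\<phi>. exp (b * R \<phi> * g) \<partial>M) \<le> exp ((cmod (of_real (b * g) * u))\<^sup>2 * \<bar>x - y\<bar> / 1)"
      using gaussian_field_laplace_increment[OF L m _ G, of "of_real (b * g) * u" x y] by simp
    also have "(cmod (of_real (b * g) * u))\<^sup>2 * \<bar>x - y\<bar> / 1 = g\<^sup>2 / 4"
      using s u by (simp add: norm_mult power_mult_distrib b flip: s_def)
    finally show "(\<integral>\<^sup>+\<phi>. exp (b * R \<phi> * g) \<partial>M) \<le> exp (g\<^sup>2 / 4)" .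
  qed auto
  \<comment> \<open>The product is again a Gaussian, of variance 2, and the ratio of normalizations
    is sqrt 2.\<close>
  also have "\<dots> = (\<integral>\<^sup>+g. ennreal (sqrt 2) * ennreal (normal_density 0 (sqrt 2) g) \<partial>lborel)"
  proof (intro nn_integral_cong)
    fix g :: real
    have "exp (- g\<^sup>2 / 2) * exp (g\<^sup>2 / 4) = exp (- g\<^sup>2 / 4)" by (simp flip: exp_add)
    hence "std_normal_density g * exp (g\<^sup>2 / 4) = sqrt 2 * normal_density 0 (sqrt 2) g"
      by (simp add: normal_density_def real_sqrt_mult divide_simps)
    thus "ennreal (std_normal_density g) * exp (g\<^sup>2 / 4) = ennreal (sqrt 2) * ennreal (normal_density 0 (sqrt 2) g)"
      by (simp flip: ennreal_mult)
  qed
  also have "\<dots> = ennreal (sqrt 2) * (\<integral>\<^sup>+g. normal_density 0 (sqrt 2) g \<partial>lborel)"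
    by (intro nn_integral_cmult) auto
  also have "(\<integral>\<^sup>+g. normal_density 0 (sqrt 2) g \<partial>lborel) = 1"
    by (subst nn_integral_eq_integral) auto
  also have "ennreal (sqrt 2) * 1 \<le> 2"
    using ennreal_leI[of "sqrt 2" 2] real_le_lsqrt[of 2 2] by simp
  finally show ?thesis by (simp add: R_def s_def)
qed

text \<open>The squared modulus is the sum of the squares of the real and imaginary parts, which are
  the components for u = 1 and u = -i. Since they are not separated by independence here, the
  product of exponentials is bounded by the mean of their squares; this doubles the exponents and
  turns 16 into 8.\<close>

lemma gaussian_field_square_exp_increment:
  assumes L: "L > 0" and m: "m > 0" and G: "gaussian_field L m 1 M" and xy: "x \<noteq> y"
  shows "(\<integral>\<^sup>+\<phi>. exp ((cmod (apply_bcontfun \<phi> x - apply_bcontfun \<phi> y))\<^sup>2 / (16 * \<bar>x - y\<bar>)) \<partial>M) \<le> 2"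
proof -
  note [measurable] = gaussian_field_measurable_eval'[OF L G]
  define s where "s = \<bar>x - y\<bar>"
  have s: "s > 0" using xy by (simp add: s_def)
  define R where "R u \<phi> = Re (u * (apply_bcontfun \<phi> x - apply_bcontfun \<phi> y))" for u \<phi>
  have [measurable]: "R u \<in> borel_measurable M" for u unfolding R_def by measurable
  define h :: real where "h = 1 / 2"
  have h: "h \<ge> 0" "h * 2 = 1" by (auto simp: h_def)
  have le: "ennreal (exp ((cmod (apply_bcontfun \<phi> x - apply_bcontfun \<phi> y))\<^sup>2 / (16 * s)))
      \<le> ennreal h * exp ((R 1 \<phi>)\<^sup>2 / (8 * s)) + ennreal h * exp ((R (-\<i>) \<phi>)\<^sup>2 / (8 * s))" for \<phi>
  proof -
    define a b where "a = exp ((R 1 \<phi>)\<^sup>2 / (16 * s))" and "b = exp ((R (-\<i>) \<phi>)\<^sup>2 / (16 * s))"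
    have "exp ((cmod (apply_bcontfun \<phi> x - apply_bcontfun \<phi> y))\<^sup>2 / (16 * s)) = a * b"
      by (simp add: a_def b_def R_def cmod_power2 add_divide_distrib flip: exp_add)
    also have "\<dots> \<le> h * a\<^sup>2 + h * b\<^sup>2" using sum_squares_bound[of a b] by (simp add: h_def)
    also have "a\<^sup>2 = exp ((R 1 \<phi>)\<^sup>2 / (8 * s))" by (simp add: a_def flip: exp_double)
    also have "b\<^sup>2 = exp ((R (-\<i>) \<phi>)\<^sup>2 / (8 * s))" by (simp add: b_def flip: exp_double)
    finally show ?thesis using h(1) by (simp add: ennreal_leI flip: ennreal_mult ennreal_plus)
  qed
  have R: "(\<integral>\<^sup>+\<phi>. exp ((R u \<phi>)\<^sup>2 / (8 * s)) \<partial>M) \<le> 2" if "cmod u = 1" for u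
    using gaussian_field_square_exp_component[OF L m G xy that] by (simp add: R_def s_def)
  have "(\<integral>\<^sup>+\<phi>. exp ((cmod (apply_bcontfun \<phi> x - apply_bcontfun \<phi> y))\<^sup>2 / (16 * s)) \<partial>M)
     \<le> (\<integral>\<^sup>+\<phi>. ennreal h * exp ((R 1 \<phi>)\<^sup>2 / (8 * s)) + ennreal h * exp ((R (-\<i>) \<phi>)\<^sup>2 / (8 * s)) \<partial>M)"
    by (intro nn_integral_mono le)
  also have "\<dots> = ennreal h * (\<integral>\<^sup>+\<phi>. exp ((R 1 \<phi>)\<^sup>2 / (8 * s)) \<partial>M)
      + ennreal h * (\<integral>\<^sup>+\<phi>. exp ((R (-\<i>) \<phi>)\<^sup>2 / (8 * s)) \<partial>M)"
    by (subst nn_integral_add) (auto simp: nn_integral_cmult)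
  also have "\<dots> \<le> ennreal h * 2 + ennreal h * 2"
    by (intro add_mono mult_left_mono R) auto
  also have "\<dots> = 2"
    using h ennreal_mult[of h 2] by simp
  finally show ?thesis by (simp add: s_def)
qed

text \<open>The \<open>W\<close> of the overview, a functional of Garsia-Rodemich-Rumsey type. It
  takes values in \<open>ennreal\<close> because a given continuous function may have infinite
  energy; finiteness will hold almost surely.\<close>

definition increment_energy :: "real \<Rightarrow> (real \<Rightarrow>\<^sub>C complex) \<Rightarrow> ennreal" where
  "increment_energy L \<phi> = (\<integral>\<^sup>+x\<in>{0..L}. (\<integral>\<^sup>+s\<in>{0<..L}.
     ennreal (exp ((cmod (apply_bcontfun \<phi> (x + s) - apply_bcontfun \<phi> x))\<^sup>2 / (16 * s))) \<partial>lborel) \<partial>lborel)"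

lemma increment_energy_measurable:
  assumes L: "L > 0" and G: "gaussian_field L m \<beta> M"
  shows "increment_energy L \<in> borel_measurable M"
proof -
  note [measurable] = gaussian_field_measurable_eval'[OF L G]
  show ?thesis unfolding increment_energy_def by measurable
qed

lemma increment_energy_expectation:
  assumes L: "L > 0" and m: "m > 0" and G: "gaussian_field L m 1 M"
  shows "(\<integral>\<^sup>+\<phi>. increment_energy L \<phi> \<partial>M) < \<infinity>"
proof -
  interpret prob_space M using G by (simp add: gaussian_field_def)
  interpret lp: pair_sigma_finite M lborel ..
  note [measurable] = gaussian_field_measurable_eval'[OF L G]
  let ?e = "\<lambda>\<phi> x s. ennreal (exp ((cmod (apply_bcontfun \<phi> (x + s) - apply_bcontfun \<phi> x))\<^sup>2 / (16 * s)))"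
  have "(\<integral>\<^sup>+\<phi>. increment_energy L \<phi> \<partial>M)
    = (\<integral>\<^sup>+x. (\<integral>\<^sup>+\<phi>. (\<integral>\<^sup>+s. ?e \<phi> x s * indicator {0<..L} s \<partial>lborel) * indicator {0..L} x \<partial>M) \<partial>lborel)"
    unfolding increment_energy_def by (rule lp.Fubini'[symmetric]) measurable
  also have "\<dots> = (\<integral>\<^sup>+x. (\<integral>\<^sup>+\<phi>. (\<integral>\<^sup>+s. ?e \<phi> x s * indicator {0<..L} s \<partial>lborel) \<partial>M) * indicator {0..L} x \<partial>lborel)"
    by (intro nn_integral_cong nn_integral_multc) measurable
  also have "\<dots> = (\<integral>\<^sup>+x. (\<integral>\<^sup>+s. (\<integral>\<^sup>+\<phi>. ?e \<phi> x s * indicator {0<..L} s \<partial>M) \<partial>lborel) * indicator {0..L} x \<partial>lborel)"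
    by (intro nn_integral_cong arg_cong2[where f = "(*)"] refl lp.Fubini'[symmetric]) measurable
  also have "\<dots> = (\<integral>\<^sup>+x. (\<integral>\<^sup>+s. (\<integral>\<^sup>+\<phi>. ?e \<phi> x s \<partial>M) * indicator {0<..L} s \<partial>lborel) * indicator {0..L} x \<partial>lborel)"
    by (intro nn_integral_cong arg_cong2[where f = "(*)"] refl nn_integral_multc) measurable
  also have "\<dots> \<le> (\<integral>\<^sup>+x. (\<integral>\<^sup>+s. 2 * indicator {0<..L} s \<partial>lborel) * indicator {0..L} x \<partial>lborel)"
  proof (rule nn_integral_mono, rule mult_right_mono, rule nn_integral_mono)
    fix x s :: real
    show "(\<integral>\<^sup>+\<phi>. ?e \<phi> x s \<partial>M) * indicator {0<..L} s \<le> 2 * indicator {0<..L} s"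
    proof (cases "s \<in> {0<..L}")
      case True
      thus ?thesis using gaussian_field_square_exp_increment[OF L m G, of "x + s" x] by simp
    qed simp
  qed auto
  also have "\<dots> = (2 * ennreal L) * ennreal L"
    using L by (simp add: nn_integral_cmult)
  also have "\<dots> < \<infinity>"
    by (metis ennreal_less_top ennreal_mult_less_top ennreal_numeral infinity_ennreal_def)
  finally show ?thesis .
qed

section \<open>Exponential integrability\<close>

text \<open>\<open>lp_mass L p\<close> and \<open>lp_mass L 2\<close> are the \<open>P\<close> and
  \<open>N\<close> of the overview.\<close>

definition lp_mass :: "real \<Rightarrow> real \<Rightarrow> (real \<Rightarrow>\<^sub>C complex) \<Rightarrow> real" where
  "lp_mass L q \<phi> = (LBINT x:{0..L}. cmod (apply_bcontfun \<phi> x) powr q)"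

lemma continuous_on_norm_powr:
  "q > 0 \<Longrightarrow> continuous_on A (\<lambda>x. cmod (apply_bcontfun \<phi> x) powr q)"
  by (intro continuous_on_powr' continuous_intros) auto

lemma lp_mass_nonneg: "lp_mass L q \<phi> \<ge> 0"
  unfolding lp_mass_def set_lebesgue_integral_def by (intro integral_nonneg_AE) auto

lemma nn_integral_lp_mass:
  assumes "q > 0"
  shows "(\<integral>\<^sup>+x\<in>{0..L}. ennreal (cmod (apply_bcontfun \<phi> x) powr q) \<partial>lborel) = ennreal (lp_mass L q \<phi>)"
proof -
  have "set_integrable lborel {0..L} (\<lambda>x. cmod (apply_bcontfun \<phi> x) powr q)"
    using assms by (intro borel_integrable_atLeastAtMost' continuous_on_norm_powr)
  hence "(\<integral>\<^sup>+x. ennreal (indicator {0..L} x *\<^sub>R (cmod (apply_bcontfun \<phi> x) powr q)) \<partial>lborel) = ennreal (lp_mass L q \<phi>)"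
    unfolding lp_mass_def set_lebesgue_integral_def set_integrable_def
    by (intro nn_integral_eq_integral) auto
  moreover have "ennreal (indicator {0..L} x *\<^sub>R (cmod (apply_bcontfun \<phi> x) powr q))
      = ennreal (cmod (apply_bcontfun \<phi> x) powr q) * indicator {0..L} x" for x
    by (simp add: indicator_def)
  ultimately show ?thesis by simp
qed

lemma circle_norm_powr: "q > 0 \<Longrightarrow> circle_norm L q \<phi> powr q = lp_mass L q \<phi>"
  using lp_mass_nonneg[of L q \<phi>] by (simp add: circle_norm_def lp_mass_def powr_powr)

lemma circle_norm_2_square: "(circle_norm L 2 \<phi>)\<^sup>2 = lp_mass L 2 \<phi>"
proof -
  have "circle_norm L 2 \<phi> \<ge> 0" by (simp add: circle_norm_def)
  thus ?thesis using circle_norm_powr[of 2 L \<phi>] by (simp add: powr_numeral)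
qed

lemma circle_norm_2_powr: "circle_norm L 2 \<phi> powr (2 * r) = lp_mass L 2 \<phi> powr r"
  using circle_norm_powr[of 2 L \<phi>] by (simp flip: powr_powr)

section \<open>Large values force a large increment energy\<close>

lemma nn_integral_translate:
  fixes g :: "real \<Rightarrow> ennreal"
  assumes "g \<in> borel_measurable borel"
  shows "(\<integral>\<^sup>+s. g (c + s) \<partial>lborel) = (\<integral>\<^sup>+s. g s \<partial>lborel)"
  using nn_integral_real_affine[OF assms, of 1 c] by simp

lemma nn_integral_period:
  fixes g :: "real \<Rightarrow> ennreal"
  assumes [measurable]: "g \<in> borel_measurable borel" and per: "\<And>x. g (x + L) = g x"
    and x: "x \<in> {0..L}"
  shows "(\<integral>\<^sup>+s\<in>{0<..L}. g (x + s) \<partial>lborel) \<le> (\<integral>\<^sup>+s\<in>{0..L}. g s \<partial>lborel)"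
proof -
  have "(\<integral>\<^sup>+s\<in>{0<..L}. g (x + s) \<partial>lborel) = (\<integral>\<^sup>+s. g s * indicator {x<..x+L} s \<partial>lborel)"
  proof (subst nn_integral_translate[symmetric, of "\<lambda>s. g s * indicator {x<..x+L} s" x])
    show "(\<integral>\<^sup>+s\<in>{0<..L}. g (x + s) \<partial>lborel) = (\<integral>\<^sup>+s. g (x + s) * indicator {x<..x+L} (x + s) \<partial>lborel)"
      by (intro nn_integral_cong) (auto split: split_indicator)
  qed measurable
  also have "\<dots> = (\<integral>\<^sup>+s. g s * indicator {x<..L} s + g s * indicator {L<..x+L} s \<partial>lborel)"
    using x by (intro nn_integral_cong) (auto split: split_indicator)
  also have "\<dots> = (\<integral>\<^sup>+s. g s * indicator {x<..L} s \<partial>lborel) + (\<integral>\<^sup>+s. g s * indicator {L<..x+L} s \<partial>lborel)"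
    by (rule nn_integral_add) measurable
  also have "(\<integral>\<^sup>+s. g s * indicator {L<..x+L} s \<partial>lborel) = (\<integral>\<^sup>+s. g s * indicator {0<..x} s \<partial>lborel)"
  proof (subst nn_integral_translate[symmetric, of "\<lambda>s. g s * indicator {L<..x+L} s" L])
    show "(\<integral>\<^sup>+s. g (L + s) * indicator {L<..x+L} (L + s) \<partial>lborel) = (\<integral>\<^sup>+s. g s * indicator {0<..x} s \<partial>lborel)"
      using per by (intro nn_integral_cong) (auto split: split_indicator simp: add.commute)
  qed measurable
  also have "(\<integral>\<^sup>+s. g s * indicator {x<..L} s \<partial>lborel) + (\<integral>\<^sup>+s. g s * indicator {0<..x} s \<partial>lborel)
      = (\<integral>\<^sup>+s. g s * indicator {x<..L} s + g s * indicator {0<..x} s \<partial>lborel)"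
    by (rule nn_integral_add[symmetric]) measurable
  also have "\<dots> \<le> (\<integral>\<^sup>+s\<in>{0..L}. g s \<partial>lborel)"
    using x by (intro nn_integral_mono) (auto split: split_indicator)
  finally show ?thesis .
qed

lemma apply_bcontfun_measurable [measurable]: "apply_bcontfun \<phi> \<in> borel_measurable borel"
  by (intro borel_measurable_continuous_onI continuous_intros)

text \<open>On a window of length \<open>h\<close> with \<open>8 N \<le> h |\<phi> x|\<^sup>2\<close> the value of \<open>|\<phi>|\<close> drops below
  \<open>|\<phi> x| / 2\<close> on at least half of the window.\<close>
lemma increment_energy_pointwise:
  assumes L: "L > 0" and \<phi>: "\<phi> \<in> circle_functions L" and h: "0 < h" "h \<le> L" and x: "x \<in> {0..L}"
    and big: "8 * lp_mass L 2 \<phi> \<le> h * (cmod (apply_bcontfun \<phi> x))\<^sup>2" and nz: "apply_bcontfun \<phi> x \<noteq> 0"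
  shows "ennreal (h / 2 * exp ((cmod (apply_bcontfun \<phi> x))\<^sup>2 / (64 * h)))
    \<le> (\<integral>\<^sup>+s\<in>{0<..L}. ennreal (exp ((cmod (apply_bcontfun \<phi> (x + s) - apply_bcontfun \<phi> x))\<^sup>2 / (16 * s))) \<partial>lborel)"
    (is "_ \<le> ?I")
proof -
  define f where "f = apply_bcontfun \<phi>"
  have [measurable]: "f \<in> borel_measurable borel" by (simp add: f_def)
  have per: "f (y + L) = f y" for y using \<phi> by (simp add: f_def circle_functions_def)
  define a where "a = cmod (f x)"
  have a: "a > 0" using nz by (simp add: a_def f_def)
  define E where "E = exp (a\<^sup>2 / (64 * h))"
  define N where "N = lp_mass L 2 \<phi>"
  have N: "N \<ge> 0" by (simp add: N_def lp_mass_nonneg)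
  \<comment> \<open>Chebyshev's inequality in pointwise form. Where |f(x + s)| is at most a/2, the
    increment is at least a/2 and s \<le> h makes the exponential at least E, since (a/2)^2 / (16 h)
    = a^2 / (64 h). Elsewhere 4 |f(x + s)|^2 / a^2 is at least 1.\<close>
  have pt: "ennreal E * indicator {0<..h} s \<le> ennreal (exp ((cmod (f (x + s) - f x))\<^sup>2 / (16 * s))) * indicator {0<..L} s
      + ennreal (4 * E / a\<^sup>2) * (ennreal (cmod (f (x + s)) powr 2) * indicator {0<..L} s)" for s
  proof (cases "s \<in> {0<..h}")
    case True
    hence s: "0 < s" "s \<le> h" "s \<in> {0<..L}" using h by auto
    have "E \<le> exp ((cmod (f (x + s) - f x))\<^sup>2 / (16 * s)) + 4 * E / a\<^sup>2 * (cmod (f (x + s)))\<^sup>2"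
    proof (cases "cmod (f (x + s)) \<le> a / 2")
      case True
      have "a / 2 \<le> cmod (f (x + s) - f x)"
        using True norm_triangle_ineq2[of "f x" "f (x + s)"] by (simp add: a_def norm_minus_commute)
      hence "(a / 2)\<^sup>2 \<le> (cmod (f (x + s) - f x))\<^sup>2" using a by (intro power_mono) auto
      hence "(a / 2)\<^sup>2 / (16 * h) \<le> (cmod (f (x + s) - f x))\<^sup>2 / (16 * s)"
        using s by (intro frac_le) auto
      hence "E \<le> exp ((cmod (f (x + s) - f x))\<^sup>2 / (16 * s))"
        by (simp add: E_def power_divide)
      thus ?thesis by (simp add: E_def add_increasing2)
    next
      case False
      hence "(a / 2)\<^sup>2 \<le> (cmod (f (x + s)))\<^sup>2" using a by (intro power_mono) auto
      hence "E * 1 \<le> E * (4 / a\<^sup>2 * (cmod (f (x + s)))\<^sup>2)"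
        using a by (intro mult_left_mono) (auto simp: E_def field_simps)
      hence "E \<le> 4 * E / a\<^sup>2 * (cmod (f (x + s)))\<^sup>2" by (simp add: mult_ac)
      thus ?thesis using exp_ge_zero[of "(cmod (f (x + s) - f x))\<^sup>2 / (16 * s)"] by linarith
    qed
    hence "ennreal E \<le> ennreal (exp ((cmod (f (x + s) - f x))\<^sup>2 / (16 * s)) + 4 * E / a\<^sup>2 * (cmod (f (x + s)))\<^sup>2)"
      by (rule ennreal_leI)
    also have "\<dots> = ennreal (exp ((cmod (f (x + s) - f x))\<^sup>2 / (16 * s))) + ennreal (4 * E / a\<^sup>2) * ennreal ((cmod (f (x + s)))\<^sup>2)"
      by (subst ennreal_plus, simp, simp add: E_def) (subst ennreal_mult, simp_all add: E_def)
    finally show ?thesis using s True by (simp add: powr_numeral)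
  qed simp
  have "ennreal (h * E) = (\<integral>\<^sup>+s. ennreal E * indicator {0<..h} s \<partial>lborel)"
  proof (subst nn_integral_cmult_indicator)
    show "ennreal (h * E) = ennreal E * emeasure lborel {0<..h}"
      using h by (simp add: E_def mult.commute flip: ennreal_mult)
  qed simp
  also have "\<dots> \<le> (\<integral>\<^sup>+s. ennreal (exp ((cmod (f (x + s) - f x))\<^sup>2 / (16 * s))) * indicator {0<..L} s
      + ennreal (4 * E / a\<^sup>2) * (ennreal (cmod (f (x + s)) powr 2) * indicator {0<..L} s) \<partial>lborel)"
    by (intro nn_integral_mono pt)
  also have "\<dots> = ?I + ennreal (4 * E / a\<^sup>2) * (\<integral>\<^sup>+s\<in>{0<..L}. ennreal (cmod (f (x + s)) powr 2) \<partial>lborel)"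
    by (subst nn_integral_add) (auto simp: nn_integral_cmult f_def)
  also have "\<dots> \<le> ?I + ennreal (4 * E / a\<^sup>2) * (\<integral>\<^sup>+s\<in>{0..L}. ennreal (cmod (f s) powr 2) \<partial>lborel)"
    using x per by (intro add_left_mono mult_left_mono nn_integral_period) auto
  also have "(\<integral>\<^sup>+s\<in>{0..L}. ennreal (cmod (f s) powr 2) \<partial>lborel) = ennreal N"
    unfolding f_def N_def by (rule nn_integral_lp_mass) simp
  also have "ennreal (4 * E / a\<^sup>2) * ennreal N = ennreal (4 * E / a\<^sup>2 * N)"
    using N by (intro ennreal_mult[symmetric]) (auto simp: E_def)
  \<comment> \<open>By \<open>big\<close>, the points of the window where |f| stays above a/2
    account for at most half of it.\<close>
  also have "\<dots> \<le> ennreal (h / 2 * E)"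
  proof (rule ennreal_leI)
    have "4 * N / a\<^sup>2 \<le> h / 2" using big a by (simp add: N_def a_def f_def field_simps)
    hence "E * (4 * N / a\<^sup>2) \<le> E * (h / 2)" by (intro mult_left_mono) (auto simp: E_def)
    thus "4 * E / a\<^sup>2 * N \<le> h / 2 * E" by (simp add: mult_ac)
  qed
  finally have *: "ennreal (h * E) \<le> ?I + ennreal (h / 2 * E)" by (simp add: add_left_mono)
  \<comment> \<open>Subtraction in \<open>ennreal\<close> requires \<open>?I\<close> to be finite;
    if it is infinite, the claim is trivial.\<close>
  have "ennreal (h / 2 * E) \<le> ?I"
  proof (cases ?I)
    case (real i)
    have E0: "h / 2 * E \<ge> 0" using h by (simp add: E_def)
    have "ennreal (h * E) \<le> ennreal (i + h / 2 * E)"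
      using * unfolding real(2) ennreal_plus[OF real(1) E0] .
    hence "h * E \<le> i + h / 2 * E"
      using real(1) E0 by (subst (asm) ennreal_le_iff) auto
    hence "h / 2 * E \<le> i" by simp
    thus ?thesis using real by (simp add: ennreal_leI)
  qed simp
  thus ?thesis by (simp add: E_def a_def f_def)
qed

text \<open>For u > Y, q ln(u/Y) \<le> q (u/Y - 1) \<le> u - Y because q \<le> Y. The shift by Y
  matters: it makes a power integrable against the energy with the damping factor exp(-Y), at the
  price of the constant Y^q.\<close>

lemma powr_le_exp_shift:
  fixes u Y q :: real
  assumes "u \<ge> 0" "0 < q" "q \<le> Y"
  shows "u powr q \<le> Y powr q * (1 + exp (u - Y))"
proof (cases "u \<le> Y")
  case True
  hence "u powr q \<le> Y powr q * 1" using assms by (simp add: powr_mono2)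
  also have "\<dots> \<le> Y powr q * (1 + exp (u - Y))" by (intro mult_left_mono) auto
  finally show ?thesis .
next
  case False
  hence u: "u > Y" "Y > 0" using assms by auto
  have "q * ln (u / Y) \<le> q * (u / Y - 1)" using u assms by (intro mult_left_mono ln_le_minus_one) auto
  also have "\<dots> = q / Y * (u - Y)" using u by (simp add: field_simps)
  also have "\<dots> \<le> 1 * (u - Y)" using u assms by (intro mult_right_mono) auto
  finally have "(u / Y) powr q \<le> exp (u - Y)" using u by (simp add: powr_def)
  hence "Y powr q * (u / Y) powr q \<le> Y powr q * (1 + exp (u - Y))" by (intro mult_left_mono) auto
  moreover have "Y powr q * (u / Y) powr q = u powr q" using u by (simp flip: powr_mult)
  ultimately show ?thesis by simp
qed

text \<open>Split at the level |f|^2 = T. Below it, |f|^p is at most T^((p-2)/2) |f|^2. Above it,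
  |f|^p is at most K (1 + exp(-Y) e(x)), with K the last power in the conclusion. The constant K is
  charged to |f|^2 / T and contributes K N / T \<le> h K; the exponential is charged to the energy
  and contributes K exp(-Y) 2 w / h \<le> 2 h K, which is the purpose of the condition on w.
  Together these are the 3 h K.\<close>

lemma lp_mass_le_increment_energy:
  assumes L: "L > 0" and p: "p > 2" and \<phi>: "\<phi> \<in> circle_functions L" and h: "0 < h" "h \<le> L"
    and w: "w \<ge> 0" "increment_energy L \<phi> \<le> ennreal w" and Y: "p / 2 \<le> Y" "w \<le> h\<^sup>2 * exp Y"
  shows "lp_mass L p \<phi> \<le> (8 * (lp_mass L 2 \<phi> + 1) / h) powr ((p - 2) / 2) * lp_mass L 2 \<phi>
    + 3 * h * (64 * h * Y) powr (p / 2)"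
proof -
  define f where "f = apply_bcontfun \<phi>"
  have [measurable]: "f \<in> borel_measurable borel" by (simp add: f_def)
  define N where "N = lp_mass L 2 \<phi>"
  have N: "N \<ge> 0" by (simp add: N_def lp_mass_nonneg)
  \<comment> \<open>\<open>N + 1\<close> keeps \<open>T\<close> positive when N = 0, and h T \<ge> 8
    N supplies the hypothesis \<open>big\<close> of \<open>increment_energy_pointwise\<close> above
    the level \<open>T\<close>.\<close>
  define T where "T = 8 * (N + 1) / h"
  have T: "T > 0" using N h by (simp add: T_def)
  define K where "K = (64 * h * Y) powr (p / 2)"
  have K: "K \<ge> 0" by (simp add: K_def)
  define A where "A = {x. T < (cmod (f x))\<^sup>2}"
  have [measurable]: "A \<in> sets borel" unfolding A_def by measurable
  define e where "e x = exp ((cmod (f x))\<^sup>2 / (64 * h))" for x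
  have [measurable]: "e \<in> borel_measurable borel" unfolding e_def by measurable
  have e0: "e x \<ge> 0" for x by (simp add: e_def)
  have energy: "(\<integral>\<^sup>+x\<in>{0..L}. (ennreal (e x) * indicator A x) \<partial>lborel) \<le> ennreal (2 * w / h)"
  proof -
    have "ennreal (h / 2) * (\<integral>\<^sup>+x\<in>{0..L}. (ennreal (e x) * indicator A x) \<partial>lborel)
        = (\<integral>\<^sup>+x\<in>{0..L}. (ennreal (h / 2 * e x) * indicator A x) \<partial>lborel)"
    proof -
      have "ennreal (h / 2 * e x) = ennreal (h / 2) * ennreal (e x)" for x
        using h e0 by (intro ennreal_mult) auto
      thus ?thesis by (simp only: mult.assoc) (rule nn_integral_cmult[symmetric], measurable)
    qed
    also have "\<dots> \<le> increment_energy L \<phi>"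
      unfolding increment_energy_def
    proof (intro nn_integral_mono)
      fix x
      show "ennreal (h / 2 * e x) * indicator A x * indicator {0..L} x
         \<le> (\<integral>\<^sup>+s\<in>{0<..L}. ennreal (exp ((cmod (apply_bcontfun \<phi> (x + s) - apply_bcontfun \<phi> x))\<^sup>2 / (16 * s))) \<partial>lborel)
           * indicator {0..L} x"
      proof (cases "x \<in> A \<and> x \<in> {0..L}")
        case True
        hence "T < (cmod (f x))\<^sup>2" by (simp add: A_def)
        hence "h * T \<le> h * (cmod (f x))\<^sup>2" "f x \<noteq> 0" using T h by auto
        moreover have "h * T = 8 * N + 8" using h by (simp add: T_def)
        ultimately show ?thesis
          using True increment_energy_pointwise[OF L \<phi> h, of x]
          by (simp add: f_def e_def N_def)
      qed (auto split: split_indicator)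
    qed
    also have "\<dots> \<le> ennreal w" by (rule w)
    finally have *: "ennreal (h / 2) * (\<integral>\<^sup>+x\<in>{0..L}. (ennreal (e x) * indicator A x) \<partial>lborel) \<le> ennreal w" .
    have "(\<integral>\<^sup>+x\<in>{0..L}. (ennreal (e x) * indicator A x) \<partial>lborel)
        = ennreal (2 / h * (h / 2)) * (\<integral>\<^sup>+x\<in>{0..L}. (ennreal (e x) * indicator A x) \<partial>lborel)" using h by simp
    also have "\<dots> = ennreal (2 / h) * (ennreal (h / 2) * (\<integral>\<^sup>+x\<in>{0..L}. (ennreal (e x) * indicator A x) \<partial>lborel))"
      using h by (subst ennreal_mult) (auto simp: mult.assoc)
    also have "\<dots> \<le> ennreal (2 / h) * ennreal w" by (intro mult_left_mono *) auto
    also have "\<dots> = ennreal (2 * w / h)" using h w by (simp flip: ennreal_mult)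
    finally show ?thesis .
  qed
  have pt: "cmod (f x) powr p \<le> (T powr ((p - 2) / 2) + K / T) * cmod (f x) powr 2 + K * exp (- Y) * (e x * indicator A x)" for x
  proof (cases "x \<in> A")
    case False
    hence "(cmod (f x))\<^sup>2 \<le> T" by (simp add: A_def)
    hence "((cmod (f x))\<^sup>2) powr ((p - 2) / 2) \<le> T powr ((p - 2) / 2)" using p by (intro powr_mono2) auto
    moreover have "((cmod (f x))\<^sup>2) powr ((p - 2) / 2) = cmod (f x) powr (p - 2)"
      by (simp add: powr_powr diff_divide_distrib algebra_simps flip: powr_numeral)
    ultimately have "cmod (f x) powr (p - 2) * cmod (f x) powr 2 \<le> T powr ((p - 2) / 2) * cmod (f x) powr 2"
      by (intro mult_right_mono) auto
    moreover have "cmod (f x) powr (p - 2) * cmod (f x) powr 2 = cmod (f x) powr p"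
      unfolding powr_add[symmetric] by simp
    moreover have "K / T * cmod (f x) powr 2 \<ge> 0" using K T by simp
    ultimately show ?thesis using False by (simp add: distrib_right del: powr_numeral)
  next
    case True
    hence T1: "T \<le> (cmod (f x))\<^sup>2" by (simp add: A_def)
    define u where "u = (cmod (f x))\<^sup>2 / (64 * h)"
    have u: "u \<ge> 0" using h by (simp add: u_def)
    have "cmod (f x) powr p = ((cmod (f x))\<^sup>2) powr (p / 2)"
      by (simp add: powr_powr flip: powr_numeral)
    also have "(cmod (f x))\<^sup>2 = 64 * h * u" using h by (simp add: u_def)
    also have "(64 * h * u) powr (p / 2) = (64 * h) powr (p / 2) * u powr (p / 2)"
      using h u by (simp add: powr_mult)
    also have "\<dots> \<le> (64 * h) powr (p / 2) * (Y powr (p / 2) * (1 + exp (u - Y)))"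
      using p Y u by (intro mult_left_mono powr_le_exp_shift) auto
    also have "\<dots> = K * 1 + K * exp (- Y) * e x"
    proof -
      have "exp (u - Y) = exp (- Y) * e x" by (simp add: e_def u_def flip: exp_add)
      thus ?thesis using h Y p by (simp add: K_def powr_mult distrib_left mult_ac)
    qed
    \<comment> \<open>On \<open>A\<close> the factor |f|^2 / T is at least 1, so the constant turns
      into something whose integral is controlled by N.\<close>
    also have "\<dots> \<le> K * ((cmod (f x))\<^sup>2 / T) + K * exp (- Y) * e x"
      using K T T1 by (intro add_right_mono mult_left_mono) auto
    also have "\<dots> \<le> (T powr ((p - 2) / 2) + K / T) * cmod (f x) powr 2 + K * exp (- Y) * (e x * indicator A x)"
      using True by (simp add: distrib_right powr_numeral)
    finally show ?thesis .
  qed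
  define c1 c2 where "c1 = T powr ((p - 2) / 2) + K / T" and "c2 = K * exp (- Y)"
  have c: "c1 \<ge> 0" "c2 \<ge> 0" using K T by (auto simp: c1_def c2_def)
  have "ennreal (lp_mass L p \<phi>) = (\<integral>\<^sup>+x\<in>{0..L}. ennreal (cmod (f x) powr p) \<partial>lborel)"
    unfolding f_def using p by (intro nn_integral_lp_mass[symmetric]) simp
  also have "\<dots> \<le> (\<integral>\<^sup>+x. ennreal c1 * (ennreal (cmod (f x) powr 2) * indicator {0..L} x)
       + ennreal c2 * ((ennreal (e x) * indicator A x) * indicator {0..L} x) \<partial>lborel)"
  proof (intro nn_integral_mono)
    fix x
    have "ennreal (cmod (f x) powr p) \<le> ennreal (c1 * cmod (f x) powr 2 + c2 * (e x * indicator A x))"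
      unfolding c1_def c2_def by (intro ennreal_leI pt)
    also have "\<dots> = ennreal c1 * ennreal (cmod (f x) powr 2) + ennreal c2 * (ennreal (e x) * indicator A x)"
      using c e0 by (subst ennreal_plus) (auto simp: ennreal_mult split: split_indicator)
    finally show "ennreal (cmod (f x) powr p) * indicator {0..L} x \<le>
       ennreal c1 * (ennreal (cmod (f x) powr 2) * indicator {0..L} x)
       + ennreal c2 * ((ennreal (e x) * indicator A x) * indicator {0..L} x)"
      by (cases "x \<in> {0..L}") auto
  qed
  also have "\<dots> = ennreal c1 * (\<integral>\<^sup>+x\<in>{0..L}. ennreal (cmod (f x) powr 2) \<partial>lborel)
       + ennreal c2 * (\<integral>\<^sup>+x\<in>{0..L}. (ennreal (e x) * indicator A x) \<partial>lborel)"
    by (subst nn_integral_add) (auto simp: nn_integral_cmult)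
  also have "(\<integral>\<^sup>+x\<in>{0..L}. ennreal (cmod (f x) powr 2) \<partial>lborel) = ennreal N"
    unfolding f_def N_def by (rule nn_integral_lp_mass) simp
  also have "ennreal c1 * ennreal N + ennreal c2 * (\<integral>\<^sup>+x\<in>{0..L}. (ennreal (e x) * indicator A x) \<partial>lborel)
      \<le> ennreal c1 * ennreal N + ennreal c2 * ennreal (2 * w / h)"
    by (intro add_left_mono mult_left_mono energy) auto
  also have "\<dots> = ennreal (c1 * N + c2 * (2 * w / h))"
  proof -
    have "0 \<le> 2 * w / h" using w h by simp
    thus ?thesis using c N by (subst ennreal_plus) (simp_all add: ennreal_mult del: times_divide_eq_right)
  qed
  finally have "ennreal (lp_mass L p \<phi>) \<le> ennreal (c1 * N + c2 * (2 * w / h))" .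
  moreover have "0 \<le> c1 * N + c2 * (2 * w / h)"
    using c N w h by (intro add_nonneg_nonneg mult_nonneg_nonneg divide_nonneg_nonneg) auto
  ultimately have "lp_mass L p \<phi> \<le> c1 * N + c2 * (2 * w / h)"
    by (simp only: ennreal_le_iff)
  also have "\<dots> \<le> T powr ((p - 2) / 2) * N + 3 * h * K"
  proof -
    have "K / T * N \<le> K * h"
    proof -
      have "N / T \<le> h" using N h by (simp add: T_def field_simps)
      hence "K * (N / T) \<le> K * h" using K by (rule mult_left_mono)
      thus ?thesis by simp
    qed
    moreover have "c2 * (2 * w / h) \<le> 2 * h * K"
    proof -
      have "exp (- Y) * w \<le> h\<^sup>2" using Y(2) by (simp add: exp_minus field_simps)
      hence "exp (- Y) * w * (2 * K / h) \<le> h\<^sup>2 * (2 * K / h)" using K h by (intro mult_right_mono) auto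
      thus ?thesis using h by (simp add: c2_def power2_eq_square mult_ac)
    qed
    moreover have "c1 * N = T powr ((p - 2) / 2) * N + K / T * N" by (simp add: c1_def distrib_right)
    ultimately show ?thesis by (simp add: mult_ac)
  qed
  finally show ?thesis by (simp add: T_def K_def N_def)
qed

section \<open>Young-type inequalities and the exponential bound\<close>

lemma powr_dominated:
  fixes a b s r :: real
  assumes "a \<ge> 0" "b > 0" "0 < s" "s < r"
  shows "\<exists>C. \<forall>x>0. a * x powr s \<le> b * x powr r + C"
proof (intro exI allI impI)
  \<comment> \<open>For a > 0 the two powers cross at \<open>x0\<close>: beyond it the right one
    dominates, below it the left one is bounded by its value there.\<close>
  define x0 where "x0 = (a / b) powr (1 / (r - s))"
  fix x :: real assume x: "x > 0"
  show "a * x powr s \<le> b * x powr r + a * x0 powr s"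
  proof (cases "x \<le> x0")
    case True
    hence "a * x powr s \<le> a * x0 powr s" using assms x by (intro mult_left_mono powr_mono2) auto
    thus ?thesis using assms by (simp add: add_increasing)
  next
    case False
    hence "x0 powr (r - s) \<le> x powr (r - s)" using assms by (intro powr_mono2) (auto simp: x0_def)
    hence "a / b \<le> x powr (r - s)" using assms by (simp add: x0_def powr_powr)
    hence "a \<le> b * x powr (r - s)" using assms by (simp add: field_simps)
    hence "a * x powr s \<le> b * x powr (r - s) * x powr s" by (intro mult_right_mono) auto
    also have "\<dots> = b * x powr r" using x by (simp add: mult.assoc flip: powr_add)
    finally show ?thesis using assms by (simp add: add_increasing2)
  qed
qed

text \<open>Young's inequality with the coefficient of Y fixed at 1/2, because the large-value term
  will use up the other half. The case split is at z Y^t = Y/2.\<close>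

lemma mult_powr_le_half:
  fixes z Y t :: real
  assumes "z \<ge> 0" "Y > 0" "0 \<le> t" "t < 1"
  shows "z * Y powr t \<le> Y / 2 + (2 * z) powr (1 / (1 - t))"
proof (cases "2 * z \<le> Y powr (1 - t)")
  case True
  hence "z * Y powr t \<le> Y powr (1 - t) / 2 * Y powr t" by (intro mult_right_mono) auto
  also have "\<dots> = Y / 2" using assms by (simp flip: powr_add)
  finally show ?thesis by (simp add: add_increasing2)
next
  case False
  hence lt: "Y powr (1 - t) < 2 * z" by simp
  have "(Y powr (1 - t)) powr (1 / (1 - t)) \<le> (2 * z) powr (1 / (1 - t))"
    using assms lt by (intro powr_mono2) auto
  hence "Y \<le> (2 * z) powr (1 / (1 - t))" using assms by (simp add: powr_powr)
  hence "Y powr t \<le> ((2 * z) powr (1 / (1 - t))) powr t" using assms by (intro powr_mono2) auto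
  hence "z * Y powr t \<le> (2 * z) powr 1 * (2 * z) powr (t / (1 - t))"
    using assms by (intro mult_mono) (auto simp: powr_powr)
  also have "\<dots> = (2 * z) powr (1 + t / (1 - t))"
    by (simp only: powr_add)
  also have "1 + t / (1 - t) = 1 / (1 - t)" using assms by (simp add: field_simps)
  finally show ?thesis using assms by (simp add: add_increasing)
qed

text \<open>The bound must be linear in w, since only the first moment of the energy is controlled.
  As exp Y is linear in w, the total coefficient of Y in the exponent has to be at most 1; the steps
  \<open>first\<close> and \<open>second\<close> spend 1/2 each.\<close>

lemma exponential_bound:
  fixes A B Q :: real
  assumes L: "L > 0" and p: "2 < p" "p < 6" and r: "r > (p + 2) / (6 - p)"
    and A: "A \<ge> 0" and B: "B > 0" and Q: "Q \<ge> 0"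
  shows "\<exists>C C0. C \<ge> 0 \<and> C0 \<ge> 0 \<and> (\<forall>\<phi>\<in>circle_functions L. \<forall>w\<ge>0. increment_energy L \<phi> \<le> ennreal w \<longrightarrow>
     exp (A * lp_mass L p \<phi> + Q * lp_mass L 2 \<phi> - B * lp_mass L 2 \<phi> powr r) \<le> C * (C0 + w))"
proof -
  define g where "g = (p - 2) / (p + 2)"
  \<comment> \<open>The power of Y that 1/h leaves in the first term. Young's inequality raises (N +
    1)^(p/2) to the power 1/(1 - t), which gives exactly \<open>r0\<close>; p < 6 is what makes t <
    1.\<close>
  define t where "t = g * ((p - 2) / 2)"
  define r0 where "r0 = (p + 2) / (6 - p)"
  have g: "0 < g" "2 * g \<le> 1" using p by (auto simp: g_def field_simps)
  have "1 - t = p * (6 - p) / (2 * (p + 2))"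
    using p by (simp add: t_def g_def field_simps)
  moreover have "p * (6 - p) / (2 * (p + 2)) > 0"
    using p by (intro divide_pos_pos mult_pos_pos) auto
  moreover have "(p / 2) * (1 / (p * (6 - p) / (2 * (p + 2)))) = r0"
    using p by (simp add: r0_def frac_eq_eq) (simp add: algebra_simps)
  ultimately have t1: "1 - t > 0" "(p / 2) * (1 / (1 - t)) = r0" by simp_all
  have t: "0 \<le> t" "t < 1" using g p t1 by (auto simp: t_def)
  have r0: "1 \<le> r0" "r0 < r" using p r by (auto simp: r0_def field_simps)
  \<comment> \<open>192 is 64 * 3, because the bound on P will be used with 3 Y in place of Y. The
    constant \<open>d\<close> satisfies A k d^((p+2)/2) = A k / (2 A k + 1), which is at most 1/2,
    also when A = 0.\<close>
  define k where "k = 3 * 192 powr (p / 2)"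
  define d where "d = (1 / (2 * A * k + 1)) powr (2 / (p + 2))"
  define c where "c = min (min L 1) d"
  have k: "k > 0" by (simp add: k_def)
  have Ak: "2 * A * k + 1 > 0" using A k by (simp add: add_nonneg_pos)
  have c: "0 < c" "c \<le> L" "c \<le> 1" using L Ak by (auto simp: c_def d_def)
  have ck: "A * k * c powr ((p + 2) / 2) \<le> 1 / 2"
  proof -
    have "c powr ((p + 2) / 2) \<le> d powr ((p + 2) / 2)" using c p by (intro powr_mono2) (auto simp: c_def)
    also have "\<dots> = (1 / (2 * A * k + 1)) powr (2 / (p + 2) * ((p + 2) / 2))"
      unfolding d_def powr_powr ..
    also have "2 / (p + 2) * ((p + 2) / 2) = 1" using p by simp
    also have "(1 / (2 * A * k + 1)) powr 1 = 1 / (2 * A * k + 1)" using Ak by simp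
    finally have "A * k * c powr ((p + 2) / 2) \<le> A * k * (1 / (2 * A * k + 1))"
      using A k by (intro mult_left_mono) auto
    also have "\<dots> \<le> 1 / 2" using Ak by (simp add: field_simps)
    finally show ?thesis .
  qed
  \<comment> \<open>The summand exp p makes Y \<ge> p, and 1/c^2 makes exp Y large enough to
    compensate the factor c^2 in h^2.\<close>
  define C0 where "C0 = exp p + 1 / c\<^sup>2"
  define a where "a = A * (8 / c) powr ((p - 2) / 2)"
  have a: "a \<ge> 0" using A by (simp add: a_def)
  define D where "D = (2 * a) powr (1 / (1 - t)) + Q"
  have D: "D \<ge> 0" using Q by (simp add: D_def)
  \<comment> \<open>The factor 1 / 2^r anticipates the passage from N + 1 back to N, (N + 1)^r \<le>
    2^r (N^r + 1). \<open>D\<close> includes Q because N \<le> (N + 1)^r0.\<close>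
  obtain C1 where C1: "\<And>x. x > 0 \<Longrightarrow> D * x powr r0 \<le> (B / 2 powr r) * x powr r + C1"
    using powr_dominated[of D "B / 2 powr r" r0 r] D B r0 by auto
  show ?thesis
  proof (rule exI[of _ "exp (B + C1)"], rule exI[of _ C0], intro conjI ballI allI impI)
    fix \<phi> w assume \<phi>: "\<phi> \<in> circle_functions L" and w: "0 \<le> w" "increment_energy L \<phi> \<le> ennreal w"
    define N where "N = lp_mass L 2 \<phi>"
    define P where "P = lp_mass L p \<phi>"
    have N: "N \<ge> 0" by (simp add: N_def lp_mass_nonneg)
    define Y where "Y = ln (C0 + w)"
    have C0w: "C0 + w > 0" using w by (simp add: C0_def add_pos_nonneg)
    have eY: "exp Y = C0 + w" using C0w by (simp add: Y_def)
    have "exp p \<le> exp Y" unfolding eY C0_def using w by simp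
    hence Yp: "Y \<ge> p" by simp
    have Y1: "Y \<ge> 1" using Yp p by simp
    \<comment> \<open>With this \<open>h\<close> the large-value term of the bound is linear in \<open>Y\<close>, and the other one contains
      \<open>Y\<close> to the power \<open>t < 1\<close> only.\<close>
    define h where "h = c * Y powr (- g)"
    have h: "0 < h" "h \<le> L"
    proof -
      show "0 < h" using c Y1 by (simp add: h_def)
      have "Y powr (- g) \<le> Y powr 0" using Y1 g by (intro powr_mono) auto
      hence "h \<le> c * 1" unfolding h_def using c Y1 by (intro mult_left_mono) auto
      thus "h \<le> L" using c by simp
    qed
    \<comment> \<open>One exp Y bounds w, a second one pays for 1/c^2, and a third one for Y^(2g),
      which is at most Y since 2 g \<le> 1. This is the origin of 3 Y.\<close>
    have wY: "w \<le> h\<^sup>2 * exp (3 * Y)"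
    proof -
      have "Y powr (2 * g) \<le> Y powr 1" using Y1 g by (intro powr_mono) auto
      also have "\<dots> \<le> exp Y" using Y1 exp_ge_add_one_self[of Y] by (simp del: exp_ge_add_one_self)
      finally have 1: "Y powr (2 * g) \<le> exp Y" .
      have "1 / c\<^sup>2 \<le> exp Y" unfolding eY C0_def using w by simp
      hence 2: "1 \<le> c\<^sup>2 * exp Y" using c by (simp add: field_simps)
      have "w \<le> exp Y * 1 * 1" unfolding eY C0_def by (simp add: add_increasing)
      also have "\<dots> \<le> exp Y * (c\<^sup>2 * exp Y) * (Y powr (- (2 * g)) * exp Y)"
        using 1 2 Y1 c by (intro mult_mono) (auto simp: powr_minus field_simps)
      also have "\<dots> = h\<^sup>2 * exp (3 * Y)"
      proof -
        have "(Y powr (- g))\<^sup>2 = Y powr (- (2 * g))"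
          using Y1 by (simp add: power2_eq_square flip: powr_add)
        moreover have "exp (3 * Y) = exp Y * exp Y * exp Y" by (simp flip: exp_add)
        ultimately show ?thesis by (simp add: h_def power_mult_distrib mult_ac)
      qed
      finally show ?thesis .
    qed
    have P: "P \<le> (8 * (N + 1) / h) powr ((p - 2) / 2) * N + 3 * h * (64 * h * (3 * Y)) powr (p / 2)"
      unfolding P_def N_def using p Yp wY h w \<phi>
      by (intro lp_mass_le_increment_energy[OF L _ \<phi>, of _ _ w]) auto
    have first: "A * ((8 * (N + 1) / h) powr ((p - 2) / 2) * N) \<le> Y / 2 + (2 * a) powr (1 / (1 - t)) * (N + 1) powr r0"
    proof -
      have "8 * (N + 1) / h = (8 / c) * ((N + 1) * Y powr g)"
        using c Y1 by (simp add: h_def powr_minus field_simps)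
      hence "(8 * (N + 1) / h) powr ((p - 2) / 2) = (8 / c) powr ((p - 2) / 2) * ((N + 1) powr ((p - 2) / 2) * Y powr t)"
        unfolding \<open>8 * (N + 1) / h = (8 / c) * ((N + 1) * Y powr g)\<close>
        by (simp only: powr_mult powr_powr t_def)
      hence "A * ((8 * (N + 1) / h) powr ((p - 2) / 2) * N) = a * ((N + 1) powr ((p - 2) / 2) * N) * Y powr t"
        by (simp add: a_def)
      also have "\<dots> \<le> a * ((N + 1) powr ((p - 2) / 2) * (N + 1) powr 1) * Y powr t"
        using a N by (intro mult_right_mono mult_left_mono) auto
      also have "(N + 1) powr ((p - 2) / 2) * (N + 1) powr 1 = (N + 1) powr (p / 2)"
        unfolding powr_add[symmetric] by (simp add: field_simps)
      also have "a * (N + 1) powr (p / 2) * Y powr t \<le> Y / 2 + (2 * (a * (N + 1) powr (p / 2))) powr (1 / (1 - t))"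
        using a t Y1 by (intro mult_powr_le_half) auto
      also have "(2 * (a * (N + 1) powr (p / 2))) powr (1 / (1 - t)) = (2 * a) powr (1 / (1 - t)) * (N + 1) powr r0"
        using a N t1(2) by (simp add: powr_mult powr_powr mult.assoc[symmetric] del: mult.assoc)
      finally show ?thesis .
    qed
    have second: "A * (3 * h * (64 * h * (3 * Y)) powr (p / 2)) \<le> Y / 2"
    proof -
      have "3 * h * (64 * h * (3 * Y)) powr (p / 2) = k * (h powr 1 * h powr (p / 2)) * Y powr (p / 2)"
        using h Y1 by (simp add: k_def powr_mult mult_ac)
      also have "h powr 1 * h powr (p / 2) = h powr ((p + 2) / 2)"
        unfolding powr_add[symmetric] by (simp add: field_simps)
      also have "\<dots> = c powr ((p + 2) / 2) * Y powr (- ((p - 2) / 2))"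
      proof -
        have "g * (p + 2) = p - 2" using p by (simp add: g_def)
        hence "- g * ((p + 2) / 2) = - ((p - 2) / 2)"
          by (simp only: minus_mult_left[symmetric] times_divide_eq_right)
        thus ?thesis by (simp only: h_def powr_mult powr_powr)
      qed
      also have "k * (c powr ((p + 2) / 2) * Y powr (- ((p - 2) / 2))) * Y powr (p / 2)
         = k * c powr ((p + 2) / 2) * (Y powr (- ((p - 2) / 2)) * Y powr (p / 2))" by simp
      also have "Y powr (- ((p - 2) / 2)) * Y powr (p / 2) = Y"
        unfolding powr_add[symmetric] using Y1 by (simp add: field_simps)
      finally have "A * (3 * h * (64 * h * (3 * Y)) powr (p / 2)) = A * k * c powr ((p + 2) / 2) * Y" by simp
      also have "\<dots> \<le> 1 / 2 * Y" using ck Y1 by (intro mult_right_mono) auto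
      finally show ?thesis by simp
    qed
    have third: "(2 * a) powr (1 / (1 - t)) * (N + 1) powr r0 + Q * N \<le> B * N powr r + (B + C1)"
    proof -
      have "N \<le> (N + 1) powr 1" using N by simp
      also have "\<dots> \<le> (N + 1) powr r0" using N r0 by (intro powr_mono) auto
      finally have "Q * N \<le> Q * (N + 1) powr r0" using Q by (rule mult_left_mono)
      hence "(2 * a) powr (1 / (1 - t)) * (N + 1) powr r0 + Q * N \<le> D * (N + 1) powr r0"
        by (simp add: D_def distrib_right)
      also have "\<dots> \<le> (B / 2 powr r) * (N + 1) powr r + C1" using N by (intro C1) simp
      also have "(N + 1) powr r \<le> 2 powr r * (N powr r + 1)"
      proof -
        have "(N + 1) powr r \<le> (2 * max N 1) powr r" using N r0 by (intro powr_mono2) auto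
        also have "\<dots> = 2 powr r * max N 1 powr r" using N by (simp add: powr_mult)
        also have "max N 1 powr r \<le> N powr r + 1" by (simp add: max_def)
        finally show ?thesis by simp
      qed
      hence "(B / 2 powr r) * (N + 1) powr r \<le> (B / 2 powr r) * (2 powr r * (N powr r + 1))"
        using B by (intro mult_left_mono) auto
      hence "(B / 2 powr r) * (N + 1) powr r + C1 \<le> B * (N powr r + 1) + C1" by simp
      finally show ?thesis by (simp add: algebra_simps)
    qed
    have "A * P \<le> A * ((8 * (N + 1) / h) powr ((p - 2) / 2) * N + 3 * h * (64 * h * (3 * Y)) powr (p / 2))"
      by (rule mult_left_mono[OF P A])
    hence "A * P + Q * N - B * N powr r \<le> (B + C1) + Y"
      using first second third by (simp only: distrib_left)
    hence "exp (A * P + Q * N - B * N powr r) \<le> exp ((B + C1) + Y)" by simp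
    thus "exp (A * lp_mass L p \<phi> + Q * lp_mass L 2 \<phi> - B * lp_mass L 2 \<phi> powr r) \<le> exp (B + C1) * (C0 + w)"
      by (simp add: P_def N_def exp_add eY)
  qed (auto simp: C0_def add_nonneg_nonneg)
qed

section \<open>Integrability for all couplings\<close>

lemma lp_mass_measurable:
  assumes L: "L > 0" and G: "gaussian_field L m \<beta> M"
  shows "lp_mass L q \<in> borel_measurable M"
proof -
  note [measurable] = gaussian_field_measurable_eval'[OF L G]
  show ?thesis unfolding lp_mass_def set_lebesgue_integral_def by measurable
qed

lemma integrable_exponential:
  assumes L: "L > 0" and m: "m > 0" and p: "2 < p" "p < 6" and r: "r > (p + 2) / (6 - p)"
    and G: "gaussian_field L m 1 M" and B: "B > 0" and Q: "Q \<ge> 0"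
  shows "integrable M (\<lambda>\<phi>. exp (A * lp_mass L p \<phi> + Q * lp_mass L 2 \<phi> - B * lp_mass L 2 \<phi> powr r))"
proof -
  interpret prob_space M using G by (simp add: gaussian_field_def)
  note [measurable] = lp_mass_measurable[OF L G] increment_energy_measurable[OF L G]
  obtain C C0 where C: "C \<ge> 0" "C0 \<ge> 0"
    and bd: "\<And>\<phi> w. \<phi> \<in> circle_functions L \<Longrightarrow> w \<ge> 0 \<Longrightarrow> increment_energy L \<phi> \<le> ennreal w \<Longrightarrow>
       exp (\<bar>A\<bar> * lp_mass L p \<phi> + Q * lp_mass L 2 \<phi> - B * lp_mass L 2 \<phi> powr r) \<le> C * (C0 + w)"
    using exponential_bound[OF L p r abs_ge_zero B Q, of A] by blast
  let ?E = "\<lambda>\<phi>. exp (A * lp_mass L p \<phi> + Q * lp_mass L 2 \<phi> - B * lp_mass L 2 \<phi> powr r)"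
  have fin: "(\<integral>\<^sup>+\<phi>. increment_energy L \<phi> \<partial>M) < \<infinity>" by (rule increment_energy_expectation[OF L m G])
  \<comment> \<open>\<open>exponential_bound\<close> asks for a real bound on the energy, so it
    applies off the null set where the energy is infinite.\<close>
  have "AE \<phi> in M. increment_energy L \<phi> \<noteq> \<infinity>"
    using fin by (intro nn_integral_PInf_AE) auto
  hence "AE \<phi> in M. ennreal (?E \<phi>) \<le> ennreal C * (ennreal C0 + increment_energy L \<phi>)"
  proof (rule AE_mp, intro AE_I2 impI)
    fix \<phi> assume \<phi>: "\<phi> \<in> space M" and "increment_energy L \<phi> \<noteq> \<infinity>"
    then obtain w where w: "w \<ge> 0" "increment_energy L \<phi> = ennreal w"
      by (cases "increment_energy L \<phi>") auto
    have "A * lp_mass L p \<phi> \<le> \<bar>A\<bar> * lp_mass L p \<phi>"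
      by (intro mult_right_mono lp_mass_nonneg) auto
    hence "?E \<phi> \<le> exp (\<bar>A\<bar> * lp_mass L p \<phi> + Q * lp_mass L 2 \<phi> - B * lp_mass L 2 \<phi> powr r)" by simp
    also have "\<dots> \<le> C * (C0 + w)"
      using \<phi> w gaussian_field_space[OF G] by (intro bd) auto
    finally have "ennreal (?E \<phi>) \<le> ennreal (C * (C0 + w))" by (rule ennreal_leI)
    also have "\<dots> = ennreal C * (ennreal C0 + increment_energy L \<phi>)"
      using C w by (simp add: ennreal_mult)
    finally show "ennreal (?E \<phi>) \<le> ennreal C * (ennreal C0 + increment_energy L \<phi>)" .
  qed
  hence "(\<integral>\<^sup>+\<phi>. ?E \<phi> \<partial>M) \<le> (\<integral>\<^sup>+\<phi>. ennreal C * (ennreal C0 + increment_energy L \<phi>) \<partial>M)"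
    by (rule nn_integral_mono_AE)
  also have "\<dots> = ennreal C * (ennreal C0 + (\<integral>\<^sup>+\<phi>. increment_energy L \<phi> \<partial>M))"
    by (simp add: nn_integral_cmult nn_integral_add emeasure_space_1)
  also have "\<dots> < \<infinity>"
    using fin by (simp add: ennreal_mult_less_top)
  finally show ?thesis by (intro integrableI_nonneg) auto
qed

text \<open>The hypothesis on \<open>r\<close> weakens as \<open>\<alpha>\<close> increases to \<open>1/2\<close>.\<close>
lemma exponent_condition:
  fixes \<alpha> p r :: real
  assumes "2 < p" "p < 6" "\<alpha> < 1 / 2" "4 * \<alpha> + 4 - p > 0" "r > (2 * \<alpha> * p + 2) / (4 * \<alpha> + 4 - p)"
  shows "r > (p + 2) / (6 - p)"
proof -
  \<comment> \<open>This is the difference of the cross products of the two fractions; it vanishes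
    at \<alpha> = 1/2.\<close>
  have "0 \<le> (p - 2)\<^sup>2 * (1 - 2 * \<alpha>)" using assms by (intro mult_nonneg_nonneg) auto
  also have "\<dots> = (2 * \<alpha> * p + 2) * (6 - p) - (p + 2) * (4 * \<alpha> + 4 - p)"
    by (simp add: power2_eq_square algebra_simps)
  finally have "(p + 2) / (6 - p) \<le> (2 * \<alpha> * p + 2) / (4 * \<alpha> + 4 - p)"
    using assms by (intro frac_le_eq[THEN iffD2]) (auto simp: divide_nonpos_pos divide_le_0_iff mult_less_0_iff)
  thus ?thesis using assms by linarith
qed

section \<open>Scaling of the Gaussian field\<close>

lemma nn_integral_lborel_scale:
  fixes f :: "'a::euclidean_space \<Rightarrow> ennreal"
  assumes [measurable]: "f \<in> borel_measurable borel" and c: "c \<noteq> 0"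
  shows "(\<integral>\<^sup>+x. f x \<partial>lborel) = ennreal (\<bar>c\<bar> ^ DIM('a)) * (\<integral>\<^sup>+x. f (c *\<^sub>R x) \<partial>lborel)"
  by (subst lborel_affine[OF c, of 0])
     (simp add: nn_integral_density nn_integral_distr nn_integral_cmult)

text \<open>A coefficient is a two-dimensional variable, so the Jacobian of scaling by sqrt \<beta>
  is \<beta>, exactly the ratio of the prefactors of the two densities.\<close>

lemma gaussian_field_scaled_mode:
  assumes \<beta>: "\<beta> > 0" and m: "m > 0"
    and G: "gaussian_field L m \<beta> M" and G1: "gaussian_field L m 1 M1"
  shows "distr M borel (\<lambda>\<phi>. of_real (sqrt \<beta>) * fourier_coeff L k \<phi>) = distr M1 borel (fourier_coeff L k)"
proof (rule measure_eqI)
  note [measurable] = gaussian_field_measurable_coeff[OF G] gaussian_field_measurable_coeff[OF G1]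
  define f where "f b z = ennreal (mode_weight L m b k / (2 * pi) * exp (- mode_weight L m b k * (cmod z)\<^sup>2 / 2))" for b z
  have [measurable]: "f b \<in> borel_measurable borel" for b unfolding f_def by measurable
  have D: "distributed M lborel (fourier_coeff L k) (f \<beta>)"
    using G unfolding gaussian_field_def f_def by blast
  have D1: "distributed M1 lborel (fourier_coeff L k) (f 1)"
    using G1 unfolding gaussian_field_def f_def by blast
  show "sets (distr M borel (\<lambda>\<phi>. of_real (sqrt \<beta>) * fourier_coeff L k \<phi>)) = sets (distr M1 borel (fourier_coeff L k))" by simp
  fix A assume "A \<in> sets (distr M borel (\<lambda>\<phi>. of_real (sqrt \<beta>) * fourier_coeff L k \<phi>))"
  hence [measurable]: "A \<in> sets borel" by simp
  let ?c = "1 / sqrt \<beta>"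
  have c: "?c \<noteq> 0" using \<beta> by simp
  have fs: "ennreal (\<bar>?c\<bar> ^ DIM(complex)) * f \<beta> (?c *\<^sub>R z) = f 1 z" for z
  proof -
    have "mode_weight L m \<beta> k * (cmod (?c *\<^sub>R z))\<^sup>2 = mode_weight L m 1 k * (cmod z)\<^sup>2"
      using \<beta> by (simp add: mode_weight_def norm_mult power_mult_distrib power_divide norm_divide)
    hence e: "- mode_weight L m \<beta> k * (cmod (?c *\<^sub>R z))\<^sup>2 / 2 = - mode_weight L m 1 k * (cmod z)\<^sup>2 / 2" by simp
    have w: "\<bar>?c\<bar> ^ DIM(complex) * (mode_weight L m \<beta> k / (2 * pi)) = mode_weight L m 1 k / (2 * pi)"
      using \<beta> by (simp add: mode_weight_def power_divide)
    show ?thesis unfolding f_def e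
      by (subst ennreal_mult'[symmetric]) (simp, metis mult.assoc w)
  qed
  have "emeasure (distr M borel (\<lambda>\<phi>. of_real (sqrt \<beta>) * fourier_coeff L k \<phi>)) A
      = (\<integral>\<^sup>+x. indicator A x \<partial>distr M borel (\<lambda>\<phi>. of_real (sqrt \<beta>) * fourier_coeff L k \<phi>))" by simp
  also have "\<dots> = (\<integral>\<^sup>+\<phi>. indicator A (of_real (sqrt \<beta>) * fourier_coeff L k \<phi>) \<partial>M)"
    by (subst nn_integral_distr) auto
  also have "\<dots> = (\<integral>\<^sup>+z. f \<beta> z * indicator A (of_real (sqrt \<beta>) * z) \<partial>lborel)"
    by (rule distributed_nn_integral[OF D, symmetric]) measurable
  also have "\<dots> = ennreal (\<bar>?c\<bar> ^ DIM(complex)) * (\<integral>\<^sup>+z. f \<beta> (?c *\<^sub>R z) * indicator A (of_real (sqrt \<beta>) * (?c *\<^sub>R z)) \<partial>lborel)"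
    by (rule nn_integral_lborel_scale[OF _ c]) measurable
  also have "\<dots> = (\<integral>\<^sup>+z. ennreal (\<bar>?c\<bar> ^ DIM(complex)) * (f \<beta> (?c *\<^sub>R z) * indicator A (of_real (sqrt \<beta>) * (?c *\<^sub>R z))) \<partial>lborel)"
    by (rule nn_integral_cmult[symmetric]) measurable
  also have "\<dots> = (\<integral>\<^sup>+z. f 1 z * indicator A z \<partial>lborel)"
    using \<beta> unfolding mult.assoc[symmetric] fs by (simp add: scaleR_conv_of_real)
  also have "\<dots> = (\<integral>\<^sup>+\<phi>. indicator A (fourier_coeff L k \<phi>) \<partial>M1)"
    by (rule distributed_nn_integral[OF D1]) measurable
  also have "\<dots> = (\<integral>\<^sup>+x. indicator A x \<partial>distr M1 borel (fourier_coeff L k))"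
    by (subst nn_integral_distr) auto
  also have "\<dots> = emeasure (distr M1 borel (fourier_coeff L k)) A" by simp
  finally show "emeasure (distr M borel (\<lambda>\<phi>. of_real (sqrt \<beta>) * fourier_coeff L k \<phi>)) A = \<dots>" .
qed

text \<open>Independence turns both joint laws into product measures, so agreement of the marginals
  suffices.\<close>

lemma gaussian_field_scaled_coeffs:
  assumes \<beta>: "\<beta> > 0" and m: "m > 0"
    and G: "gaussian_field L m \<beta> M" and G1: "gaussian_field L m 1 M1"
  shows "distr M (Pi\<^sub>M UNIV (\<lambda>_. borel)) (\<lambda>\<phi> k. of_real (sqrt \<beta>) * fourier_coeff L k \<phi>)
    = distr M1 (Pi\<^sub>M UNIV (\<lambda>_. borel)) (\<lambda>\<phi> k. fourier_coeff L k \<phi>)"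
proof -
  interpret M: prob_space M using G by (simp add: gaussian_field_def)
  interpret M1: prob_space M1 using G1 by (simp add: gaussian_field_def)
  note [measurable] = gaussian_field_measurable_coeff[OF G] gaussian_field_measurable_coeff[OF G1]
  have "M.indep_vars (\<lambda>_. borel) (fourier_coeff L) UNIV"
    using G by (simp add: gaussian_field_def)
  hence ind: "M.indep_vars (\<lambda>_. borel) (\<lambda>k \<phi>. of_real (sqrt \<beta>) * fourier_coeff L k \<phi>) UNIV"
    by (rule M.indep_vars_compose2[where Y = "\<lambda>k z. of_real (sqrt \<beta>) * z"]) measurable
  have ind1: "M1.indep_vars (\<lambda>_. borel) (fourier_coeff L) UNIV"
    using G1 by (simp add: gaussian_field_def)
  have "distr M (Pi\<^sub>M UNIV (\<lambda>_. borel)) (\<lambda>\<phi>. \<lambda>k\<in>UNIV. of_real (sqrt \<beta>) * fourier_coeff L k \<phi>)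
     = Pi\<^sub>M UNIV (\<lambda>k. distr M borel (\<lambda>\<phi>. of_real (sqrt \<beta>) * fourier_coeff L k \<phi>))"
    using ind by (subst (asm) M.indep_vars_iff_distr_eq_PiM) auto
  also have "\<dots> = Pi\<^sub>M UNIV (\<lambda>k. distr M1 borel (fourier_coeff L k))"
    unfolding gaussian_field_scaled_mode[OF assms] ..
  also have "\<dots> = distr M1 (Pi\<^sub>M UNIV (\<lambda>_. borel)) (\<lambda>\<phi>. \<lambda>k\<in>UNIV. fourier_coeff L k \<phi>)"
    using ind1 by (subst (asm) M1.indep_vars_iff_distr_eq_PiM) auto
  finally show ?thesis unfolding restrict_UNIV .
qed

text \<open>Where the Fejer means diverge, \<open>lim\<close> is an unspecified constant; this keeps the map measurable
  and does not affect coefficients of continuous functions.\<close>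
definition coeff_mass :: "real \<Rightarrow> real \<Rightarrow> (int \<Rightarrow> complex) \<Rightarrow> real" where
  "coeff_mass L q X = (LBINT t:{0..L}. cmod (lim (\<lambda>n. fejer L X n t)) powr q)"

lemma coeff_mass_measurable: "coeff_mass L q \<in> borel_measurable (Pi\<^sub>M UNIV (\<lambda>_. borel))"
  unfolding coeff_mass_def set_lebesgue_integral_def fejer_def by measurable

lemma coeff_mass_fourier_coeff:
  assumes L: "L > 0" and \<phi>: "\<phi> \<in> circle_functions L" and c: "c \<ge> 0"
  shows "coeff_mass L q (\<lambda>k. of_real c * fourier_coeff L k \<phi>) = c powr q * lp_mass L q \<phi>"
proof -
  have "lim (\<lambda>n. fejer L (\<lambda>k. of_real c * fourier_coeff L k \<phi>) n t) = of_real c * apply_bcontfun \<phi> t" for t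
  proof (rule limI)
    have "fejer L (\<lambda>k. of_real c * fourier_coeff L k \<phi>) n t = of_real c * fejer L (\<lambda>k. fourier_coeff L k \<phi>) n t" for n
      by (simp add: fejer_def sum_distrib_left mult.assoc)
    thus "(\<lambda>n. fejer L (\<lambda>k. of_real c * fourier_coeff L k \<phi>) n t) \<longlonglongrightarrow> of_real c * apply_bcontfun \<phi> t"
      using fejer_tendsto[OF L \<phi>] by (simp add: tendsto_mult_left)
  qed
  thus ?thesis using c by (simp add: coeff_mass_def lp_mass_def norm_mult powr_mult)
qed

text \<open>Equality of laws is available for coefficient sequences, so both integrals are
  transferred there by writing the masses as \<open>coeff_mass\<close>. A function F of the two
  masses is general enough because the partition function sees the field only through them.\<close>

lemma gaussian_field_scaling:
  fixes F :: "real \<Rightarrow> real \<Rightarrow> real"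
  assumes L: "L > 0" and \<beta>: "\<beta> > 0" and m: "m > 0"
    and G: "gaussian_field L m \<beta> M" and G1: "gaussian_field L m 1 M1"
    and F[measurable]: "case_prod F \<in> borel_measurable (borel \<Otimes>\<^sub>M borel)"
  shows "(LINT \<phi>|M. F (\<beta> powr (p / 2) * lp_mass L p \<phi>) (\<beta> * lp_mass L 2 \<phi>))
    = (LINT \<psi>|M1. F (lp_mass L p \<psi>) (lp_mass L 2 \<psi>))"
proof -
  note [measurable] = gaussian_field_measurable_coeff[OF G] gaussian_field_measurable_coeff[OF G1] coeff_mass_measurable
  let ?H = "\<lambda>X. F (coeff_mass L p X) (coeff_mass L 2 X)"
  have [measurable]: "?H \<in> borel_measurable (Pi\<^sub>M UNIV (\<lambda>_. borel))" by measurable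
  have "(LINT \<phi>|M. F (\<beta> powr (p / 2) * lp_mass L p \<phi>) (\<beta> * lp_mass L 2 \<phi>))
      = (LINT \<phi>|M. ?H (\<lambda>k. of_real (sqrt \<beta>) * fourier_coeff L k \<phi>))"
  proof (intro Bochner_Integration.integral_cong refl)
    fix \<phi> assume "\<phi> \<in> space M"
    hence \<phi>: "\<phi> \<in> circle_functions L" using gaussian_field_space[OF G] by simp
    have "coeff_mass L q (\<lambda>k. of_real (sqrt \<beta>) * fourier_coeff L k \<phi>) = \<beta> powr (q / 2) * lp_mass L q \<phi>" for q
      using \<beta> coeff_mass_fourier_coeff[OF L \<phi>, of "sqrt \<beta>" q] by (simp add: powr_half_sqrt[symmetric] powr_powr)
    thus "F (\<beta> powr (p / 2) * lp_mass L p \<phi>) (\<beta> * lp_mass L 2 \<phi>) = ?H (\<lambda>k. of_real (sqrt \<beta>) * fourier_coeff L k \<phi>)"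
      using \<beta> by simp
  qed
  also have "\<dots> = (LINT X|distr M (Pi\<^sub>M UNIV (\<lambda>_. borel)) (\<lambda>\<phi> k. of_real (sqrt \<beta>) * fourier_coeff L k \<phi>). ?H X)"
    by (rule integral_distr[symmetric]) (auto intro!: measurable_PiM_single')
  also have "\<dots> = (LINT X|distr M1 (Pi\<^sub>M UNIV (\<lambda>_. borel)) (\<lambda>\<phi> k. fourier_coeff L k \<phi>). ?H X)"
    unfolding gaussian_field_scaled_coeffs[OF \<beta> m G G1] ..
  also have "\<dots> = (LINT \<psi>|M1. ?H (\<lambda>k. fourier_coeff L k \<psi>))"
    by (rule integral_distr) (auto intro!: measurable_PiM_single')
  also have "\<dots> = (LINT \<psi>|M1. F (lp_mass L p \<psi>) (lp_mass L 2 \<psi>))"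
  proof (intro Bochner_Integration.integral_cong refl)
    fix \<psi> assume "\<psi> \<in> space M1"
    hence "\<psi> \<in> circle_functions L" using gaussian_field_space[OF G1] by simp
    from coeff_mass_fourier_coeff[OF L this, of 1]
    show "?H (\<lambda>k. fourier_coeff L k \<psi>) = F (lp_mass L p \<psi>) (lp_mass L 2 \<psi>)" by simp
  qed
  finally show ?thesis .
qed

section \<open>Parametric integrals\<close>

text \<open>Dominated convergence. Domination is asked for only near each point, since the couplings
  to which this will be applied are unbounded on the parameter domain.\<close>

lemma continuous_on_parametric_integral:
  fixes f :: "'b::metric_space \<Rightarrow> 'a \<Rightarrow> 'c::{banach, second_countable_topology}"
  assumes meas: "\<And>z. z \<in> S \<Longrightarrow> f z \<in> borel_measurable M"
    and cont: "\<And>x. x \<in> space M \<Longrightarrow> continuous_on S (\<lambda>z. f z x)"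
    and dom: "\<And>z0. z0 \<in> S \<Longrightarrow> \<exists>\<rho>>0. \<exists>g. integrable M g \<and>
      (\<forall>z\<in>S \<inter> ball z0 \<rho>. \<forall>x\<in>space M. norm (f z x) \<le> g x)"
  shows "continuous_on S (\<lambda>z. LINT x|M. f z x)"
  unfolding continuous_on_eq_continuous_within
proof
  fix z0 assume z0: "z0 \<in> S"
  from dom[OF z0] obtain \<rho> g where \<rho>: "\<rho> > 0" and g: "integrable M g"
    and bd: "\<And>z x. z \<in> S \<Longrightarrow> z \<in> ball z0 \<rho> \<Longrightarrow> x \<in> space M \<Longrightarrow> norm (f z x) \<le> g x" by blast
  have "((\<lambda>z. LINT x|M. f z x) \<longlongrightarrow> (LINT x|M. f z0 x)) (at z0 within (S \<inter> ball z0 \<rho>))"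
    unfolding tendsto_at_iff_sequentially
  proof (intro allI impI)
    fix X assume X: "\<forall>i. X i \<in> S \<inter> ball z0 \<rho> - {z0}" "X \<longlonglongrightarrow> z0"
    have "(\<lambda>i. LINT x|M. f (X i) x) \<longlonglongrightarrow> (LINT x|M. f z0 x)"
    proof (rule integral_dominated_convergence[OF _ _ g])
      show "f z0 \<in> borel_measurable M" "f (X i) \<in> borel_measurable M" for i
        using meas z0 X by auto
      show "AE x in M. (\<lambda>i. f (X i) x) \<longlonglongrightarrow> f z0 x"
        using cont z0 X by (intro AE_I2 continuous_on_tendsto_compose[of S "\<lambda>z. f z _"]) auto
      show "AE x in M. norm (f (X i) x) \<le> g x" for i using X bd by (intro AE_I2) auto
    qed
    thus "((\<lambda>z. LINT x|M. f z x) \<circ> X) \<longlonglongrightarrow> (LINT x|M. f z0 x)" by (simp add: o_def)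
  qed
  moreover have "at z0 within (S \<inter> ball z0 \<rho>) = at z0 within S"
    using \<rho> by (intro at_within_nhd[of z0 "ball z0 \<rho>"]) auto
  ultimately show "continuous (at z0 within S) (\<lambda>z. LINT x|M. f z x)"
    by (simp add: continuous_within)
qed

text \<open>Cauchy's inequality turns the local majorant g of f into a majorant g / (s/2) of its
  z-derivative, hence of the difference quotients, and dominated convergence applies to
  these.\<close>

lemma holomorphic_on_parametric_integral:
  fixes f :: "complex \<Rightarrow> 'a \<Rightarrow> complex"
  assumes S: "open S" and meas: "\<And>z. z \<in> S \<Longrightarrow> f z \<in> borel_measurable M"
    and hol: "\<And>x. x \<in> space M \<Longrightarrow> (\<lambda>z. f z x) holomorphic_on S"
    and dom: "\<And>z0. z0 \<in> S \<Longrightarrow> \<exists>\<rho>>0. \<exists>g. integrable M g \<and>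
      (\<forall>z\<in>S \<inter> ball z0 \<rho>. \<forall>x\<in>space M. norm (f z x) \<le> g x)"
  shows "(\<lambda>z. LINT x|M. f z x) holomorphic_on S"
  unfolding holomorphic_on_open[OF S]
proof
  fix z0 assume z0: "z0 \<in> S"
  from dom[OF z0] obtain \<rho>1 g where \<rho>1: "\<rho>1 > 0" and g: "integrable M g"
    and bd1: "\<And>z x. z \<in> S \<Longrightarrow> z \<in> ball z0 \<rho>1 \<Longrightarrow> x \<in> space M \<Longrightarrow> norm (f z x) \<le> g x" by blast
  from S z0 obtain \<rho>2 where \<rho>2: "\<rho>2 > 0" "ball z0 \<rho>2 \<subseteq> S" by (auto simp: open_contains_ball)
  \<comment> \<open>Discs of radius s/2 around points of \<open>ball z0 s\<close> stay within
    distance 2 s of \<open>z0\<close>, where both holomorphy and the majorant are at hand.\<close>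
  define s where "s = min \<rho>1 \<rho>2 / 2"
  have s: "s > 0" using \<rho>1 \<rho>2 by (simp add: s_def)
  have sub: "z \<in> S \<and> z \<in> ball z0 \<rho>1" if "dist z0 z < 2 * s" for z
    using that \<rho>2 by (auto simp: s_def)
  have bd: "norm (f z x) \<le> g x" if "dist z0 z < 2 * s" "x \<in> space M" for z x
    using bd1 sub[OF that(1)] that(2) by auto
  have lip: "norm (f z x - f z0 x) \<le> g x / (s / 2) * norm (z - z0)" if x: "x \<in> space M" and z: "z \<in> ball z0 s" for x z
  proof (rule field_differentiable_bound[of "ball z0 s" _ "deriv (\<lambda>z. f z x)"])
    fix w assume w: "w \<in> ball z0 s"
    show "((\<lambda>z. f z x) has_field_derivative deriv (\<lambda>z. f z x) w) (at w within ball z0 s)"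
    proof (rule has_field_derivative_at_within, rule holomorphic_derivI[OF hol[OF x] S])
      have "dist z0 w < 2 * s" using w s by simp
      thus "w \<in> S" using sub by blast
    qed
    have near: "dist z0 u < 2 * s" if "u \<in> cball w (s / 2)" for u
      using that w s dist_triangle[of z0 u w] unfolding mem_ball mem_cball by linarith
    have "cball w (s / 2) \<subseteq> S" using near sub by blast
    hence h: "(\<lambda>z. f z x) holomorphic_on cball w (s / 2)" using hol[OF x] holomorphic_on_subset by blast
    have "norm ((deriv ^^ 1) (\<lambda>z. f z x) w) \<le> fact 1 * g x / (s / 2) ^ 1"
    proof (rule Cauchy_inequality)
      show "(\<lambda>z. f z x) holomorphic_on ball w (s / 2)" using h ball_subset_cball holomorphic_on_subset by blast
      show "continuous_on (cball w (s / 2)) (\<lambda>z. f z x)" using h by (rule holomorphic_on_imp_continuous_on)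
      show "norm (f u x) \<le> g x" if "norm (w - u) = s / 2" for u
        using that by (intro bd x near) (simp add: dist_norm)
    qed (use s in simp)
    thus "norm (deriv (\<lambda>z. f z x) w) \<le> g x / (s / 2)" by simp
  qed (use z s in auto)
  define d where "d x = deriv (\<lambda>z. f z x) z0" for x
  have "((\<lambda>z. ((LINT x|M. f z x) - (LINT x|M. f z0 x)) / (z - z0)) \<longlongrightarrow> (LINT x|M. d x)) (at z0 within ball z0 s)"
    unfolding tendsto_at_iff_sequentially
  proof (intro allI impI)
    fix X assume X: "\<forall>i. X i \<in> ball z0 s - {z0}" "X \<longlonglongrightarrow> z0"
    have XS': "X i \<noteq> z0" "X i \<in> ball z0 s" for i using X by auto
    have Xd: "dist z0 (X i) < 2 * s" for i using XS'(2)[of i] s by simp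
    have XS: "X i \<in> S" "X i \<noteq> z0" "X i \<in> ball z0 s" for i using XS' sub[OF Xd] by auto
    have int: "integrable M (f z)" if "dist z0 z < 2 * s" for z
    proof (rule Bochner_Integration.integrable_bound[OF g])
      show "f z \<in> borel_measurable M" using meas sub[OF that] by blast
      show "AE x in M. norm (f z x) \<le> norm (g x)"
      proof (rule AE_I2)
        fix x assume "x \<in> space M"
        from bd[OF that this] show "norm (f z x) \<le> norm (g x)" by simp
      qed
    qed
    define Q where "Q i x = (f (X i) x - f z0 x) / (X i - z0)" for i x
    have Qm: "Q i \<in> borel_measurable M" for i
      unfolding Q_def using meas XS z0 by (intro borel_measurable_divide borel_measurable_diff) auto
    have lim: "(\<lambda>i. Q i x) \<longlonglongrightarrow> d x" if x: "x \<in> space M" for x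
    proof -
      have "((\<lambda>z. f z x) has_field_derivative d x) (at z0)"
        unfolding d_def by (rule holomorphic_derivI[OF hol[OF x] S z0])
      hence "((\<lambda>z. (f z x - f z0 x) / (z - z0)) \<longlongrightarrow> d x) (at z0)"
        by (simp add: has_field_derivative_iff)
      thus ?thesis using X XS unfolding tendsto_at_iff_sequentially Q_def by (auto simp: o_def)
    qed
    have "(\<lambda>i. LINT x|M. Q i x) \<longlonglongrightarrow> (LINT x|M. d x)"
    proof (rule integral_dominated_convergence)
      show "integrable M (\<lambda>x. g x / (s / 2))" using g by auto
      show "d \<in> borel_measurable M" using Qm lim by (rule borel_measurable_LIMSEQ_metric)
      show "AE x in M. (\<lambda>i. Q i x) \<longlonglongrightarrow> d x" using lim by auto
      show "AE x in M. norm (Q i x) \<le> g x / (s / 2)" for i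
      proof (rule AE_I2)
        fix x assume x: "x \<in> space M"
        show "norm (Q i x) \<le> g x / (s / 2)"
          using lip[OF x XS(3)[of i]] XS(2)[of i] by (simp add: Q_def norm_divide divide_le_eq)
      qed
    qed (use Qm in auto)
    moreover have "(LINT x|M. Q i x) = ((LINT x|M. f (X i) x) - (LINT x|M. f z0 x)) / (X i - z0)" for i
      using int[of "X i"] int[of z0] XS(3)[of i] s by (simp add: Q_def)
    ultimately show "((\<lambda>z. ((LINT x|M. f z x) - (LINT x|M. f z0 x)) / (z - z0)) \<circ> X) \<longlonglongrightarrow> (LINT x|M. d x)"
      by (simp add: o_def)
  qed
  hence "((\<lambda>z. LINT x|M. f z x) has_field_derivative (LINT x|M. d x)) (at z0 within ball z0 s)"
    by (simp add: has_field_derivative_iff)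
  thus "\<exists>f'. ((\<lambda>z. LINT x|M. f z x) has_field_derivative f') (at z0)"
    using s by (auto simp: at_within_open[of z0 "ball z0 s"])
qed

section \<open>Osgood's lemma\<close>

text \<open>A bridge from contour integrals, which are gauge integrals over the unit interval, to
  the measure-theoretic parametric integrals of the previous section.\<close>

lemma integrable_unit_interval:
  fixes f :: "real \<Rightarrow> 'a::euclidean_space"
  assumes f: "continuous_on {0..1} f"
  shows "integrable (restrict_space lborel {0..1}) f"
    and "(LINT t|restrict_space lborel {0..1}. f t) = integral {0..1} f"
proof -
  have i: "set_integrable lborel {0..1} f" by (rule borel_integrable_atLeastAtMost'[OF f])
  show "integrable (restrict_space lborel {0..1}) f"
    using i by (subst integrable_restrict_space) (auto simp: set_integrable_def)
  show "(LINT t|restrict_space lborel {0..1}. f t) = integral {0..1} f"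
    using set_borel_integral_eq_integral(2)[OF i]
    by (subst integral_restrict_space) (auto simp: set_lebesgue_integral_def)
qed

definition circle_point :: "real \<Rightarrow> real \<Rightarrow> complex" where
  "circle_point \<rho> t = of_real \<rho> * exp (2 * of_real pi * \<i> * of_real t)"

lemma norm_circle_point [simp]: "cmod (circle_point \<rho> t) = \<bar>\<rho>\<bar>"
  by (simp add: circle_point_def norm_mult)

lemma continuous_circle_point [continuous_intros]: "continuous_on A (circle_point \<rho>)"
  unfolding circle_point_def by (intro continuous_intros)

text \<open>Cauchy's formula with 2 pi i and the derivative of the path cancelled; the latter takes
  away one factor \<open>circle_point\<close>, so the power is i and not \<open>Suc i\<close>. In
  this form a Taylor coefficient is a parametric integral.\<close>

lemma taylor_coeff_circle_integral:
  assumes h: "h holomorphic_on ball a R" and \<rho>: "0 < \<rho>" "\<rho> < R"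
  shows "continuous_on {0..1} (\<lambda>t. h (a + circle_point \<rho> t) / circle_point \<rho> t ^ i)"
    and "(deriv ^^ i) h a / fact i
      = (LINT t|restrict_space lborel {0..1}. h (a + circle_point \<rho> t) / circle_point \<rho> t ^ i)"
proof -
  let ?k = "\<lambda>t. h (a + circle_point \<rho> t) / circle_point \<rho> t ^ i"
  have e: "circle_point \<rho> t \<noteq> 0" for t using \<rho> by (simp add: circle_point_def)
  have sub: "cball a \<rho> \<subseteq> ball a R" using \<rho> by auto
  hence hc: "continuous_on (cball a \<rho>) h"
    using h holomorphic_on_imp_continuous_on continuous_on_subset by blast
  have "a + circle_point \<rho> t \<in> cball a \<rho>" for t using \<rho> by (simp add: dist_norm)
  thus c: "continuous_on {0..1} ?k"
    using e by (intro continuous_intros continuous_on_compose2[OF hc]) auto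
  have "((\<lambda>u. h u / (u - a) ^ Suc i) has_contour_integral (2 * pi * \<i>) / fact i * (deriv ^^ i) h a) (circlepath a \<rho>)"
    using \<rho> hc h sub by (intro Cauchy_has_contour_integral_higher_derivative_circlepath)
      (auto intro: holomorphic_on_subset)
  hence "((\<lambda>t. h (circlepath a \<rho> t) / (circlepath a \<rho> t - a) ^ Suc i
      * vector_derivative (circlepath a \<rho>) (at t within {0..1})) has_integral (2 * pi * \<i>) / fact i * (deriv ^^ i) h a) {0..1}"
    unfolding has_contour_integral_def .
  hence "((\<lambda>t. (2 * pi * \<i>) * ?k t) has_integral (2 * pi * \<i>) / fact i * (deriv ^^ i) h a) {0..1}"
  proof (rule has_integral_eq[rotated])
    fix t :: real assume t: "t \<in> {0..1}"
    have "circlepath a \<rho> t = a + circle_point \<rho> t" by (simp add: circlepath circle_point_def)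
    moreover have "vector_derivative (circlepath a \<rho>) (at t within {0..1}) = (2 * pi * \<i>) * circle_point \<rho> t"
      using t by (simp add: vector_derivative_circlepath01 circle_point_def)
    ultimately show "h (circlepath a \<rho> t) / (circlepath a \<rho> t - a) ^ Suc i
      * vector_derivative (circlepath a \<rho>) (at t within {0..1}) = (2 * pi * \<i>) * ?k t"
      using e by simp
  qed
  hence "integral {0..1} (\<lambda>t. (2 * pi * \<i>) * ?k t) = (2 * pi * \<i>) / fact i * (deriv ^^ i) h a"
    by (rule integral_unique)
  hence "(2 * pi * \<i>) * integral {0..1} ?k = (2 * pi * \<i>) * ((deriv ^^ i) h a / fact i)"
    unfolding integral_mult_right by simp
  hence "integral {0..1} ?k = (deriv ^^ i) h a / fact i" by (subst (asm) mult_cancel_left) simp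
  thus "(deriv ^^ i) h a / fact i = (LINT t|restrict_space lborel {0..1}. ?k t)"
    using integrable_unit_interval(2)[OF c] by simp
qed

lemma taylor_sums_bound:
  assumes h: "h holomorphic_on ball a R" and bd: "\<And>w. w \<in> ball a R \<Longrightarrow> cmod (h w) \<le> B"
  shows "w \<in> ball a R \<Longrightarrow> (\<lambda>i. (deriv ^^ i) h a / fact i * (w - a) ^ i) sums h w"
    and "0 < \<rho> \<Longrightarrow> \<rho> < R \<Longrightarrow> cmod ((deriv ^^ i) h a / fact i) \<le> B / \<rho> ^ i"
proof -
  show "w \<in> ball a R \<Longrightarrow> (\<lambda>i. (deriv ^^ i) h a / fact i * (w - a) ^ i) sums h w"
    by (rule holomorphic_power_series[OF h])
  assume \<rho>: "0 < \<rho>" "\<rho> < R"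
  have sub: "cball a \<rho> \<subseteq> ball a R" using \<rho> by auto
  have "cmod ((deriv ^^ i) h a) \<le> fact i * B / \<rho> ^ i"
  proof (rule Cauchy_inequality)
    show "h holomorphic_on ball a \<rho>" using h \<rho> by (auto intro: holomorphic_on_subset)
    show "continuous_on (cball a \<rho>) h"
      using h sub holomorphic_on_imp_continuous_on continuous_on_subset by blast
    show "cmod (h x) \<le> B" if "cmod (a - x) = \<rho>" for x using that \<rho> by (intro bd) (simp add: dist_norm)
  qed (use \<rho> in simp)
  thus "cmod ((deriv ^^ i) h a / fact i) \<le> B / \<rho> ^ i" by (simp add: norm_divide divide_le_eq mult.commute)
qed

text \<open>The induction step of Osgood's lemma: taking a Taylor coefficient in one variable
  preserves continuity and holomorphy in the others. The map \<open>c\<close> selects a coordinate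
  line in \<open>P\<close>, so that the same statement serves when two variables remain and when one
  does.\<close>

lemma taylor_coeff_parametric:
  fixes F :: "complex \<Rightarrow> 'b::metric_space \<Rightarrow> complex"
  assumes R: "R > 0" and cont: "continuous_on (ball a R \<times> P) (\<lambda>(w, q). F w q)"
    and hol: "\<And>q. q \<in> P \<Longrightarrow> (\<lambda>w. F w q) holomorphic_on ball a R"
    and bd: "\<And>w q. w \<in> ball a R \<Longrightarrow> q \<in> P \<Longrightarrow> cmod (F w q) \<le> B"
  defines "A \<equiv> \<lambda>i q. (deriv ^^ i) (\<lambda>w. F w q) a / fact i"
  shows "continuous_on P (A i)"
    and "\<And>T c. open T \<Longrightarrow> c ` T \<subseteq> P \<Longrightarrow> (\<And>w. w \<in> ball a R \<Longrightarrow> (\<lambda>\<zeta>. F w (c \<zeta>)) holomorphic_on T)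
      \<Longrightarrow> (\<lambda>\<zeta>. A i (c \<zeta>)) holomorphic_on T"
proof -
  define \<rho> where "\<rho> = R / 2"
  have \<rho>: "0 < \<rho>" "\<rho> < R" using R by (auto simp: \<rho>_def)
  let ?M = "restrict_space lborel {0..1::real}"
  let ?k = "\<lambda>q t. F (a + circle_point \<rho> t) q / circle_point \<rho> t ^ i"
  have inb: "a + circle_point \<rho> t \<in> ball a R" for t using \<rho> by (simp add: dist_norm)
  have A: "A i q = (LINT t|?M. ?k q t)" if "q \<in> P" for q
    unfolding A_def by (rule taylor_coeff_circle_integral(2)[OF hol[OF that] \<rho>])
  have meas: "?k q \<in> borel_measurable ?M" if "q \<in> P" for q
    using integrable_unit_interval(1)[OF taylor_coeff_circle_integral(1)[OF hol[OF that] \<rho>]] by auto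
  have kb: "cmod (?k q t) \<le> B / \<rho> ^ i" if "q \<in> P" for q t
    using bd[OF inb that] \<rho> by (simp add: norm_divide norm_power divide_right_mono)
  have const: "integrable ?M (\<lambda>_. B / \<rho> ^ i)"
    by (intro integrable_unit_interval(1) continuous_intros)
  have "continuous_on P (\<lambda>q. LINT t|?M. ?k q t)"
  proof (rule continuous_on_parametric_integral)
    fix t
    have "continuous_on P (\<lambda>q. (\<lambda>(w, q). F w q) (a + circle_point \<rho> t, q))"
      by (intro continuous_on_compose2[OF cont] continuous_intros) (use inb in auto)
    thus "continuous_on P (\<lambda>q. ?k q t)" using \<rho> by (auto simp: circle_point_def intro!: continuous_intros)
  next
    fix z0 assume "z0 \<in> P"
    show "\<exists>\<rho>'>0. \<exists>g. integrable ?M g \<and> (\<forall>z\<in>P \<inter> ball z0 \<rho>'. \<forall>x\<in>space ?M. cmod (?k z x) \<le> g x)"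
      using const kb by (intro exI[of _ "1::real"] conjI exI[of _ "\<lambda>_. B / \<rho> ^ i"]) auto
  qed (use meas in auto)
  thus "continuous_on P (A i)" using A by (simp cong: continuous_on_cong)
  fix T and c :: "complex \<Rightarrow> 'b"
  assume T: "open T" "c ` T \<subseteq> P" and h: "\<And>w. w \<in> ball a R \<Longrightarrow> (\<lambda>\<zeta>. F w (c \<zeta>)) holomorphic_on T"
  have "(\<lambda>\<zeta>. LINT t|?M. ?k (c \<zeta>) t) holomorphic_on T"
  proof (rule holomorphic_on_parametric_integral[OF T(1)])
    fix t
    show "(\<lambda>\<zeta>. ?k (c \<zeta>) t) holomorphic_on T"
      using \<rho> by (intro holomorphic_intros h inb) (auto simp: circle_point_def)
  next
    fix z0 assume "z0 \<in> T"
    show "\<exists>\<rho>'>0. \<exists>g. integrable ?M g \<and> (\<forall>z\<in>T \<inter> ball z0 \<rho>'. \<forall>x\<in>space ?M. cmod (?k (c z) x) \<le> g x)"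
      using const kb T by (intro exI[of _ "1::real"] conjI exI[of _ "\<lambda>_. B / \<rho> ^ i"]) auto
  qed (use meas T in auto)
  thus "(\<lambda>\<zeta>. A i (c \<zeta>)) holomorphic_on T"
    using A T(2) by (subst holomorphic_cong[OF refl]) auto
qed

lemma abs_summable_on_product:
  fixes f :: "'a \<Rightarrow> real" and g :: "'b \<Rightarrow> real"
  assumes "Infinite_Sum.abs_summable_on f A" "Infinite_Sum.abs_summable_on g B"
  shows "Infinite_Sum.abs_summable_on (\<lambda>(x, y). f x * g y) (A \<times> B)"
  unfolding Infinite_Sum.abs_summable_on_Sigma_iff using assms
  by (auto simp: abs_mult infsum_cmult_right' intro!: summable_on_cmult_right summable_on_cmult_left)

text \<open>The geometric majorant gives unconditional summability over triples, and the iterated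
  sums then identify the value.\<close>

lemma iterated_power_series_has_sum:
  fixes C :: "nat \<Rightarrow> nat \<Rightarrow> nat \<Rightarrow> complex"
  assumes bd: "\<And>i j k. cmod (C i j k) \<le> B * (1/2) ^ i * (1/2) ^ j * (1/2) ^ k"
    and 3: "\<And>i j. (\<lambda>k. C i j k) sums (S2 i j)" and 2: "\<And>i. (\<lambda>j. S2 i j) sums (S1 i)" and 1: "S1 sums S"
  shows "((\<lambda>(i, j, k). C i j k) has_sum S) UNIV"
proof -
  have half: "Infinite_Sum.abs_summable_on (\<lambda>i::nat. (1/2::real) ^ i) UNIV"
    by (simp add: summable_on_UNIV_nonneg_real_iff norm_power)
  have half': "Infinite_Sum.abs_summable_on (\<lambda>i::nat. b * (1/2::real) ^ i) UNIV" for b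
    using half by (simp add: abs_mult summable_on_cmult_right)
  have Z: "(\<lambda>k. C i j k) summable_on UNIV" for i j
    by (rule abs_summable_summable[OF Infinite_Sum.abs_summable_on_comparison_test[OF half'[of "B * (1/2) ^ i * (1/2) ^ j"]]])
       (use bd in \<open>auto intro: order_trans[OF bd abs_ge_self]\<close>)
  have YZ: "(\<lambda>(j, k). C i j k) summable_on (UNIV \<times> UNIV)" for i
    by (rule abs_summable_summable[OF Infinite_Sum.abs_summable_on_comparison_test[OF
          abs_summable_on_product[OF half'[of "B * (1/2) ^ i"] half]]])
       (use bd in \<open>auto intro: order_trans[OF bd abs_ge_self]\<close>)
  have XYZ: "(\<lambda>(i, j, k). C i j k) summable_on (UNIV \<times> (UNIV \<times> UNIV))"
    by (rule abs_summable_summable[OF Infinite_Sum.abs_summable_on_comparison_test[OF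
          abs_summable_on_product[OF half'[of B] abs_summable_on_product[OF half half]]]])
       (use bd in \<open>auto simp: mult.assoc intro: order_trans[OF bd[unfolded mult.assoc] abs_ge_self]\<close>)
  have hZ: "((\<lambda>k. C i j k) has_sum S2 i j) UNIV" for i j
    using Z[of i j] 3[of i j] has_sum_imp_sums sums_unique2 unfolding summable_on_def by blast
  have hYZ: "((\<lambda>(j, k). C i j k) has_sum S1 i) (UNIV \<times> UNIV)" for i
  proof -
    obtain s where s: "((\<lambda>(j, k). C i j k) has_sum s) (UNIV \<times> UNIV)" using YZ[of i] by (auto simp: summable_on_def)
    have "((\<lambda>j. S2 i j) has_sum s) UNIV"
      by (rule has_sum_SigmaD[OF s]) (use hZ in simp)
    hence "s = S1 i" using 2[of i] has_sum_imp_sums sums_unique2 by blast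
    thus ?thesis using s by simp
  qed
  obtain s where s: "((\<lambda>(i, j, k). C i j k) has_sum s) (UNIV \<times> (UNIV \<times> UNIV))" using XYZ by (auto simp: summable_on_def)
  have "(S1 has_sum s) UNIV"
    by (rule has_sum_SigmaD[OF s]) (use hYZ in simp)
  hence "s = S" using 1 has_sum_imp_sums sums_unique2 by blast
  thus ?thesis using s by simp
qed

text \<open>The function is expanded in x, the coefficients in y, and their coefficients in z.
  Assuming continuity and a bound, unlike in Hartogs' theorem, makes each coefficient a continuous
  function of the remaining variables with Cauchy estimates that multiply up.\<close>

theorem separately_holomorphic_power_series:
  fixes F :: "complex \<times> complex \<times> complex \<Rightarrow> complex"
  assumes R: "R > 0" and cont: "continuous_on (ball a R \<times> ball b R \<times> ball c R) F"
    and bd: "\<And>x y z. x \<in> ball a R \<Longrightarrow> y \<in> ball b R \<Longrightarrow> z \<in> ball c R \<Longrightarrow> cmod (F (x, y, z)) \<le> B"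
    and holx: "\<And>y z. y \<in> ball b R \<Longrightarrow> z \<in> ball c R \<Longrightarrow> (\<lambda>x. F (x, y, z)) holomorphic_on ball a R"
    and holy: "\<And>x z. x \<in> ball a R \<Longrightarrow> z \<in> ball c R \<Longrightarrow> (\<lambda>y. F (x, y, z)) holomorphic_on ball b R"
    and holz: "\<And>x y. x \<in> ball a R \<Longrightarrow> y \<in> ball b R \<Longrightarrow> (\<lambda>z. F (x, y, z)) holomorphic_on ball c R"
  shows "\<exists>\<rho>>0. \<exists>C :: nat \<times> nat \<times> nat \<Rightarrow> complex. \<forall>x y z.
        cmod (x - a) < \<rho> \<and> cmod (y - b) < \<rho> \<and> cmod (z - c) < \<rho> \<longrightarrow>
        ((\<lambda>(i, j, k). C (i, j, k) * (x - a) ^ i * (y - b) ^ j * (z - c) ^ k) has_sum F (x, y, z)) UNIV"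
proof -
  define \<rho> where "\<rho> = R / 2"
  have \<rho>: "0 < \<rho>" "\<rho> < R" using R by (auto simp: \<rho>_def)
  define A1 where "A1 i q = (deriv ^^ i) (\<lambda>x. F (x, q)) a / fact i" for i q
  define A2 where "A2 i j z = (deriv ^^ j) (\<lambda>y. A1 i (y, z)) b / fact j" for i j z
  define A3 where "A3 i j k = (deriv ^^ k) (\<lambda>z. A2 i j z) c / fact k" for i j k
  let ?P = "ball b R \<times> ball c R"
  have p1: "(\<lambda>x. F (x, q)) holomorphic_on ball a R" "\<And>x. x \<in> ball a R \<Longrightarrow> cmod (F (x, q)) \<le> B"
    if "q \<in> ?P" for q using that holx bd by auto
  have A1s: "(\<lambda>i. A1 i q * (x - a) ^ i) sums F (x, q)" if "q \<in> ?P" "x \<in> ball a R" for q x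
    unfolding A1_def using taylor_sums_bound(1)[OF p1[OF that(1)] that(2)] .
  have A1b: "cmod (A1 i q) \<le> B / \<rho> ^ i" if "q \<in> ?P" for i q
    unfolding A1_def using taylor_sums_bound(2)[OF p1[OF that] \<rho>] .
  have cF: "continuous_on (ball a R \<times> ?P) (\<lambda>(x, q). F (x, q))" using cont by simp
  note par1 = taylor_coeff_parametric[of R a ?P "\<lambda>x q. F (x, q)" B, OF R cF p1, folded A1_def]
  have A1c: "continuous_on ?P (A1 i)" for i using par1(1) by blast
  have A1y: "(\<lambda>y. A1 i (y, z)) holomorphic_on ball b R" if "z \<in> ball c R" for i z
    using that holy by (intro par1(2)) auto
  have A1z: "(\<lambda>z. A1 i (y, z)) holomorphic_on ball c R" if "y \<in> ball b R" for i y
    using that holz by (intro par1(2)) auto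
  have A2s: "(\<lambda>j. A2 i j z * (y - b) ^ j) sums A1 i (y, z)" if "z \<in> ball c R" "y \<in> ball b R" for i y z
    unfolding A2_def using that A1b by (intro taylor_sums_bound(1)[OF A1y[OF that(1)], where B = "B / \<rho> ^ i"]) auto
  have A2b: "cmod (A2 i j z) \<le> B / \<rho> ^ i / \<rho> ^ j" if "z \<in> ball c R" for i j z
    unfolding A2_def using that A1b \<rho> by (intro taylor_sums_bound(2)[OF A1y[OF that], where B = "B / \<rho> ^ i"]) auto
  have cA1: "continuous_on (ball b R \<times> ball c R) (\<lambda>(y, z). A1 i (y, z))" for i using A1c by simp
  have A2z: "(\<lambda>z. A2 i j z) holomorphic_on ball c R" for i j
    unfolding A2_def
    by (rule taylor_coeff_parametric(2)[OF R cA1 A1y, where c = "\<lambda>z. z" and B = "B / \<rho> ^ i"])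
       (use A1b A1z in auto)
  have A3s: "(\<lambda>k. A3 i j k * (z - c) ^ k) sums A2 i j z" if "z \<in> ball c R" for i j z
    unfolding A3_def using that A2b by (intro taylor_sums_bound(1)[OF A2z, where B = "B / \<rho> ^ i / \<rho> ^ j"]) auto
  have A3b: "cmod (A3 i j k) \<le> B / \<rho> ^ i / \<rho> ^ j / \<rho> ^ k" for i j k
    unfolding A3_def using A2b \<rho> by (intro taylor_sums_bound(2)[OF A2z, where B = "B / \<rho> ^ i / \<rho> ^ j"]) auto
  have B: "B \<ge> 0" using order_trans[OF norm_ge_zero bd[of a b c]] R by simp
  show ?thesis
  \<comment> \<open>The Cauchy estimates hold with radius \<rho>; at half that radius the terms are
    at most B / 2^(i+j+k).\<close>
  proof (rule exI[of _ "\<rho> / 2"], intro conjI, use \<rho> in simp, rule exI[of _ "\<lambda>(i, j, k). A3 i j k"], intro allI impI)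
    fix x y z assume d: "cmod (x - a) < \<rho> / 2 \<and> cmod (y - b) < \<rho> / 2 \<and> cmod (z - c) < \<rho> / 2"
    hence x: "x \<in> ball a R" and y: "y \<in> ball b R" and z: "z \<in> ball c R"
      using \<rho> by (auto simp: dist_norm norm_minus_commute)
    have pw: "u ^ n / \<rho> ^ n \<le> (1/2) ^ n" if "0 \<le> u" "u < \<rho> / 2" for u n
      using that \<rho> by (simp only: power_divide[symmetric]) (intro power_mono, auto simp: field_simps)
    have "((\<lambda>(i, j, k). A3 i j k * (x - a) ^ i * (y - b) ^ j * (z - c) ^ k) has_sum F (x, y, z)) UNIV"
    proof (rule iterated_power_series_has_sum)
      fix i j k
      have "cmod (A3 i j k * (x - a) ^ i * (y - b) ^ j * (z - c) ^ k)
          = cmod (A3 i j k) * (cmod (x - a) ^ i * cmod (y - b) ^ j * cmod (z - c) ^ k)"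
        by (simp add: norm_mult norm_power)
      also have "\<dots> \<le> B / \<rho> ^ i / \<rho> ^ j / \<rho> ^ k * (cmod (x - a) ^ i * cmod (y - b) ^ j * cmod (z - c) ^ k)"
        by (intro mult_right_mono A3b) auto
      also have "\<dots> = B * (cmod (x - a) ^ i / \<rho> ^ i) * (cmod (y - b) ^ j / \<rho> ^ j) * (cmod (z - c) ^ k / \<rho> ^ k)"
        by simp
      also have "\<dots> \<le> B * (1/2) ^ i * (1/2) ^ j * (1/2) ^ k"
        using d B \<rho> by (intro mult_mono mult_left_mono pw mult_nonneg_nonneg divide_nonneg_nonneg) auto
      finally show "cmod (A3 i j k * (x - a) ^ i * (y - b) ^ j * (z - c) ^ k) \<le> B * (1/2) ^ i * (1/2) ^ j * (1/2) ^ k" .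
    next
      fix i j
      show "(\<lambda>k. A3 i j k * (x - a) ^ i * (y - b) ^ j * (z - c) ^ k) sums (A2 i j z * (y - b) ^ j * (x - a) ^ i)"
        using sums_mult[OF A3s[OF z, of i j], of "(x - a) ^ i * (y - b) ^ j"] by (simp add: mult_ac)
    next
      fix i
      show "(\<lambda>j. A2 i j z * (y - b) ^ j * (x - a) ^ i) sums (A1 i (y, z) * (x - a) ^ i)"
        by (rule sums_mult2[OF A2s[OF z y]])
    next
      show "(\<lambda>i. A1 i (y, z) * (x - a) ^ i) sums F (x, y, z)"
        using A1s[of "(y, z)" x] x y z by simp
    qed
    thus "((\<lambda>(i, j, k). (case (i, j, k) of (i, j, k) \<Rightarrow> A3 i j k) * (x - a) ^ i * (y - b) ^ j * (z - c) ^ k) has_sum F (x, y, z)) UNIV"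
      by simp
  qed
qed

section \<open>The pressure\<close>

lemma open_contains_polydisc:
  fixes V :: "(complex \<times> complex \<times> complex) set"
  assumes "open V" "(a, b, c) \<in> V"
  shows "\<exists>R>0. ball a R \<times> ball b R \<times> ball c R \<subseteq> V"
proof -
  obtain A BC where A: "open A" "open BC" "(a, b, c) \<in> A \<times> BC" "A \<times> BC \<subseteq> V"
    using open_prod_elim[OF assms] by blast
  hence "(b, c) \<in> BC" by simp
  then obtain B C where BC: "open B" "open C" "(b, c) \<in> B \<times> C" "B \<times> C \<subseteq> BC"
    using open_prod_elim[OF A(2)] by blast
  obtain r1 where r1: "r1 > 0" "ball a r1 \<subseteq> A" using A by (auto simp: open_contains_ball)
  obtain r2 where r2: "r2 > 0" "ball b r2 \<subseteq> B" using BC by (auto simp: open_contains_ball)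
  obtain r3 where r3: "r3 > 0" "ball c r3 \<subseteq> C" using BC by (auto simp: open_contains_ball)
  define R where "R = min r1 (min r2 r3)"
  have "ball a R \<subseteq> A" "ball b R \<subseteq> B" "ball c R \<subseteq> C"
    using r1 r2 r3 by (auto simp: R_def)
  hence "ball a R \<times> ball b R \<times> ball c R \<subseteq> V" using A BC by blast
  moreover have "R > 0" using r1 r2 r3 by (simp add: R_def)
  ultimately show ?thesis by blast
qed

locale pressure =
  fixes L m p r :: real and M :: "(real \<Rightarrow>\<^sub>C complex) measure"
  assumes L: "L > 0" and m: "m > 0" and p: "2 < p" "p < 6" and r: "r > (p + 2) / (6 - p)"
    and G: "gaussian_field L m 1 M"
begin

sublocale prob_space M using G by (simp add: gaussian_field_def)

lemma r_pos: "r > 0"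
proof -
  have "(p + 2) / (6 - p) > 0" using p by simp
  thus ?thesis using r by linarith
qed

text \<open>The coefficient of \<open>P\<close> in the exponent, as \<open>confinement\<close> is
  that of -N^r. The expression by \<open>exp\<close> and \<open>Ln\<close> agrees with
  \<open>powr\<close> for nonzero \<beta>.\<close>

definition power_coupling :: "complex \<times> complex \<times> complex \<Rightarrow> complex" where
  "power_coupling = (\<lambda>(\<kappa>, \<beta>, \<Lambda>). \<Lambda> * exp (of_real (1 - p / 2) * Ln \<beta>) / of_real p)"

definition confinement :: "complex \<times> complex \<times> complex \<Rightarrow> complex" where
  "confinement = (\<lambda>(\<kappa>, \<beta>, \<Lambda>). exp (of_real (1 - r) * Ln \<beta>) * \<kappa> / of_real r)"

definition weight :: "complex \<times> complex \<times> complex \<Rightarrow> (real \<Rightarrow>\<^sub>C complex) \<Rightarrow> complex" where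
  "weight q \<psi> = exp (power_coupling q * of_real (lp_mass L p \<psi>)
     + of_real (m\<^sup>2 / 2 * lp_mass L 2 \<psi>) - confinement q * of_real (lp_mass L 2 \<psi> powr r))"

definition parameters :: "(complex \<times> complex \<times> complex) set" where
  "parameters = {q. Re (fst (snd q)) > 0 \<and> Re (confinement q) > 0}"

definition partition_val :: "complex \<times> complex \<times> complex \<Rightarrow> complex" where
  "partition_val q = (LINT \<psi>|M. weight q \<psi>)"

lemma not_nonpos: "Re z > 0 \<Longrightarrow> z \<notin> \<real>\<^sub>\<le>\<^sub>0"
  by (auto simp: complex_nonpos_Reals_iff)

lemma continuous_on_couplings:
  "continuous_on {q. Re (fst (snd q)) > 0} power_coupling"
  "continuous_on {q. Re (fst (snd q)) > 0} confinement"
  unfolding power_coupling_def confinement_def case_prod_unfold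
  using p r_pos by (auto intro!: continuous_intros not_nonpos)

lemma open_half: "open {q :: complex \<times> complex \<times> complex. Re (fst (snd q)) > 0}"
  by (intro open_Collect_less continuous_intros)

lemma open_parameters: "open parameters"
proof -
  have "open ({q. Re (fst (snd q)) > 0} \<inter> confinement -` {z. Re z > 0})"
    by (intro continuous_open_preimage continuous_on_couplings open_half open_halfspace_Re_gt)
  moreover have "parameters = {q. Re (fst (snd q)) > 0} \<inter> confinement -` {z. Re z > 0}"
    by (auto simp: parameters_def)
  ultimately show ?thesis by simp
qed

section \<open>Regularity of the partition function and of its logarithm\<close>

lemma weight_measurable: "weight q \<in> borel_measurable M"
proof -
  note [measurable] = lp_mass_measurable[OF L G]
  show ?thesis unfolding weight_def by measurable
qed

text \<open>The modulus of an exponential depends on the real part of the exponent only, and both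
  masses are nonnegative. So it suffices that near \<open>q0\<close> the power coupling stays below
  A in modulus and the real part of the confinement above B; taking half of its value at
  \<open>q0\<close> keeps B positive.\<close>

lemma weight_dominated:
  assumes q0: "q0 \<in> parameters"
  shows "\<exists>\<rho>>0. \<exists>g. integrable M g \<and> (\<forall>q\<in>ball q0 \<rho>. \<forall>\<psi>\<in>space M. cmod (weight q \<psi>) \<le> g \<psi>)"
proof -
  define B where "B = Re (confinement q0) / 2"
  define A where "A = cmod (power_coupling q0) + 1"
  have B: "B > 0" using q0 by (simp add: B_def parameters_def)
  have cont: "continuous_on parameters power_coupling" "continuous_on parameters confinement"
    using continuous_on_couplings by (auto intro: continuous_on_subset simp: parameters_def)
  define O1 where "O1 = parameters \<inter> power_coupling -` {z. cmod z < A}"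
  define O2 where "O2 = parameters \<inter> confinement -` {z. B < Re z}"
  have "open O1" unfolding O1_def
    by (intro continuous_open_preimage cont open_parameters open_Collect_less continuous_intros)
  moreover have "open O2" unfolding O2_def
    by (intro continuous_open_preimage cont open_parameters open_halfspace_Re_gt)
  ultimately have "open (O1 \<inter> O2)" by blast
  moreover have "q0 \<in> O1 \<inter> O2" using q0 B by (auto simp: O1_def O2_def A_def B_def)
  ultimately obtain \<rho> where \<rho>: "\<rho> > 0" "ball q0 \<rho> \<subseteq> O1 \<inter> O2" by (rule openE)
  let ?g = "\<lambda>\<psi>. exp (A * lp_mass L p \<psi> + m\<^sup>2 / 2 * lp_mass L 2 \<psi> - B * lp_mass L 2 \<psi> powr r)"
  have "integrable M ?g" by (rule integrable_exponential[OF L m p r G B]) simp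
  moreover have "cmod (weight q \<psi>) \<le> ?g \<psi>" if "q \<in> ball q0 \<rho>" for q \<psi>
  proof -
    have q: "cmod (power_coupling q) < A" "B < Re (confinement q)"
      using that \<rho> by (auto simp: O1_def O2_def)
    have "Re (power_coupling q) * lp_mass L p \<psi> \<le> A * lp_mass L p \<psi>"
      using q complex_Re_le_cmod[of "power_coupling q"] by (intro mult_right_mono lp_mass_nonneg) linarith
    moreover have "B * lp_mass L 2 \<psi> powr r \<le> Re (confinement q) * lp_mass L 2 \<psi> powr r"
      using q by (intro mult_right_mono) auto
    ultimately show ?thesis by (simp add: weight_def)
  qed
  ultimately show ?thesis using \<rho> by blast
qed

lemma integrable_weight:
  assumes "q \<in> parameters" shows "integrable M (weight q)"
proof -
  obtain \<rho> g where \<rho>: "\<rho> > 0" and g: "integrable M g"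
    and bd: "\<And>q' \<psi>. q' \<in> ball q \<rho> \<Longrightarrow> \<psi> \<in> space M \<Longrightarrow> cmod (weight q' \<psi>) \<le> g \<psi>"
    using weight_dominated[OF assms] by blast
  show ?thesis
  proof (rule Bochner_Integration.integrable_bound[OF g weight_measurable], rule AE_I2)
    fix \<psi> assume "\<psi> \<in> space M"
    from bd[OF _ this, of q] \<rho> show "cmod (weight q \<psi>) \<le> norm (g \<psi>)" by simp
  qed
qed

lemma continuous_on_partition: "continuous_on parameters partition_val"
  unfolding partition_val_def
proof (rule continuous_on_parametric_integral)
  have cont: "continuous_on parameters power_coupling" "continuous_on parameters confinement"
    using continuous_on_couplings by (auto intro: continuous_on_subset simp: parameters_def)
  show "continuous_on parameters (\<lambda>q. weight q \<psi>)" for \<psi>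
    unfolding weight_def by (intro continuous_intros cont)
  show "\<exists>\<rho>>0. \<exists>g. integrable M g \<and> (\<forall>q\<in>parameters \<inter> ball q0 \<rho>. \<forall>\<psi>\<in>space M. cmod (weight q \<psi>) \<le> g \<psi>)"
    if "q0 \<in> parameters" for q0 using weight_dominated[OF that] by blast
qed (rule weight_measurable)

text \<open>The curve \<open>c\<close> will be an embedding of a coordinate line.\<close>
lemma holomorphic_on_partition_curve:
  fixes c :: "complex \<Rightarrow> complex \<times> complex \<times> complex"
  assumes T: "open T" "c ` T \<subseteq> parameters" and iso: "\<And>z w. dist (c z) (c w) = dist z w"
    and h: "(\<lambda>z. power_coupling (c z)) holomorphic_on T" "(\<lambda>z. confinement (c z)) holomorphic_on T"
  shows "(\<lambda>z. partition_val (c z)) holomorphic_on T"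
  unfolding partition_val_def
proof (rule holomorphic_on_parametric_integral[OF T(1)])
  show "(\<lambda>z. weight (c z) \<psi>) holomorphic_on T" for \<psi>
    unfolding weight_def by (intro holomorphic_intros h)
  fix z0 assume "z0 \<in> T"
  hence "c z0 \<in> parameters" using T by auto
  then obtain \<rho> g where \<rho>: "\<rho> > 0" and g: "integrable M g"
    and bd: "\<And>q \<psi>. q \<in> ball (c z0) \<rho> \<Longrightarrow> \<psi> \<in> space M \<Longrightarrow> cmod (weight q \<psi>) \<le> g \<psi>"
    using weight_dominated by blast
  \<comment> \<open>Since \<open>c\<close> is an isometry, the radius around \<open>c z0\<close>
    works around \<open>z0\<close> as well.\<close>
  show "\<exists>\<rho>>0. \<exists>g. integrable M g \<and> (\<forall>z\<in>T \<inter> ball z0 \<rho>. \<forall>\<psi>\<in>space M. cmod (weight (c z) \<psi>) \<le> g \<psi>)"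
    using \<rho> g bd iso by (intro exI[of _ \<rho>] conjI exI[of _ g] ballI) auto
qed (rule weight_measurable)

text \<open>The condition on the real part excludes zeros of the partition function and at the same
  time keeps its values off the cut of \<open>Ln\<close>.\<close>

definition log_domain :: "(complex \<times> complex \<times> complex) set" where
  "log_domain = parameters \<inter> partition_val -` {z. Re z > 0}"

lemma open_log_domain: "open log_domain"
  unfolding log_domain_def
  by (intro continuous_open_preimage continuous_on_partition open_parameters open_halfspace_Re_gt)

text \<open>Osgood's lemma is applied to the logarithm itself, so that no power series has to be
  substituted into another. The bound it asks for comes from shrinking to \<open>V\<close>, where
  the logarithm stays near its value at the centre.\<close>

lemma analytic3_on_log: "analytic3_on (\<lambda>q. Ln (partition_val q)) log_domain"
  unfolding analytic3_on_def
proof (clarify)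
  fix a b c assume abc: "(a, b, c) \<in> log_domain"
  let ?F = "\<lambda>q. Ln (partition_val q)"
  have nonpos: "partition_val q \<notin> \<real>\<^sub>\<le>\<^sub>0" if "q \<in> log_domain" for q
    using that by (intro not_nonpos) (simp add: log_domain_def)
  have cont: "continuous_on log_domain ?F"
    using nonpos continuous_on_partition
    by (intro continuous_intros) (auto intro: continuous_on_subset simp: log_domain_def)
  define B where "B = cmod (?F (a, b, c)) + 1"
  define V where "V = log_domain \<inter> ?F -` {z. cmod z < B}"
  have "open V" unfolding V_def
    by (intro continuous_open_preimage cont open_log_domain open_Collect_less continuous_intros)
  moreover have "(a, b, c) \<in> V" using abc by (simp add: V_def B_def)
  ultimately obtain R where R: "R > 0" and sub: "ball a R \<times> ball b R \<times> ball c R \<subseteq> V"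
    using open_contains_polydisc by blast
  have dom: "(x, y, z) \<in> log_domain" if "x \<in> ball a R" "y \<in> ball b R" "z \<in> ball c R" for x y z
    using sub that by (auto simp: V_def)
  have par: "(x, y, z) \<in> parameters" "Re y > 0" if "x \<in> ball a R" "y \<in> ball b R" "z \<in> ball c R" for x y z
    using dom[OF that] by (auto simp: log_domain_def parameters_def)
  show "\<exists>\<rho>>0. \<exists>C. \<forall>x y z. cmod (x - a) < \<rho> \<and> cmod (y - b) < \<rho> \<and> cmod (z - c) < \<rho> \<longrightarrow>
        ((\<lambda>(i, j, k). C (i, j, k) * (x - a) ^ i * (y - b) ^ j * (z - c) ^ k) has_sum ?F (x, y, z)) UNIV"
  proof (rule separately_holomorphic_power_series[OF R])
    show "continuous_on (ball a R \<times> ball b R \<times> ball c R) ?F"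
      using sub by (intro continuous_on_subset[OF cont]) (auto simp: V_def)
    show "cmod (?F (x, y, z)) \<le> B" if "x \<in> ball a R" "y \<in> ball b R" "z \<in> ball c R" for x y z
      using sub that by (force simp: V_def)
  next
    fix y z assume yz: "y \<in> ball b R" "z \<in> ball c R"
    have "(\<lambda>x. partition_val (x, y, z)) holomorphic_on ball a R"
      using par(1)[OF _ yz] r_pos p
      by (intro holomorphic_on_partition_curve)
         (auto simp: dist_Pair_Pair power_coupling_def confinement_def intro!: holomorphic_intros)
    thus "(\<lambda>x. ?F (x, y, z)) holomorphic_on ball a R"
      by (intro holomorphic_intros nonpos dom yz)
  next
    fix x z assume xz: "x \<in> ball a R" "z \<in> ball c R"
    \<comment> \<open>The couplings are affine in \<kappa> and \<Lambda>; only in \<beta> do they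
      involve \<open>Ln\<close>, which requires staying off its cut.\<close>
    have pos: "y \<notin> \<real>\<^sub>\<le>\<^sub>0" if "y \<in> ball b R" for y
      using par(2)[OF xz(1) that xz(2)] by (rule not_nonpos)
    have "(\<lambda>y. partition_val (x, y, z)) holomorphic_on ball b R"
    proof (rule holomorphic_on_partition_curve)
      show "(\<lambda>y. power_coupling (x, y, z)) holomorphic_on ball b R"
        unfolding power_coupling_def case_prod_conv using p by (intro holomorphic_intros pos) auto
      show "(\<lambda>y. confinement (x, y, z)) holomorphic_on ball b R"
        unfolding confinement_def case_prod_conv using r_pos by (intro holomorphic_intros pos) auto
    qed (use par(1)[OF xz(1) _ xz(2)] in \<open>auto simp: dist_Pair_Pair\<close>)
    thus "(\<lambda>y. ?F (x, y, z)) holomorphic_on ball b R"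
      by (intro holomorphic_intros nonpos dom xz)
  next
    fix x y assume xy: "x \<in> ball a R" "y \<in> ball b R"
    have "(\<lambda>z. partition_val (x, y, z)) holomorphic_on ball c R"
      using par(1)[OF xy] r_pos p
      by (intro holomorphic_on_partition_curve)
         (auto simp: dist_Pair_Pair power_coupling_def confinement_def intro!: holomorphic_intros)
    thus "(\<lambda>z. ?F (x, y, z)) holomorphic_on ball c R"
      by (intro holomorphic_intros nonpos dom xy)
  qed
qed

section \<open>Agreement with the given partition functions\<close>

lemma partition_eq_complex:
  assumes "Re \<beta> > 0"
  shows "partition_function_complex L m p r M \<kappa> \<beta> \<Lambda> = partition_val (\<kappa>, \<beta>, \<Lambda>)"
proof -
  have "\<beta> \<noteq> 0" using assms by auto
  hence "\<beta> powr s = exp (s * Ln \<beta>)" for s by (simp add: powr_def)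
  thus ?thesis using p
    by (simp add: partition_function_complex_def partition_val_def weight_def power_coupling_def confinement_def
        circle_norm_powr circle_norm_2_square circle_norm_2_powr)
qed

lemma parameters_iff:
  assumes "Re \<beta> > 0"
  shows "(\<kappa>, \<beta>, \<Lambda>) \<in> parameters \<longleftrightarrow> Re (\<beta> powr of_real (1 - r) * \<kappa>) > 0"
proof -
  have "\<beta> \<noteq> 0" using assms by auto
  thus ?thesis using assms r_pos
    by (simp add: parameters_def confinement_def powr_def zero_less_divide_iff)
qed

lemma partition_real:
  fixes \<kappa> \<beta> \<Lambda> :: real
  assumes \<kappa>: "\<kappa> > 0" and \<beta>: "\<beta> > 0" and G\<beta>: "gaussian_field L m \<beta> N"
  shows "partition_val (of_real \<kappa>, of_real \<beta>, of_real \<Lambda>) = of_real (partition_function L m p r N \<kappa> \<beta> \<Lambda>)"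
    and "partition_function L m p r N \<kappa> \<beta> \<Lambda> > 0"
    and "(of_real \<kappa>, of_real \<beta>, of_real \<Lambda>) \<in> log_domain"
proof -
  let ?q = "(of_real \<kappa>, of_real \<beta>, of_real \<Lambda>) :: complex \<times> complex \<times> complex"
  \<comment> \<open>\<open>F\<close> is the integrand at inverse temperature \<beta> in terms of the
    masses of sqrt \<beta> times the field. Evaluated at the masses of \<psi> itself it becomes the
    weight under \<open>M\<close>, so the change of variables is an instance of
    \<open>gaussian_field_scaling\<close>.\<close>
  define F where "F P Q = exp (\<beta> * (\<Lambda> / p * (\<beta> powr (- p / 2) * P) + m\<^sup>2 / 2 * (Q / \<beta>) - \<kappa> / r * (Q / \<beta>) powr r))" for P Q
  have Fm: "case_prod F \<in> borel_measurable (borel \<Otimes>\<^sub>M borel)"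
    unfolding F_def case_prod_unfold by measurable
  have pw: "(of_real \<beta> :: complex) powr of_real s = of_real (\<beta> powr s)" for s
    using \<beta> by (intro powr_of_real) simp
  have par: "?q \<in> parameters"
    using \<beta> \<kappa> by (subst parameters_iff) (auto simp: pw simp del: of_real_diff)
  have "partition_function L m p r N \<kappa> \<beta> \<Lambda> = (LINT \<phi>|N. F (\<beta> powr (p / 2) * lp_mass L p \<phi>) (\<beta> * lp_mass L 2 \<phi>))"
    unfolding partition_function_def F_def
  proof (intro Bochner_Integration.integral_cong refl)
    fix \<phi>
    have "\<beta> powr (- p / 2) * (\<beta> powr (p / 2) * lp_mass L p \<phi>) = lp_mass L p \<phi>"
      using \<beta> by (simp add: mult.assoc[symmetric] flip: powr_add)
    thus "exp (\<beta> * (\<Lambda> / p * circle_norm L p \<phi> powr p + m\<^sup>2 / 2 * (circle_norm L 2 \<phi>)\<^sup>2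
        - \<kappa> / r * circle_norm L 2 \<phi> powr (2 * r))) =
      exp (\<beta> * (\<Lambda> / p * (\<beta> powr (- p / 2) * (\<beta> powr (p / 2) * lp_mass L p \<phi>))
        + m\<^sup>2 / 2 * (\<beta> * lp_mass L 2 \<phi> / \<beta>) - \<kappa> / r * (\<beta> * lp_mass L 2 \<phi> / \<beta>) powr r))"
      using \<beta> p by (simp add: circle_norm_powr circle_norm_2_square circle_norm_2_powr)
  qed
  also have "\<dots> = (LINT \<psi>|M. F (lp_mass L p \<psi>) (lp_mass L 2 \<psi>))"
    by (rule gaussian_field_scaling[OF L \<beta> m G\<beta> G Fm])
  finally have Z: "partition_function L m p r N \<kappa> \<beta> \<Lambda> = (LINT \<psi>|M. F (lp_mass L p \<psi>) (lp_mass L 2 \<psi>))" .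
  have w: "weight ?q \<psi> = of_real (F (lp_mass L p \<psi>) (lp_mass L 2 \<psi>))" for \<psi>
  proof -
    have "exp (of_real (1 - p / 2) * Ln (of_real \<beta>)) = complex_of_real (\<beta> powr (1 - p / 2))"
         "exp (of_real (1 - r) * Ln (of_real \<beta>)) = complex_of_real (\<beta> powr (1 - r))"
      using \<beta> pw[of "1 - p / 2"] pw[of "1 - r"] by (simp_all add: powr_def)
    hence "weight ?q \<psi> = of_real (exp (\<Lambda> * \<beta> powr (1 - p / 2) / p * lp_mass L p \<psi> + m\<^sup>2 / 2 * lp_mass L 2 \<psi>
        - \<beta> powr (1 - r) * \<kappa> / r * lp_mass L 2 \<psi> powr r))"
      unfolding weight_def power_coupling_def confinement_def case_prod_conv
      by (simp only: of_real_mult[symmetric] of_real_divide[symmetric] of_real_add[symmetric]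
          of_real_diff[symmetric] exp_of_real)
    also have "\<Lambda> * \<beta> powr (1 - p / 2) / p * lp_mass L p \<psi> + m\<^sup>2 / 2 * lp_mass L 2 \<psi>
        - \<beta> powr (1 - r) * \<kappa> / r * lp_mass L 2 \<psi> powr r
      = \<beta> * (\<Lambda> / p * (\<beta> powr (- p / 2) * lp_mass L p \<psi>) + m\<^sup>2 / 2 * (lp_mass L 2 \<psi> / \<beta>)
          - \<kappa> / r * (lp_mass L 2 \<psi> / \<beta>) powr r)"
    proof -
      have "\<beta> powr (1 - p / 2) = \<beta> * \<beta> powr (- p / 2)" "\<beta> powr (1 - r) = \<beta> * \<beta> powr (- r)"
        using \<beta> by (simp_all add: powr_mult_base)
      moreover have "(lp_mass L 2 \<psi> / \<beta>) powr r = \<beta> powr (- r) * lp_mass L 2 \<psi> powr r"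
        by (simp only: powr_divide powr_minus) (simp add: divide_inverse)
      ultimately show ?thesis using \<beta> by (simp add: algebra_simps)
    qed
    finally show ?thesis by (simp add: F_def)
  qed
  show eq: "partition_val ?q = of_real (partition_function L m p r N \<kappa> \<beta> \<Lambda>)"
    unfolding partition_val_def w Z by (rule integral_complex_of_real)
  have "integrable M (\<lambda>\<psi>. Re (weight ?q \<psi>))" using integrable_weight[OF par] by (rule integrable_Re)
  hence int: "integrable M (\<lambda>\<psi>. F (lp_mass L p \<psi>) (lp_mass L 2 \<psi>))" unfolding w by simp
  \<comment> \<open>A nonnegative integrable function with integral 0 vanishes almost everywhere,
    but \<open>F\<close> is an exponential and \<open>M\<close> a probability measure.\<close>
  have "(LINT \<psi>|M. F (lp_mass L p \<psi>) (lp_mass L 2 \<psi>)) \<noteq> 0"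
  proof
    assume "(LINT \<psi>|M. F (lp_mass L p \<psi>) (lp_mass L 2 \<psi>)) = 0"
    hence "AE \<psi> in M. F (lp_mass L p \<psi>) (lp_mass L 2 \<psi>) = 0"
      by (subst (asm) integral_nonneg_eq_0_iff_AE[OF int]) (auto simp: F_def)
    thus False by (simp add: F_def AE_False)
  qed
  moreover have "(LINT \<psi>|M. F (lp_mass L p \<psi>) (lp_mass L 2 \<psi>)) \<ge> 0"
    by (intro integral_nonneg_AE) (auto simp: F_def)
  ultimately show pos: "partition_function L m p r N \<kappa> \<beta> \<Lambda> > 0" unfolding Z by linarith
  show "?q \<in> log_domain" using par pos by (simp add: log_domain_def eq)
qed

end

theorem theorem4p1:
  fixes L m p r :: real
    and \<mu> :: "real \<Rightarrow> (real \<Rightarrow>\<^sub>C complex) measure"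
  assumes "L > 0" and "m > 0" and "2 < p" and "p < 6"
    and "\<exists>\<alpha>::real. 0 < \<alpha> \<and> \<alpha> < 1/2 \<and> 4 * \<alpha> + 4 - p > 0
           \<and> r > (2 * \<alpha> * p + 2) / (4 * \<alpha> + 4 - p)"
    and "\<And>\<beta>. \<beta> > 0 \<Longrightarrow> gaussian_field L m \<beta> (\<mu> \<beta>)"
  shows "\<exists>(D :: (complex \<times> complex \<times> complex) set) (logZ :: complex \<times> complex \<times> complex \<Rightarrow> complex).
    open D \<and> connected D \<and>
    (\<forall>(\<kappa>, \<beta>, \<Lambda>) \<in> D. Re \<beta> > 0 \<and> Re (\<beta> powr of_real (1 - r) * \<kappa>) > 0) \<and>
    (\<exists>\<delta> :: real \<Rightarrow> real \<Rightarrow> real \<Rightarrow> real.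
       (\<forall>k b l. k > 0 \<and> b > 0 \<longrightarrow> \<delta> k b l > 0) \<and>
       (\<forall>\<kappa> \<beta> \<Lambda>. Re \<beta> > 0 \<and> Re \<kappa> > 0 \<and>
          \<bar>Im \<beta>\<bar> < \<delta> (Re \<kappa>) (Re \<beta>) (Re \<Lambda>) \<and>
          \<bar>Im \<kappa>\<bar> < \<delta> (Re \<kappa>) (Re \<beta>) (Re \<Lambda>) \<and>
          \<bar>Im \<Lambda>\<bar> < \<delta> (Re \<kappa>) (Re \<beta>) (Re \<Lambda>) \<longrightarrow> (\<kappa>, \<beta>, \<Lambda>) \<in> D)) \<and>
    analytic3_on logZ D \<and>
    (\<forall>(\<kappa>, \<beta>, \<Lambda>) \<in> D.
       exp (logZ (\<kappa>, \<beta>, \<Lambda>)) = partition_function_complex L m p r (\<mu> 1) \<kappa> \<beta> \<Lambda>) \<and>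
    (\<forall>\<kappa> \<beta> \<Lambda> :: real. \<kappa> > 0 \<and> \<beta> > 0 \<longrightarrow>
       partition_function L m p r (\<mu> \<beta>) \<kappa> \<beta> \<Lambda> > 0 \<and>
       logZ (of_real \<kappa>, of_real \<beta>, of_real \<Lambda>)
         = of_real (ln (partition_function L m p r (\<mu> \<beta>) \<kappa> \<beta> \<Lambda>)))"
proof -
  interpret pressure L m p r "\<mu> 1"
    using assms exponent_condition[of p _ r] by unfold_locales auto
  define q :: "real \<times> real \<times> real \<Rightarrow> complex \<times> complex \<times> complex"
    where "q = (\<lambda>(k, b, l). (of_real k, of_real b, of_real l))"
  \<comment> \<open>The real parameters. They form a connected subset of \<open>log_domain\<close>,
    so they lie in a single component; the base point (1, 1, 0) only serves to name it.\<close>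
  define S where "S = q ` ({0<..} \<times> {0<..} \<times> UNIV)"
  have qS: "q (k, b, l) \<in> S" if "k > 0" "b > 0" for k b l
    using that by (auto simp: S_def)
  have "connected S" unfolding S_def q_def case_prod_unfold
    by (intro connected_continuous_image continuous_intros connected_Times) auto
  have S_sub: "S \<subseteq> log_domain"
    using partition_real(3)[OF _ _ assms(6)] by (auto simp: S_def q_def)
  define D where "D = connected_component_set log_domain (q (1, 1, 0))"
  have SD: "S \<subseteq> D"
    unfolding D_def using \<open>connected S\<close> S_sub qS by (intro connected_component_maximal) auto
  have D_sub: "D \<subseteq> log_domain" unfolding D_def by (rule connected_component_subset)
  have D_params: "Re \<beta> > 0 \<and> (\<kappa>, \<beta>, \<Lambda>) \<in> parameters \<and> Re (partition_val (\<kappa>, \<beta>, \<Lambda>)) > 0" if "(\<kappa>, \<beta>, \<Lambda>) \<in> D" for \<kappa> \<beta> \<Lambda>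
    using that D_sub by (auto simp: log_domain_def parameters_def)
  \<comment> \<open>The implication stands inside the existential so that a choice function on all
    real triples can be extracted; outside k, b > 0 any positive radius will do.\<close>
  have "\<exists>R>0. k > 0 \<and> b > 0 \<longrightarrow> ball (of_real k) R \<times> ball (of_real b) R \<times> ball (of_real l) R \<subseteq> D" for k b l :: real
  proof (cases "k > 0 \<and> b > 0")
    case True
    hence "q (k, b, l) \<in> D" using qS SD by auto
    moreover have "open D" unfolding D_def by (intro open_connected_component open_log_domain)
    ultimately show ?thesis using open_contains_polydisc[of D] unfolding q_def case_prod_conv by blast
  qed (use zero_less_one in blast)
  then obtain \<delta> where \<delta>: "\<And>k b l. \<delta> k b l > 0"
    "\<And>k b l. k > 0 \<Longrightarrow> b > 0 \<Longrightarrow> ball (of_real k) (\<delta> k b l) \<times> ball (of_real b) (\<delta> k b l) \<times> ball (of_real l) (\<delta> k b l) \<subseteq> D"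
    by metis
  \<comment> \<open>The distance of z from its real part is |Im z|, so small imaginary parts put a
    point into the polydisc around its real parts.\<close>
  have near: "z \<in> ball (of_real (Re z)) d" if "\<bar>Im z\<bar> < d" for z d
    using that by (simp add: dist_norm cmod_def)
  show ?thesis
  proof (rule exI[of _ D], rule exI[of _ "\<lambda>q. Ln (partition_val q)"], intro conjI)
    show "open D" unfolding D_def by (intro open_connected_component open_log_domain)
    show "connected D" unfolding D_def by simp
    show "\<forall>(\<kappa>, \<beta>, \<Lambda>) \<in> D. Re \<beta> > 0 \<and> Re (\<beta> powr of_real (1 - r) * \<kappa>) > 0"
      using D_params parameters_iff by fast
    show "\<exists>\<delta> :: real \<Rightarrow> real \<Rightarrow> real \<Rightarrow> real.
       (\<forall>k b l. k > 0 \<and> b > 0 \<longrightarrow> \<delta> k b l > 0) \<and>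
       (\<forall>\<kappa> \<beta> \<Lambda>. Re \<beta> > 0 \<and> Re \<kappa> > 0 \<and>
          \<bar>Im \<beta>\<bar> < \<delta> (Re \<kappa>) (Re \<beta>) (Re \<Lambda>) \<and>
          \<bar>Im \<kappa>\<bar> < \<delta> (Re \<kappa>) (Re \<beta>) (Re \<Lambda>) \<and>
          \<bar>Im \<Lambda>\<bar> < \<delta> (Re \<kappa>) (Re \<beta>) (Re \<Lambda>) \<longrightarrow> (\<kappa>, \<beta>, \<Lambda>) \<in> D)"
    proof (intro exI[of _ \<delta>] conjI allI impI)
      fix \<kappa> \<beta> \<Lambda> :: complex
      assume "Re \<beta> > 0 \<and> Re \<kappa> > 0 \<and>
          \<bar>Im \<beta>\<bar> < \<delta> (Re \<kappa>) (Re \<beta>) (Re \<Lambda>) \<and>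
          \<bar>Im \<kappa>\<bar> < \<delta> (Re \<kappa>) (Re \<beta>) (Re \<Lambda>) \<and>
          \<bar>Im \<Lambda>\<bar> < \<delta> (Re \<kappa>) (Re \<beta>) (Re \<Lambda>)"
      thus "(\<kappa>, \<beta>, \<Lambda>) \<in> D"
        using \<delta>(2)[of "Re \<kappa>" "Re \<beta>" "Re \<Lambda>"] near by blast
    qed (rule \<delta>(1))
    show "analytic3_on (\<lambda>q. Ln (partition_val q)) D"
      using analytic3_on_log D_sub unfolding analytic3_on_def by blast
    show "\<forall>(\<kappa>, \<beta>, \<Lambda>) \<in> D.
       exp (Ln (partition_val (\<kappa>, \<beta>, \<Lambda>))) = partition_function_complex L m p r (\<mu> 1) \<kappa> \<beta> \<Lambda>"
    proof clarify
      fix \<kappa> \<beta> \<Lambda> assume "(\<kappa>, \<beta>, \<Lambda>) \<in> D"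
      from D_params[OF this] show "exp (Ln (partition_val (\<kappa>, \<beta>, \<Lambda>))) = partition_function_complex L m p r (\<mu> 1) \<kappa> \<beta> \<Lambda>"
        by (subst exp_Ln) (auto simp: partition_eq_complex)
    qed
    show "\<forall>\<kappa> \<beta> \<Lambda> :: real. \<kappa> > 0 \<and> \<beta> > 0 \<longrightarrow>
       partition_function L m p r (\<mu> \<beta>) \<kappa> \<beta> \<Lambda> > 0 \<and>
       Ln (partition_val (of_real \<kappa>, of_real \<beta>, of_real \<Lambda>))
         = of_real (ln (partition_function L m p r (\<mu> \<beta>) \<kappa> \<beta> \<Lambda>))"
      using partition_real(1,2)[OF _ _ assms(6)] by (simp add: Ln_of_real)
  qed
qed

end
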